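(* (a) There are exactly $37$ isomorphism types of vector space partitions of $\mathbb{F}_2^7$ of type $(3^{16}4^1)$. (b) There are exactly $37$ isomorphism types of binary $3\times 4$ MRD codes of minimum rank distance $3$.
   Context: A vector space partition of $V=\mathbb{F}_2^7$ is a set of nonzero subspaces partitioning the set of $1$-dimensional subspaces; type $(3^{16}4^1)$ means sixteen $3$-dimensional members and one $4$-dimensional member; isomorphism is via $\mathrm{GL}(7,2)$. The rank distance on $\mathbb{F}_2^{3\times 4}$ is $d(A,B)=\mathrm{rk}(A-B)$; a rank metric code is a subset $\mathcal{C}\subseteq\mathbb{F}_2^{3\times 4}$ with minimum distance the minimum rank distance between distinct elements; an MRD code with $m\le n$ ($m\times n$ matrices over $\mathbb{F}_q$) and minimum distance $d$ is one of size $q^{(m-d+1)n}$ (here size $16$). Two rank metric codes are isomorphic if one is mapped onto the other by a map $A\mapsto PAQ+R$ with $P\in\mathrm{GL}(3,2)$, $Q\in\mathrm{GL}(4,2)$, $R\in\mathbb{F}_2^{3\times 4}$ (these are all isometries of the rank metric space in this non-square case). *)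

theory Defs
  imports "HOL-Analysis.Analysis" "HOL-Library.Multiset" "HOL-Library.Z2"
begin

text \<open>The field with two elements is the type \<^typ>\<open>bit\<close>; the library provides its field
  structure, but not its finiteness.\<close>

instance bit :: finite
proof
  have "UNIV = {0, 1 :: bit}"
    using bit_not_zero_iff by blast
  then show "finite (UNIV :: bit set)"
    by (metis finite.emptyI finite.insertI)
qed

definition num_iso_types :: "'x set \<Rightarrow> ('x \<Rightarrow> 'x \<Rightarrow> bool) \<Rightarrow> nat" where
  "num_iso_types S r = card (S // {(x, y). x \<in> S \<and> y \<in> S \<and> r x y})"


section \<open>Vector space partitions\<close>

definition vector_space_partition :: "('a::field ^ 'n) set set \<Rightarrow> bool" where
  "vector_space_partition P \<longleftrightarrow>
     (\<forall>U\<in>P. vec.subspace U \<and> U \<noteq> {0}) \<and>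
     (\<forall>L. vec.subspace L \<and> vec.dim L = 1 \<longrightarrow> (\<exists>!U. U \<in> P \<and> L \<subseteq> U))"

text \<open>The type of a vector space partition is the multiset of the dimensions of its members;
  e.g. \<open>(3\<^sup>1\<^sup>6 4\<^sup>1)\<close> is \<open>replicate_mset 16 3 + replicate_mset 1 4\<close>.
  As \<open>mset_set\<close> sends infinite sets to \<open>{#}\<close>, this is meaningful for finite \<open>P\<close> only;
  over a finite field every \<open>P\<close> is finite.\<close>

definition vsp_type :: "('a::{field,finite} ^ 'n) set set \<Rightarrow> nat multiset" where
  "vsp_type P = image_mset vec.dim (mset_set P)"

definition vsp_isomorphic :: "('a::field ^ 'n) set set \<Rightarrow> ('a ^ 'n) set set \<Rightarrow> bool" where
  "vsp_isomorphic P Q \<longleftrightarrow>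
     (\<exists>A :: 'a ^ 'n ^ 'n. invertible A \<and> Q = (\<lambda>U. (\<lambda>x. A *v x) ` U) ` P)"


section \<open>Rank metric codes\<close>

text \<open>The \<open>m \<times> n\<close> matrices over \<open>'a\<close> form the type \<open>'a ^ 'n ^ 'm\<close>: the row index comes last.\<close>

definition rank_dist :: "'a::field ^ 'n ^ 'm \<Rightarrow> 'a ^ 'n ^ 'm \<Rightarrow> nat" where
  "rank_dist A B = rank (A - B)"

text \<open>Meaningful only for codes with at least two elements; otherwise \<open>Min\<close> is taken over the
  empty set.\<close>

definition min_rank_dist :: "('a::{field,finite} ^ 'n ^ 'm) set \<Rightarrow> nat" where
  "min_rank_dist C = Min {rank_dist A B | A B. A \<in> C \<and> B \<in> C \<and> A \<noteq> B}"

text \<open>Since \<open>d \<le> m\<close> for every code with at least two elements, the subtraction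
  \<open>m - d\<close> on natural numbers does not truncate.\<close>

definition MRD_code :: "nat \<Rightarrow> ('a::{field,finite} ^ 'n ^ 'm) set \<Rightarrow> bool" where
  "MRD_code d C \<longleftrightarrow>
     CARD('m) \<le> CARD('n) \<and>
     min_rank_dist C = d \<and>
     card C = CARD('a) ^ ((CARD('m) - d + 1) * CARD('n))"

definition code_isomorphic ::
    "('a::field ^ 'n ^ 'm) set \<Rightarrow> ('a ^ 'n ^ 'm) set \<Rightarrow> bool" where
  "code_isomorphic C D \<longleftrightarrow>
     (\<exists>(P :: 'a ^ 'm ^ 'm) (Q :: 'a ^ 'n ^ 'n) (R :: 'a ^ 'n ^ 'm).
        invertible P \<and> invertible Q \<and> D = (\<lambda>A. P ** A ** Q + R) ` C)"


section \<open>The isomorphism relations are equivalence relations\<close>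

lemma invertibleE:
  fixes A :: "'a::field ^ 'n ^ 'n"
  assumes "invertible A"
  obtains B where "invertible B" "A ** B = mat 1" "B ** A = mat 1"
  using assms unfolding invertible_def by blast

lemma invertible_mat_1: "invertible (mat 1 :: 'a::field ^ 'n ^ 'n)"
  unfolding invertible_def by (rule exI[of _ "mat 1"]) simp

lemma matrix_add_rdistrib:
  fixes A B :: "'a::semiring_1 ^ 'n ^ 'm"
  shows "(A + B) ** C = A ** C + B ** C"
  by (simp add: vec_eq_iff matrix_matrix_mult_def sum.distrib distrib_right)

lemma equivp_vsp_isomorphic:
  "equivp (vsp_isomorphic :: ('a::field ^ 'n) set set \<Rightarrow> _)"
proof (rule equivpI)
  show "reflp (vsp_isomorphic :: ('a ^ 'n) set set \<Rightarrow> _)"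
  proof (rule reflpI)
    fix P :: "('a ^ 'n) set set"
    have "P = (\<lambda>U. (\<lambda>x. (mat 1 :: 'a ^ 'n ^ 'n) *v x) ` U) ` P"
      by simp
    then show "vsp_isomorphic P P"
      unfolding vsp_isomorphic_def by (intro exI conjI) (rule invertible_mat_1)
  qed
  show "symp (vsp_isomorphic :: ('a ^ 'n) set set \<Rightarrow> _)"
  proof (rule sympI)
    fix P Q :: "('a ^ 'n) set set"
    assume "vsp_isomorphic P Q"
    then obtain A :: "'a ^ 'n ^ 'n"
      where A: "invertible A" and Q: "Q = (\<lambda>U. (\<lambda>x. A *v x) ` U) ` P"
      unfolding vsp_isomorphic_def by blast
    from A obtain B where B: "invertible B" "B ** A = mat 1"
      by (rule invertibleE)
    have "P = (\<lambda>U. (\<lambda>x. B *v x) ` U) ` Q"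
      by (simp add: Q image_image matrix_vector_mul_assoc B)
    with B(1) show "vsp_isomorphic Q P"
      unfolding vsp_isomorphic_def by (intro exI conjI)
  qed
  show "transp (vsp_isomorphic :: ('a ^ 'n) set set \<Rightarrow> _)"
  proof (rule transpI)
    fix P Q S :: "('a ^ 'n) set set"
    assume "vsp_isomorphic P Q" "vsp_isomorphic Q S"
    then obtain A B :: "'a ^ 'n ^ 'n"
      where A: "invertible A" "Q = (\<lambda>U. (\<lambda>x. A *v x) ` U) ` P"
        and B: "invertible B" "S = (\<lambda>U. (\<lambda>x. B *v x) ` U) ` Q"
      unfolding vsp_isomorphic_def by blast
    have "S = (\<lambda>U. (\<lambda>x. (B ** A) *v x) ` U) ` P"
      by (simp add: A B image_image matrix_vector_mul_assoc)
    then show "vsp_isomorphic P S"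
      unfolding vsp_isomorphic_def
      by (intro exI conjI) (rule invertible_mult[OF B(1) A(1)])
  qed
qed

lemma equivp_code_isomorphic:
  "equivp (code_isomorphic :: ('a::field ^ 'n ^ 'm) set \<Rightarrow> _)"
proof (rule equivpI)
  show "reflp (code_isomorphic :: ('a ^ 'n ^ 'm) set \<Rightarrow> _)"
  proof (rule reflpI)
    fix C :: "('a ^ 'n ^ 'm) set"
    have "C = (\<lambda>A. (mat 1 :: 'a ^ 'm ^ 'm) ** A ** (mat 1 :: 'a ^ 'n ^ 'n) + 0) ` C"
      by simp
    then show "code_isomorphic C C"
      unfolding code_isomorphic_def by (intro exI conjI) (rule invertible_mat_1)+
  qed
  show "symp (code_isomorphic :: ('a ^ 'n ^ 'm) set \<Rightarrow> _)"
  proof (rule sympI)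
    fix C D :: "('a ^ 'n ^ 'm) set"
    assume "code_isomorphic C D"
    then obtain P :: "'a ^ 'm ^ 'm" and Q :: "'a ^ 'n ^ 'n" and R :: "'a ^ 'n ^ 'm"
      where P: "invertible P" and Q: "invertible Q" and D: "D = (\<lambda>A. P ** A ** Q + R) ` C"
      unfolding code_isomorphic_def by blast
    from P obtain P' where P': "invertible P'" "P' ** P = mat 1"
      by (rule invertibleE)
    from Q obtain Q' where Q': "invertible Q'" "Q ** Q' = mat 1"
      by (rule invertibleE)
    have "P' ** (P ** A ** Q + R) ** Q' + (- (P' ** R ** Q')) = A" for A
    proof -
      have "P' ** (P ** A ** Q + R) ** Q' = (P' ** P) ** A ** (Q ** Q') + P' ** R ** Q'"
        by (simp add: matrix_add_ldistrib matrix_add_rdistrib matrix_mul_assoc)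
      then show ?thesis
        by (simp add: P' Q')
    qed
    then have "C = (\<lambda>A. P' ** A ** Q' + (- (P' ** R ** Q'))) ` D"
      by (simp add: D image_image)
    with P'(1) Q'(1) show "code_isomorphic D C"
      unfolding code_isomorphic_def by (intro exI conjI)
  qed
  show "transp (code_isomorphic :: ('a ^ 'n ^ 'm) set \<Rightarrow> _)"
  proof (rule transpI)
    fix C D E :: "('a ^ 'n ^ 'm) set"
    assume "code_isomorphic C D" "code_isomorphic D E"
    then obtain P P' :: "'a ^ 'm ^ 'm" and Q Q' :: "'a ^ 'n ^ 'n" and R R' :: "'a ^ 'n ^ 'm"
      where P: "invertible P" "invertible P'" and Q: "invertible Q" "invertible Q'"
        and D: "D = (\<lambda>A. P ** A ** Q + R) ` C" and E: "E = (\<lambda>A. P' ** A ** Q' + R') ` D"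
      unfolding code_isomorphic_def by blast
    have "E = (\<lambda>A. (P' ** P) ** A ** (Q ** Q') + (P' ** R ** Q' + R')) ` C"
      by (simp add: D E image_image matrix_add_ldistrib matrix_add_rdistrib matrix_mul_assoc
          add.assoc)
    then show "code_isomorphic C E"
      unfolding code_isomorphic_def
      by (intro exI conjI)
        (rule invertible_mult[OF P(2) P(1)], rule invertible_mult[OF Q(1) Q(2)])
  qed
qed

end

theory Submission
  imports Defs
begin

text \<open>A code \<open>C\<close> of the kind considered is mapped bijectively onto \<open>\<bbbF>\<^sub>2\<^sup>4\<close> by every nonzero combination of
  the three rows, hence (by Fourier inversion) two-to-one onto \<open>\<bbbF>\<^sub>2\<^sup>3\<close> by \<open>A \<mapsto> A v\<close> for \<open>v \<noteq> 0\<close>. So the kernels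
  of \<open>A - B\<close>, \<open>A - D\<close> are distinct for distinct \<open>A, B, D \<in> C\<close>. These two facts suffice for an exhaustive
  search for codes containing \<open>0\<close>: branch over the codewords with a prescribed row combination, discard
  all candidates in conflict with the choices made, and cut a branch as soon as it contains an
  isomorphic copy of a configuration already treated. The search is recorded in a certificate, which is
  checked by rewriting. The 37 codes found are told apart by the numbers of triples \<open>A, B, D\<close> of codewords
  for which the kernels of \<open>A - B\<close>, \<open>A - D\<close>, \<open>B - D\<close> add up to zero.

  Lifting turns codes into vector space partitions: \<open>A\<close> becomes the graph \<open>{(y, y A)}\<close>, and the graphs
  are completed by the 4-dimensional space \<open>{(0, x)}\<close>, which is recovered from the partition.\<close>

text \<open>The obstacle is size: there are 2^12 matrices, a code has 16 of them, and every step of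
  the search has to pass through the simplifier. Cutting a branch is sound because of a single
  property, \<open>covered\<close>: every code containing a given partial code is isomorphic to a
  representative. It passes to larger partial codes and along affine maps, so a copy of a covered
  configuration settles the branch, be that configuration small or a whole code. The 37
  representatives are not collected by the search; they are placed in its list of known
  configurations at the start, where they are covered trivially. A leaf with 16 matrices then only
  has to exhibit an isomorphism. The search thus shows completeness of the list, and the invariant
  shows that the list has no repetition. Nested squares in the invariant keep track of how the
  triples are spread over the codewords. The number of partitions is transferred from the codes;
  there, linear maps are handled as additive maps, which over the field with two elements are the
  same.\<close>

section \<open>Counting isomorphism types by representatives and by transfer\<close>

lemma num_iso_types_reps:
  assumes r: "equivp r" and S: "set xs \<subseteq> S" and ex: "\<And>x. x \<in> S \<Longrightarrow> \<exists>y\<in>set xs. r y x"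
    and dist: "distinct xs" and noniso: "\<And>x y. x \<in> set xs \<Longrightarrow> y \<in> set xs \<Longrightarrow> r x y \<Longrightarrow> x = y"
  shows "num_iso_types S r = length xs"
proof -
  let ?r = "{(x, y). x \<in> S \<and> y \<in> S \<and> r x y}"
  have refl: "r x x" for x using r by (simp add: equivp_reflp)
  have trans: "r x y \<Longrightarrow> r y z \<Longrightarrow> r x z" for x y z using r by (rule equivp_transp)
  have sym: "r x y \<Longrightarrow> r y x" for x y using r by (rule equivp_symp)
  have "S // ?r = (\<lambda>x. ?r `` {x}) ` set xs"
  proof
    show "S // ?r \<subseteq> (\<lambda>x. ?r `` {x}) ` set xs"
    proof
      fix X assume "X \<in> S // ?r"
      then obtain x where x: "x \<in> S" "X = ?r `` {x}" by (auto simp: quotient_def)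
      from ex[OF x(1)] obtain y where y: "y \<in> set xs" "r y x" by blast
      have "r x z \<longleftrightarrow> r y z" for z
        using trans[OF y(2), of z] trans[OF sym[OF y(2)], of z] by blast
      then have "X = ?r `` {y}" using x y(1) S by auto
      then show "X \<in> (\<lambda>x. ?r `` {x}) ` set xs" using y by blast
    qed
    show "(\<lambda>x. ?r `` {x}) ` set xs \<subseteq> S // ?r" using S by (auto simp: quotient_def)
  qed
  moreover have "inj_on (\<lambda>x. ?r `` {x}) (set xs)"
  proof (rule inj_onI)
    fix x y assume xy: "x \<in> set xs" "y \<in> set xs" "?r `` {x} = ?r `` {y}"
    then have "y \<in> ?r `` {y}" using S refl by auto
    with xy have "r x y" by blast
    with xy noniso show "x = y" by blast
  qed
  ultimately show ?thesis
    unfolding num_iso_types_def using dist by (simp add: card_image distinct_card)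
qed

text \<open>\<open>F\<close> has to reach each class of the target only up to \<open>s\<close>. The
  bijection between classes sends \<open>X\<close> to the closure of its image under
  \<open>s\<close>.\<close>

lemma num_iso_types_transfer:
  assumes r: "equivp r" and s: "equivp s" and F: "\<And>x. x \<in> S \<Longrightarrow> F x \<in> S'"
    and iff: "\<And>x y. x \<in> S \<Longrightarrow> y \<in> S \<Longrightarrow> r x y \<longleftrightarrow> s (F x) (F y)"
    and surj: "\<And>y. y \<in> S' \<Longrightarrow> \<exists>x\<in>S. s (F x) y"
    and num: "num_iso_types S r = n" "0 < n"
  shows "num_iso_types S' s = n"
proof -
  let ?r = "{(x, y). x \<in> S \<and> y \<in> S \<and> r x y}" and ?s = "{(x, y). x \<in> S' \<and> y \<in> S' \<and> s x y}"
  have r': "r x x" "r x y \<Longrightarrow> r y x" "r x y \<Longrightarrow> r y z \<Longrightarrow> r x z" for x y z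
    using r by (auto simp: equivp_reflp intro: equivp_transp equivp_symp)
  have s': "s x x" "s x y \<Longrightarrow> s y x" "s x y \<Longrightarrow> s y z \<Longrightarrow> s x z" for x y z
    using s by (auto simp: equivp_reflp intro: equivp_transp equivp_symp)
  let ?h = "\<lambda>X. ?s `` (F ` X)"
  \<comment> \<open>The image of one class lies within one class, so closing it under
    \<open>s\<close> yields precisely the class of \<open>F x\<close>.\<close>
  have h: "?h (?r `` {x}) = ?s `` {F x}" if "x \<in> S" for x
  proof
    show "?h (?r `` {x}) \<subseteq> ?s `` {F x}"
    proof
      fix z assume "z \<in> ?h (?r `` {x})"
      then obtain y where "y \<in> S" "r x y" "z \<in> S'" "s (F y) z" by auto
      then show "z \<in> ?s `` {F x}"
        using that iff[of x y] s'(3)[of "F x" "F y" z] F by auto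
    qed
    show "?s `` {F x} \<subseteq> ?h (?r `` {x})" using that r'(1)[of x] by auto
  qed
  have "bij_betw ?h (S // ?r) (S' // ?s)"
    unfolding bij_betw_def
  proof
    show "inj_on ?h (S // ?r)"
    proof (rule inj_onI)
      fix X Y assume XY: "X \<in> S // ?r" "Y \<in> S // ?r" "?h X = ?h Y"
      then obtain x y where x: "x \<in> S" "X = ?r `` {x}" and y: "y \<in> S" "Y = ?r `` {y}"
        by (auto simp: quotient_def)
      then have "?s `` {F x} = ?s `` {F y}" using XY h by simp
      moreover have "F y \<in> ?s `` {F y}" using F y s'(1) by auto
      ultimately have "s (F x) (F y)" by blast
      then have "r x y" using iff x y by blast
      then have "r x z \<longleftrightarrow> r y z" for z
        using r'(3)[of x y z] r'(3)[OF r'(2), of x y z] by blast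
      then show "X = Y" using x y by auto
    qed
    show "?h ` (S // ?r) = S' // ?s"
    proof
      show "?h ` (S // ?r) \<subseteq> S' // ?s"
      proof (rule image_subsetI)
        fix X assume "X \<in> S // ?r"
        then obtain x where x: "x \<in> S" "X = ?r `` {x}" by (rule quotientE)
        have "?h X = ?s `` {F x}" unfolding x(2) by (rule h[OF x(1)])
        then show "?h X \<in> S' // ?s" using F[OF x(1)] by (simp only: quotientI)
      qed
      show "S' // ?s \<subseteq> ?h ` (S // ?r)"
      proof
        fix Y assume "Y \<in> S' // ?s"
        then obtain y where y: "y \<in> S'" "Y = ?s `` {y}" by (auto simp: quotient_def)
        from surj[OF y(1)] obtain x where x: "x \<in> S" "s (F x) y" by blast
        have "s y z \<longleftrightarrow> s (F x) z" for z
          using s'(3)[OF x(2), of z] s'(3)[OF s'(2)[OF x(2)], of z] by blast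
        then have "Y = ?s `` {F x}" using x(1) y F by auto
        also have "\<dots> = ?h (?r `` {x})" using h[OF x(1)] by simp
        finally show "Y \<in> ?h ` (S // ?r)" using quotientI[OF x(1), of ?r] by (rule image_eqI)
      qed
    qed
  qed
  then show ?thesis using num unfolding num_iso_types_def by (simp add: bij_betw_same_card)
qed

section \<open>Vectors over the field with two elements\<close>

lemma bit_vec_diff: "x - y = x + y" for x y :: "bit ^ 'n"
  by (simp add: vec_eq_iff)

lemma bit_vec_double [simp]: "x + x = 0" for x :: "bit ^ 'n"
  by (simp add: vec_eq_iff flip: mult_2)

lemma bit_mat_diff: "x - y = x + y" for x y :: "bit ^ 'n ^ 'm"
  by (simp add: vec_eq_iff)

lemma bit_mat_double [simp]: "x + x = 0" for x :: "bit ^ 'n ^ 'm"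
  by (simp add: vec_eq_iff flip: mult_2)

lemma UNIV_bit: "(UNIV :: bit set) = {0, 1}"
  using bit_not_zero_iff by blast

lemma card_bit [simp]: "CARD(bit) = 2"
  by (simp add: UNIV_bit)

lemma card_bit_vec [simp]: "CARD(bit ^ 'n) = 2 ^ CARD('n)"
  by simp

lemma bit_scale: "a *s x = (if a = 0 then 0 else x)" for x :: "bit ^ 'n"
  by (cases a) auto

lemma subspace_bit_iff:
  "vec.subspace U \<longleftrightarrow> 0 \<in> U \<and> (\<forall>x\<in>U. \<forall>y\<in>U. x + y \<in> U)" for U :: "(bit ^ 'n) set"
  by (auto simp: vec.subspace_def bit_scale)

text \<open>A vector outside a span doubles it: as the only scalars are 0 and 1, the new span is the
  disjoint union of the old one and its translate by \<open>b\<close>.\<close>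

lemma card_span_bit:
  fixes B :: "(bit ^ 'n) set"
  assumes "vec.independent B"
  shows "card (vec.span B) = 2 ^ card B"
proof -
  have "finite B" by simp
  then show ?thesis using assms
  proof (induction B)
    case (insert b B)
    let ?V = "vec.span B"
    have b: "b \<notin> ?V" and ind: "vec.independent B"
      using insert by (auto simp: vec.independent_insert)
    have "vec.span (insert b B) = ?V \<union> (\<lambda>x. b + x) ` ?V"
    proof -
      have "x \<in> vec.span (insert b B) \<longleftrightarrow> x \<in> ?V \<or> x - b \<in> ?V" for x
        by (subst vec.span_breakdown_eq) (auto simp: bit_scale split: if_splits)
      moreover have "x - b \<in> ?V \<longleftrightarrow> x \<in> (\<lambda>x. b + x) ` ?V" for x
        by (auto simp: image_iff) (metis add_diff_cancel_left' diff_add_cancel add.commute)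
      ultimately show ?thesis by auto
    qed
    moreover have "?V \<inter> (\<lambda>x. b + x) ` ?V = {}"
    proof -
      have "b \<in> ?V" if "x \<in> ?V" "b + x \<in> ?V" for x
        using vec.span_diff[OF that(2,1)] by simp
      with b show ?thesis by auto
    qed
    ultimately have "card (vec.span (insert b B)) = card ?V + card ((\<lambda>x. b + x) ` ?V)"
      by (simp add: card_Un_disjoint)
    also have "card ((\<lambda>x. b + x) ` ?V) = card ?V"
      by (rule card_image) simp
    finally show ?case using insert ind by simp
  qed simp
qed

lemma card_subspace_bit:
  fixes U :: "(bit ^ 'n) set"
  assumes "vec.subspace U"
  shows "card U = 2 ^ vec.dim U"
proof -
  obtain B where "B \<subseteq> U" "vec.independent B" "U \<subseteq> vec.span B" "card B = vec.dim U"
    by (rule vec.basis_exists)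
  moreover have "vec.span B \<subseteq> U" using calculation assms by (simp add: vec.span_minimal)
  ultimately show ?thesis using card_span_bit[of B] by (simp add: subset_antisym)
qed

text \<open>Scaling by 0 or 1 is respected by every additive map, so all later maps may be given as
  additive functions.\<close>

lemma linear_bit:
  fixes f :: "bit ^ 'n \<Rightarrow> bit ^ 'm"
  assumes "\<And>x y. f (x + y) = f x + f y"
  shows "Vector_Spaces.linear (*s) (*s) f"
proof -
  have "f 0 + f 0 = f 0" using assms[of 0 0] by simp
  then have "f 0 = 0" by simp
  then show ?thesis using assms by unfold_locales (auto simp: bit_scale vec.scale_right_distrib vec.scale_left_distrib)
qed

section \<open>The standard pairing, characters and Fourier inversion\<close>

definition dot :: "'a::comm_ring_1 ^ 'n \<Rightarrow> 'a ^ 'n \<Rightarrow> 'a" where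
  "dot x y = (\<Sum>i\<in>UNIV. x $ i * y $ i)"

lemma dot_add_left: "dot (x + y) z = dot x z + dot y z"
  by (simp add: dot_def algebra_simps sum.distrib)

lemma dot_add_right: "dot z (x + y) = dot z x + dot z y"
  by (simp add: dot_def algebra_simps sum.distrib)

lemma dot_zero [simp]: "dot 0 x = 0" "dot x 0 = 0"
  by (simp_all add: dot_def)

lemma dot_axis: "dot (axis i 1) x = x $ i"
  by (simp add: dot_def axis_def if_distrib[of "\<lambda>x. x * _"] cong: if_cong)

lemma dot_commute: "dot x y = dot y x"
  by (simp add: dot_def mult.commute)

lemma dot_matrix: "dot (u v* A) x = dot u (A *v x)" for A :: "'a::comm_ring_1 ^ 'n ^ 'm"
proof -
  have "dot (u v* A) x = (\<Sum>j\<in>UNIV. \<Sum>i\<in>UNIV. u $ i * A $ i $ j * x $ j)"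
    by (simp add: dot_def vector_matrix_mult_def sum_distrib_left sum_distrib_right mult_ac)
  also have "\<dots> = (\<Sum>i\<in>UNIV. \<Sum>j\<in>UNIV. u $ i * A $ i $ j * x $ j)"
    by (rule sum.swap)
  also have "\<dots> = dot u (A *v x)"
    by (simp add: dot_def matrix_vector_mult_def sum_distrib_left mult_ac)
  finally show ?thesis .
qed

text \<open>The nontrivial additive character of the field. Its values are integers, so that
  character sums can be compared with cardinalities.\<close>

definition chi :: "bit \<Rightarrow> int" where
  "chi b = (if b = 0 then 1 else -1)"

lemma chi_add: "chi (a + b) = chi a * chi b"
  by (cases a; cases b) (simp_all add: chi_def)

lemma chi_simps [simp]: "chi 0 = 1" "chi 1 = -1"
  by (simp_all add: chi_def)

text \<open>Orthogonality of characters: if \<open>z $ i = 1\<close>, adding the \<open>i\<close>-th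
  unit vector to \<open>x\<close> permutes the index set and flips the sign of every term.\<close>

lemma sum_chi_dot:
  fixes z :: "bit ^ 'n"
  shows "(\<Sum>x\<in>UNIV. chi (dot x z)) = (if z = 0 then 2 ^ CARD('n) else 0)"
proof (cases "z = 0")
  case True
  have "(\<Sum>x\<in>(UNIV :: (bit ^ 'n) set). 1) = (2 :: int) ^ CARD('n)"
    by (simp only: sum_constant card_bit_vec) simp
  then show ?thesis using True by (simp add: chi_def)
next
  case False
  then obtain i where i: "z $ i = 1" by (metis bit_not_zero_iff vec_eq_iff zero_index)
  have "(\<Sum>x\<in>UNIV. chi (dot x z)) = (\<Sum>x\<in>UNIV. chi (dot (x + axis i 1) z))"
    by (rule sum.reindex_bij_witness[of _ "\<lambda>x. x + axis i 1" "\<lambda>x. x + axis i 1"])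
      (simp_all add: add.assoc)
  also have "\<dots> = - (\<Sum>x\<in>UNIV. chi (dot x z))"
    by (simp only: dot_add_left chi_add dot_axis i chi_simps mult_minus_right mult_1_right sum_negf)
  finally show ?thesis using False by simp
qed

text \<open>Fourier inversion: a map into \<open>\<bbbF>\<^sub>2\<^sup>3\<close> all of whose nontrivial character sums vanish has fibres of
  equal size.\<close>

lemma card_fibre_of_balanced:
  fixes h :: "'i \<Rightarrow> bit ^ 3"
  assumes J: "finite J" and bal: "\<And>u. u \<noteq> 0 \<Longrightarrow> (\<Sum>j\<in>J. chi (dot u (h j))) = 0"
  shows "8 * card {j \<in> J. h j = w} = card J"
proof -
  have "int (8 * card {j \<in> J. h j = w}) = (\<Sum>j\<in>J. if h j = w then 8 else 0)"
    using J by (simp add: sum.If_cases Int_def)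
  \<comment> \<open>By orthogonality the inner sum is 8 or 0 according to whether
    \<open>h j = w\<close>. After exchanging the sums only the trivial character
    \<open>u = 0\<close> survives.\<close>
  also have "\<dots> = (\<Sum>j\<in>J. \<Sum>u\<in>UNIV. chi (dot u (h j + w)))"
  proof (rule sum.cong[OF refl])
    fix j
    have "h j + w = 0 \<longleftrightarrow> h j = w"
      by (metis add.commute add.left_commute add_0 bit_vec_double)
    then show "(if h j = w then 8 else 0) = (\<Sum>u\<in>UNIV. chi (dot u (h j + w)))"
      by (simp add: sum_chi_dot)
  qed
  also have "\<dots> = (\<Sum>u\<in>UNIV. chi (dot u w) * (\<Sum>j\<in>J. chi (dot u (h j))))"
    by (subst sum.swap) (simp only: dot_add_right chi_add sum_distrib_left mult.commute)
  also have "\<dots> = (\<Sum>u\<in>(UNIV :: (bit ^ 3) set). if u = 0 then int (card J) else 0)"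
    by (rule sum.cong) (auto simp: bal)
  also have "\<dots> = int (card J)" by simp
  finally show ?thesis by simp
qed

section \<open>MRD codes\<close>

text \<open>This is rank three (see \<open>rank_eq_3_iff\<close>), put in terms of row combinations
  because both the search and the lifting work with these.\<close>

definition full :: "bit ^ 4 ^ 3 \<Rightarrow> bool" where
  "full A \<longleftrightarrow> (\<forall>u. u v* A = 0 \<longrightarrow> u = 0)"

lemma vector_matrix_mult_rows: "u v* A = (\<Sum>i\<in>UNIV. u $ i *s row i A)" for A :: "bit ^ 'n ^ 'm"
  by (simp only: vec_eq_iff vector_matrix_mult_def row_def vec_lambda_beta sum_component
      vector_smult_component vec_lambda_eta mult.commute) simp

lemma span_rows: "vec.span (rows A) = range (\<lambda>u. u v* A)" for A :: "bit ^ 'n ^ 'm"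
proof
  have "row i A = axis i 1 v* A" for i
  proof -
    have "axis i (1::bit) $ j *s row j A = (if j = i then row i A else 0)" for j
      by (simp add: axis_def)
    then show ?thesis by (simp add: vector_matrix_mult_rows)
  qed
  then have "rows A \<subseteq> range (\<lambda>u. u v* A)" by (auto simp: rows_def)
  moreover have "vec.subspace (range (\<lambda>u. u v* A))"
    unfolding subspace_bit_iff
    by (metis (no_types, lifting) rangeE rangeI vector_matrix_left_distrib vector_matrix_mult_0)
  ultimately show "vec.span (rows A) \<subseteq> range (\<lambda>u. u v* A)" by (rule vec.span_minimal)
  show "range (\<lambda>u. u v* A) \<subseteq> vec.span (rows A)"
  proof clarify
    show "u v* A \<in> vec.span (rows A)" for u
      unfolding vector_matrix_mult_rows
      by (intro vec.span_sum vec.span_scale vec.span_base) (auto simp: rows_def)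
  qed
qed

lemma card_row_space: "card (range (\<lambda>u. u v* A)) = 2 ^ rank A" for A :: "bit ^ 'n ^ 'm"
  using card_subspace_bit[OF vec.subspace_span[of "rows A"]]
  by (simp add: span_rows[symmetric] row_rank_def_gen)

lemma rank_le: "rank A \<le> 3" for A :: "bit ^ 4 ^ 3"
proof -
  have "2 ^ rank A \<le> CARD(bit ^ 3)"
    unfolding card_row_space[symmetric] by (rule card_image_le) simp
  then have "(2::nat) ^ rank A \<le> 2 ^ 3" by simp
  then show ?thesis by (rule power_le_imp_le_exp[rotated]) simp
qed

text \<open>The row space has \<open>2 ^ rank A\<close> elements and is the image of the eight
  vectors of F_2^3, so it has eight elements exactly when \<open>u v* A\<close> is injective in
  \<open>u\<close>.\<close>

lemma rank_eq_3_iff: "rank A = 3 \<longleftrightarrow> full A"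
proof -
  have "full A \<longleftrightarrow> inj (\<lambda>u. u v* A)"
  proof
    assume A: "full A"
    show "inj (\<lambda>u. u v* A)"
    proof (rule injI)
      fix u w assume "u v* A = w v* A"
      then have "(u - w) v* A = 0" by (simp only: vector_matrix_mult_diff_distrib right_minus_eq)
      then have "u - w = 0" using A by (simp only: full_def)
      then show "u = w" by (simp only: right_minus_eq)
    qed
  next
    assume "inj (\<lambda>u. u v* A)"
    then show "full A" unfolding full_def by (metis injD vector_matrix_mult_0)
  qed
  also have "\<dots> \<longleftrightarrow> card (range (\<lambda>u. u v* A)) = CARD(bit ^ 3)"
    by (metis card_image eq_card_imp_inj_on finite)
  also have "\<dots> \<longleftrightarrow> (2::nat) ^ rank A = 2 ^ 3"
    unfolding card_row_space by simp
  also have "\<dots> \<longleftrightarrow> rank A = 3"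
    by (rule power_inject_exp) simp
  finally show ?thesis ..
qed

text \<open>The size is \<open>2 ^ ((3 - 3 + 1) * 4) = 16\<close>. No rank exceeds 3, so a minimum
  distance of 3 forces every difference of distinct codewords to attain it.\<close>

lemma MRD_code_3_iff:
  "MRD_code 3 C \<longleftrightarrow> card C = 16 \<and> (\<forall>A\<in>C. \<forall>B\<in>C. A \<noteq> B \<longrightarrow> full (A - B))"
  for C :: "(bit ^ 4 ^ 3) set"
proof -
  let ?M = "{rank_dist A B | A B. A \<in> C \<and> B \<in> C \<and> A \<noteq> B}"
  have "Min ?M = 3 \<longleftrightarrow> (\<forall>A\<in>C. \<forall>B\<in>C. A \<noteq> B \<longrightarrow> full (A - B))" if "card C = 16"
  proof -
    have fin: "finite ?M" by (rule finite_subset[of _ "{..3}"]) (auto simp: rank_dist_def rank_le)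
    \<comment> \<open>Sixteen codewords contain two distinct ones, so \<open>Min\<close> is taken
      over a nonempty set.\<close>
    have "\<not> card C \<le> Suc 0" using that by simp
    then obtain A B where AB: "A \<in> C" "B \<in> C" "A \<noteq> B"
      using card_le_Suc0_iff_eq[of C] by auto
    then have ne: "?M \<noteq> {}" by blast
    show ?thesis
    proof
      assume "Min ?M = 3"
      then have ge: "rank_dist A B \<ge> 3" if "A \<in> C" "B \<in> C" "A \<noteq> B" for A B
        using Min_le[OF fin, of "rank_dist A B"] that by auto
      show "\<forall>A\<in>C. \<forall>B\<in>C. A \<noteq> B \<longrightarrow> full (A - B)"
      proof (intro ballI impI)
        fix A B assume "A \<in> C" "B \<in> C" "A \<noteq> B"
        then have "rank (A - B) = 3" using ge[of A B] rank_le[of "A - B"] by (simp add: rank_dist_def)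
        then show "full (A - B)" by (simp add: rank_eq_3_iff)
      qed
    next
      assume "\<forall>A\<in>C. \<forall>B\<in>C. A \<noteq> B \<longrightarrow> full (A - B)"
      then have "?M \<subseteq> {3}" by (auto simp: rank_dist_def rank_eq_3_iff)
      then have "?M = {} \<or> ?M = {3}" by (rule subset_singletonD)
      then have "?M = {3}" by (rule disjE) (erule notE[OF ne], assumption)
      then show "Min ?M = 3" by (simp only: Min_singleton)
    qed
  qed
  then show ?thesis by (auto simp: MRD_code_def min_rank_dist_def)
qed

text \<open>\<open>P\<close> permutes the vectors \<open>u\<close>, and \<open>Q\<close> sends only
  0 to 0.\<close>

lemma full_transform:
  assumes "invertible P" "invertible Q"
  shows "full (P ** A ** Q) \<longleftrightarrow> full A"
proof -
  obtain P' where P': "P ** P' = mat 1" "P' ** P = mat 1" using assms(1) by (rule invertibleE)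
  obtain Q' where Q': "Q ** Q' = mat 1" "Q' ** Q = mat 1" using assms(2) by (rule invertibleE)
  have P0: "u v* P = 0 \<longleftrightarrow> u = 0" for u
    by (metis P'(1) vector_matrix_mul_assoc vector_matrix_mul_rid vector_matrix_mult_0)
  have Q0: "u v* Q = 0 \<longleftrightarrow> u = 0" for u
    by (metis Q'(1) vector_matrix_mul_assoc vector_matrix_mul_rid vector_matrix_mult_0)
  have "full (P ** A ** Q) \<longleftrightarrow> (\<forall>u. (u v* P) v* A = 0 \<longrightarrow> u v* P = 0)"
    by (simp add: full_def vector_matrix_mul_assoc[symmetric] P0 Q0)
  also have "\<dots> \<longleftrightarrow> full A"
    unfolding full_def by (metis P'(2) vector_matrix_mul_assoc vector_matrix_mul_rid)
  finally show ?thesis .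
qed

lemma affine_diff:
  "(P ** A ** Q + R) - (P ** B ** Q + R) = P ** (A - B) ** Q" for P :: "bit ^ 'm ^ 'm" and Q :: "bit ^ 'n ^ 'n"
proof -
  have "(P ** A ** Q + R) - (P ** B ** Q + R) = P ** A ** Q - P ** B ** Q"
    by (rule add_diff_cancel_right)
  then show ?thesis by (simp only: bit_mat_diff matrix_add_ldistrib matrix_add_rdistrib)
qed

lemma inj_affine:
  fixes P :: "bit ^ 'm ^ 'm" and Q :: "bit ^ 'n ^ 'n"
  assumes "invertible P" "invertible Q"
  shows "inj (\<lambda>A. P ** A ** Q + R)"
proof -
  obtain P' where P': "P' ** P = mat 1" using assms(1) by (rule invertibleE)
  obtain Q' where Q': "Q ** Q' = mat 1" using assms(2) by (rule invertibleE)
  have cancel: "P' ** (P ** A ** Q) ** Q' = A" for A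
  proof -
    have "P' ** (P ** A ** Q) ** Q' = (P' ** P) ** A ** (Q ** Q')" by (simp only: matrix_mul_assoc)
    then show ?thesis by (simp only: P' Q' matrix_mul_lid matrix_mul_rid)
  qed
  show ?thesis
  proof (rule injI)
    fix A B assume "P ** A ** Q + R = P ** B ** Q + R"
    then have "P ** A ** Q = P ** B ** Q" by (simp only: add_right_cancel)
    then show "A = B" by (metis cancel)
  qed
qed

lemma MRD_code_isomorphic:
  fixes C :: "(bit ^ 4 ^ 3) set"
  assumes C: "MRD_code 3 C" and iso: "code_isomorphic C D"
  shows "MRD_code 3 D"
proof -
  obtain P Q R where PQ: "invertible P" "invertible Q" and D: "D = (\<lambda>A. P ** A ** Q + R) ` C"
    using iso unfolding code_isomorphic_def by blast
  have "card C = 16" using C[unfolded MRD_code_3_iff] ..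
  moreover have "card D = card C"
    unfolding D by (rule card_image) (rule inj_on_subset[OF inj_affine[OF PQ]], simp)
  moreover have "full (E - F)" if EF: "E \<in> D" "F \<in> D" "E \<noteq> F" for E F
  proof -
    obtain A B where AB: "A \<in> C" "B \<in> C" and E: "E = P ** A ** Q + R" and F: "F = P ** B ** Q + R"
      using EF unfolding D by fast
    have "A \<noteq> B" using EF(3) unfolding E F by fast
    with AB C[unfolded MRD_code_3_iff] have "full (A - B)" by blast
    then show ?thesis unfolding E F affine_diff full_transform[OF PQ] .
  qed
  ultimately show ?thesis
    unfolding MRD_code_3_iff by (intro conjI ballI impI) (simp only:)
qed

section \<open>Row combinations, columns and kernels in a code\<close>

text \<open>Two codewords with the same combination would have a difference annihilated by
  \<open>u\<close>. Sixteen different values then fill F_2^4.\<close>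

lemma bij_row_combination:
  fixes C :: "(bit ^ 4 ^ 3) set"
  assumes C: "MRD_code 3 C" and u: "u \<noteq> 0"
  shows "bij_betw (\<lambda>A. u v* A) C UNIV"
proof -
  have inj: "inj_on (\<lambda>A. u v* A) C"
  proof (rule inj_onI, rule ccontr)
    fix A B assume AB: "A \<in> C" "B \<in> C" "u v* A = u v* B" "A \<noteq> B"
    then have "full (A - B)" "u v* (A - B) = 0"
      using C by (auto simp: MRD_code_3_iff vector_matrix_mult_diff_rdistrib)
    with u show False by (auto simp: full_def)
  qed
  moreover have "card ((\<lambda>A. u v* A) ` C) = CARD(bit ^ 4)"
    using C by (simp add: card_image[OF inj] MRD_code_3_iff)
  then have "(\<lambda>A. u v* A) ` C = UNIV" by (intro card_subset_eq) auto
  ultimately show ?thesis by (simp add: bij_betw_def)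
qed

lemma row_combination_surj:
  fixes C :: "(bit ^ 4 ^ 3) set"
  assumes "MRD_code 3 C" "u \<noteq> 0"
  obtains A where "A \<in> C" "u v* A = x"
proof -
  have "x \<in> (\<lambda>A. u v* A) ` C"
    using bij_row_combination[OF assms] by (simp add: bij_betw_def)
  then show ?thesis
  proof (rule imageE)
    fix A assume "x = u v* A" "A \<in> C"
    then show ?thesis using that[of A] by simp
  qed
qed

text \<open>As \<open>A\<close> runs through the code, \<open>u v* A\<close> runs through F_2^4
  once. The character sum over the code is therefore a full character sum at \<open>v\<close> and
  vanishes, and each of the eight fibres has 16 / 8 elements.\<close>

lemma card_column_fibre:
  fixes C :: "(bit ^ 4 ^ 3) set"
  assumes C: "MRD_code 3 C" and v: "v \<noteq> 0"
  shows "card {A \<in> C. A *v v = w} = 2"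
proof -
  have "(\<Sum>A\<in>C. chi (dot u (A *v v))) = 0" if u: "u \<noteq> 0" for u
  proof -
    have "(\<Sum>A\<in>C. chi (dot u (A *v v))) = (\<Sum>x\<in>UNIV. chi (dot x v))"
      unfolding dot_matrix[symmetric] by (rule sum.reindex_bij_betw[OF bij_row_combination[OF C u]])
    with v show ?thesis by (simp add: sum_chi_dot)
  qed
  from card_fibre_of_balanced[OF _ this, of w] C show ?thesis by (simp add: MRD_code_3_iff)
qed

text \<open>The same balancing argument, now over all \<open>v\<close> instead of all codewords:
  \<open>u v* A\<close> is nonzero, so its character sum vanishes and the fibre over 0 has 16 / 8
  elements.\<close>

lemma card_kernel:
  assumes "full A"
  shows "card {v. A *v v = 0} = 2"
proof -
  have "(\<Sum>v\<in>UNIV. chi (dot u (A *v v))) = 0" if "u \<noteq> 0" for u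
  proof -
    have "u v* A \<noteq> 0" using assms that unfolding full_def by blast
    then show ?thesis
      by (simp only: dot_matrix[symmetric] dot_commute[of "u v* A"] sum_chi_dot if_False)
  qed
  from card_fibre_of_balanced[OF _ this, of 0] show ?thesis by simp
qed

text \<open>The default 0 agrees with what the tables of the search return, and it keeps the
  transformation law valid for matrices that are not full, in particular for the difference of a
  codeword with itself.\<close>

definition kap :: "bit ^ 4 ^ 3 \<Rightarrow> bit ^ 4" where
  "kap A = (if full A then THE v. v \<noteq> 0 \<and> A *v v = 0 else 0)"

lemma kernel_unique:
  assumes "full A"
  shows "\<exists>!v. v \<noteq> 0 \<and> A *v v = 0"
proof -
  have "card ({v. A *v v = 0} - {0}) = 1" using card_kernel[OF assms] by (simp add: card_Diff_singleton)
  then obtain v where "{v. A *v v = 0} - {0} = {v}" using card_1_singletonE by blast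
  then show ?thesis by (metis (mono_tags, lifting) Diff_iff mem_Collect_eq singleton_iff)
qed

lemma kap_nonzero: "full A \<Longrightarrow> kap A \<noteq> 0"
  and kap_kernel: "full A \<Longrightarrow> A *v kap A = 0"
  using theI'[OF kernel_unique[of A]] by (simp_all add: kap_def)

lemma kap_eqI: "full A \<Longrightarrow> v \<noteq> 0 \<Longrightarrow> A *v v = 0 \<Longrightarrow> kap A = v"
  using kernel_unique[of A] kap_nonzero kap_kernel by blast

text \<open>If \<open>P ** A ** Q\<close> annihilates \<open>v\<close>, then \<open>A\<close>
  annihilates \<open>Q *v v\<close>; the kernel vector being unique, there is no other
  choice.\<close>

lemma kap_transform:
  assumes PQ: "invertible P" "invertible Q"
  shows "Q *v kap (P ** A ** Q) = kap A"
proof (cases "full A")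
  case True
  obtain P' where P': "P' ** P = mat 1" using PQ(1) by (rule invertibleE)
  obtain Q' where Q': "Q' ** Q = mat 1" using PQ(2) by (rule invertibleE)
  let ?v = "kap (P ** A ** Q)"
  have v: "?v \<noteq> 0" "P ** A ** Q *v ?v = 0"
    using True by (simp_all add: full_transform[OF PQ] kap_nonzero kap_kernel)
  have "A *v (Q *v ?v) = P' *v (P ** A ** Q *v ?v)"
    by (simp only: matrix_vector_mul_assoc matrix_mul_assoc P' matrix_mul_lid)
  then have "A *v (Q *v ?v) = 0" by (simp only: v(2) matrix_vector_mult_0_right)
  moreover have "Q *v ?v \<noteq> 0"
  proof
    assume "Q *v ?v = 0"
    then have "Q' *v (Q *v ?v) = 0" by (simp only: matrix_vector_mult_0_right)
    with v(1) show False by (simp only: matrix_vector_mul_assoc Q' matrix_vector_mul_lid)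
  qed
  ultimately show ?thesis using kap_eqI[OF True] by simp
qed (simp add: kap_def full_transform[OF PQ])

section \<open>An isomorphism invariant built from kernels\<close>

text \<open>For three distinct codewords of a code the three kernels are nonzero and pairwise
  distinct, so their sum vanishes exactly when they are the nonzero vectors of a plane. The
  degenerate cases \<open>D = A\<close> and \<open>D = B\<close> are counted as well, since
  \<open>kap 0 = 0\<close>.\<close>

definition triangles :: "(bit ^ 4 ^ 3) set \<Rightarrow> bit ^ 4 ^ 3 \<Rightarrow> bit ^ 4 ^ 3 \<Rightarrow> nat" where
  "triangles C A B = card {D \<in> C. kap (A - B) + kap (A - D) + kap (B - D) = 0}"

text \<open>The squares retain how the triples are distributed over pairs of codewords and over
  single codewords; without them only the total number of triples would be left.\<close>

definition code_invariant :: "(bit ^ 4 ^ 3) set \<Rightarrow> nat" where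
  "code_invariant C = (\<Sum>A\<in>C. (\<Sum>B\<in>C. (triangles C A B)\<^sup>2)\<^sup>2)"

text \<open>\<open>Q\<close> carries the kernels of the image code back to those of the original one
  and is injective, so vanishing sums of kernels correspond to each other.\<close>

lemma code_invariant_isomorphic:
  assumes "code_isomorphic C D"
  shows "code_invariant C = code_invariant D"
proof -
  obtain P Q R where PQ: "invertible P" "invertible Q" and D: "D = (\<lambda>A. P ** A ** Q + R) ` C"
    using assms unfolding code_isomorphic_def by blast
  let ?f = "\<lambda>A. P ** A ** Q + R"
  have inj: "inj_on ?f S" for S by (rule inj_on_subset[OF inj_affine[OF PQ]]) simp
  obtain Q' where Q': "Q' ** Q = mat 1" using PQ(2) by (rule invertibleE)
  have Q0: "Q *v v = 0 \<longleftrightarrow> v = 0" for v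
  proof
    assume "Q *v v = 0"
    then have "Q' *v (Q *v v) = 0" by (simp only: matrix_vector_mult_0_right)
    then show "v = 0" by (simp only: matrix_vector_mul_assoc Q' matrix_vector_mul_lid)
  qed (simp only: matrix_vector_mult_0_right)
  have tri: "triangles D (?f A) (?f B) = triangles C A B" for A B
  proof -
    have "kap (?f A - ?f B) + kap (?f A - ?f E) + kap (?f B - ?f E) = 0 \<longleftrightarrow>
        kap (A - B) + kap (A - E) + kap (B - E) = 0" for E
      by (subst Q0[symmetric]) (simp only: affine_diff matrix_vector_right_distrib kap_transform[OF PQ])
    then have "{E \<in> D. kap (?f A - ?f B) + kap (?f A - E) + kap (?f B - E) = 0} =
        ?f ` {E \<in> C. kap (A - B) + kap (A - E) + kap (B - E) = 0}"
      unfolding D by blast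
    then show ?thesis unfolding triangles_def by (simp add: card_image[OF inj])
  qed
  show ?thesis unfolding code_invariant_def
    by (simp add: D sum.reindex[OF inj] tri[unfolded D] o_def)
qed

section \<open>Lifting codes to vector space partitions\<close>

lemma additive_zero:
  fixes f :: "'a::group_add \<Rightarrow> 'b::group_add"
  assumes "\<And>x y. f (x + y) = f x + f y"
  shows "f 0 = 0"
proof -
  have "f 0 + f 0 = f 0 + 0" using assms[of 0 0] by (simp only: add_0_right)
  then show ?thesis by (simp only: add_left_cancel)
qed

lemma additive_matrix:
  fixes h :: "bit ^ 'n \<Rightarrow> bit ^ 'm"
  assumes "\<And>x y. h (x + y) = h x + h y"
  obtains A where "\<And>x. h x = x v* A"
  using that[of "transpose (matrix h)"] matrix_works[OF linear_bit[OF assms]] by simp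

lemma invertible_row_kernel:
  fixes A :: "'a::field ^ 'n ^ 'n"
  assumes "\<And>x. x v* A = 0 \<Longrightarrow> x = 0"
  shows "invertible A"
proof -
  have "\<forall>x. transpose A *v x = 0 \<longrightarrow> x = 0"
    using assms by (simp add: transpose_matrix_vector)
  then have "\<exists>B. B ** transpose A = mat 1" by (simp only: matrix_left_invertible_ker)
  then obtain B where "B ** transpose A = mat 1" ..
  then have "transpose (B ** transpose A) = mat 1" by (simp only: transpose_mat)
  then have "A ** transpose B = mat 1" by (simp only: matrix_transpose_mul transpose_transpose)
  moreover from this have "transpose B ** A = mat 1" by (simp only: matrix_left_right_inverse)
  ultimately show ?thesis unfolding invertible_def by (intro exI conjI)
qed

text \<open>Additive maps are linear here, and an injective map of a finite space into itself is
  bijective. In this form isomorphisms can be given by formulas instead of 7 by 7 matrices.\<close>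

lemma vsp_isomorphic_additive:
  "vsp_isomorphic P Q \<longleftrightarrow> (\<exists>f. (\<forall>x y. f (x + y) = f x + f y) \<and> inj f \<and> Q = (`) f ` P)"
  for P Q :: "(bit ^ 'n) set set"
proof
  assume "vsp_isomorphic P Q"
  then obtain A where A: "invertible A" "Q = (\<lambda>U. (\<lambda>x. A *v x) ` U) ` P"
    unfolding vsp_isomorphic_def by blast
  then have "inj ((*v) A)" by (metis invertible_def matrix_left_invertible_injective)
  with A(2) show "\<exists>f. (\<forall>x y. f (x + y) = f x + f y) \<and> inj f \<and> Q = (`) f ` P"
    by (intro exI[of _ "(*v) A"]) (simp add: matrix_vector_right_distrib)
next
  assume "\<exists>f. (\<forall>x y. f (x + y) = f x + f y) \<and> inj f \<and> Q = (`) f ` P"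
  then obtain f where f: "\<And>x y. f (x + y) = f x + f y" "inj f" "Q = (`) f ` P" by blast
  have m: "matrix f *v x = f x" for x by (rule matrix_works[OF linear_bit[OF f(1)]])
  then have "(*v) (matrix f) = f" by blast
  then have "invertible (matrix f)"
    using f(2) matrix_left_invertible_injective[of "matrix f"] matrix_left_right_inverse
    unfolding invertible_def by metis
  with f(3) show "vsp_isomorphic P Q" unfolding vsp_isomorphic_def by (metis m image_cong)
qed

lemma subspace_dim_1_bit:
  "vec.subspace M \<and> vec.dim M = 1 \<longleftrightarrow> (\<exists>v. v \<noteq> 0 \<and> M = {0, v})" for M :: "(bit ^ 'n) set"
proof
  assume M: "vec.subspace M \<and> vec.dim M = 1"
  then have "card M = 2" using card_subspace_bit by fastforce
  moreover have "0 \<in> M" using M vec.subspace_0 by blast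
  ultimately show "\<exists>v. v \<noteq> 0 \<and> M = {0, v}" by (auto simp: card_2_iff)
next
  assume "\<exists>v. v \<noteq> 0 \<and> M = {0, v}"
  then obtain v where v: "v \<noteq> 0" "M = {0, v}" by blast
  then have M: "vec.subspace M" by (auto simp: subspace_bit_iff)
  with card_subspace_bit[OF M] v have "(2::nat) ^ vec.dim M = 2 ^ 1" by simp
  then have "vec.dim M = 1" by (rule power_inject_exp[THEN iffD1, rotated]) simp
  with M show "vec.subspace M \<and> vec.dim M = 1" ..
qed

text \<open>A one-dimensional subspace contains a single nonzero vector, so the points of the
  geometry can be replaced by nonzero vectors.\<close>

lemma vector_space_partition_bit:
  "vector_space_partition P \<longleftrightarrow>
     (\<forall>U\<in>P. vec.subspace U \<and> U \<noteq> {0}) \<and> (\<forall>v. v \<noteq> 0 \<longrightarrow> (\<exists>!U. U \<in> P \<and> v \<in> U))"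
  for P :: "(bit ^ 'n) set set"
proof -
  have sub: "(\<exists>!U. U \<in> P \<and> {0, v} \<subseteq> U) \<longleftrightarrow> (\<exists>!U. U \<in> P \<and> v \<in> U)" if "\<forall>U\<in>P. vec.subspace U" for v
    using that vec.subspace_0 by (metis empty_subsetI insert_subset)
  have "(\<forall>M. (\<exists>v. v \<noteq> 0 \<and> M = {0, v}) \<longrightarrow> (\<exists>!U. U \<in> P \<and> M \<subseteq> U)) \<longleftrightarrow>
      (\<forall>v. v \<noteq> 0 \<longrightarrow> (\<exists>!U. U \<in> P \<and> {0, v} \<subseteq> U))"
    by (intro iffI allI impI) (blast, elim exE conjE, simp only: simp_thms)
  then have eq: "vector_space_partition P \<longleftrightarrow> (\<forall>U\<in>P. vec.subspace U \<and> U \<noteq> {0}) \<and>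
      (\<forall>v. v \<noteq> 0 \<longrightarrow> (\<exists>!U. U \<in> P \<and> {0, v} \<subseteq> U))"
    unfolding vector_space_partition_def subspace_dim_1_bit by (simp only:)
  show ?thesis
  proof (cases "\<forall>U\<in>P. vec.subspace U")
    case True
    show ?thesis by (simp only: eq sub[OF True])
  next
    case False
    then show ?thesis by (simp only: eq ball_conj_distrib simp_thms)
  qed
qed

section \<open>Coordinates on F_2^7 and graphs of matrices\<close>

text \<open>\<open>3 + 4\<close> is the disjoint sum of two index types. Any bijection serves, since
  everything below rests on bijectivity alone.\<close>

definition split_index :: "7 \<Rightarrow> 3 + 4" where
  "split_index = (SOME f. bij f)"

lemma bij_split_index: "bij split_index"
proof -
  have "\<exists>f :: 7 \<Rightarrow> 3 + 4. bij f" by (rule finite_same_card_bij) simp_all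
  then show ?thesis unfolding split_index_def by (rule someI_ex)
qed

definition join :: "bit ^ 3 \<Rightarrow> bit ^ 4 \<Rightarrow> bit ^ 7" where
  "join y x = (\<chi> i. case split_index i of Inl a \<Rightarrow> y $ a | Inr b \<Rightarrow> x $ b)"

definition top_part :: "bit ^ 7 \<Rightarrow> bit ^ 3" where
  "top_part v = (\<chi> a. v $ inv split_index (Inl a))"

definition bottom_part :: "bit ^ 7 \<Rightarrow> bit ^ 4" where
  "bottom_part v = (\<chi> b. v $ inv split_index (Inr b))"

lemma top_part_join [simp]: "top_part (join y x) = y"
  and bottom_part_join [simp]: "bottom_part (join y x) = x"
  using bij_split_index
  by (simp_all add: vec_eq_iff top_part_def bottom_part_def join_def bij_is_surj surj_f_inv_f)

lemma join_parts [simp]: "join (top_part v) (bottom_part v) = v"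
  using bij_split_index
  by (auto simp: vec_eq_iff top_part_def bottom_part_def join_def bij_is_inj inv_f_eq split: sum.split)

lemma join_eq_iff [simp]: "join y x = join y' x' \<longleftrightarrow> y = y' \<and> x = x'"
  by (metis top_part_join bottom_part_join)

lemma join_add: "join y x + join y' x' = join (y + y') (x + x')"
  by (simp add: vec_eq_iff join_def split: sum.split)

lemma join_0 [simp]: "join 0 0 = 0"
  by (simp add: vec_eq_iff join_def split: sum.split)

lemma join_eq_0_iff [simp]: "join y x = 0 \<longleftrightarrow> y = 0 \<and> x = 0"
  by (metis join_0 join_eq_iff)

lemma parts_add: "top_part (v + w) = top_part v + top_part w"
  "bottom_part (v + w) = bottom_part v + bottom_part w"
  by (simp_all add: vec_eq_iff top_part_def bottom_part_def)

lemma join_induct: "(\<And>y x. Q (join y x)) \<Longrightarrow> Q v"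
  by (metis join_parts)

definition lift :: "bit ^ 4 ^ 3 \<Rightarrow> (bit ^ 7) set" where
  "lift A = range (\<lambda>y. join y (y v* A))"

definition special :: "(bit ^ 7) set" where
  "special = range (join 0)"

definition lift_code :: "(bit ^ 4 ^ 3) set \<Rightarrow> (bit ^ 7) set set" where
  "lift_code C = insert special (lift ` C)"

lemma join_in_lift: "join y x \<in> lift A \<longleftrightarrow> x = y v* A"
  by (auto simp: lift_def)

lemma join_in_special: "join y x \<in> special \<longleftrightarrow> y = 0"
  by (auto simp: special_def)

lemma card_lift: "card (lift A) = 8"
proof -
  have "card (lift A) = CARD(bit ^ 3)" unfolding lift_def by (rule card_image) (simp add: inj_def)
  then show ?thesis by simp
qed

lemma card_special: "card special = 16"
proof -
  have "card special = CARD(bit ^ 4)" unfolding special_def by (rule card_image) (simp add: inj_def)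
  then show ?thesis by simp
qed

lemma subspace_lift: "vec.subspace (lift A)"
proof -
  have "join 0 0 \<in> lift A" by (simp only: join_in_lift) simp
  moreover have "v + w \<in> lift A" if "v \<in> lift A" "w \<in> lift A" for v w
    using that by (induction v rule: join_induct, induction w rule: join_induct)
      (simp add: join_add join_in_lift vector_matrix_left_distrib)
  ultimately show ?thesis by (simp add: subspace_bit_iff)
qed

lemma subspace_special: "vec.subspace special"
proof -
  have "join 0 0 \<in> special" by (simp only: join_in_special)
  moreover have "v + w \<in> special" if "v \<in> special" "w \<in> special" for v w
    using that by (induction v rule: join_induct, induction w rule: join_induct)
      (simp add: join_add join_in_special)
  ultimately show ?thesis by (simp add: subspace_bit_iff)
qed

lemma lift_neq_special: "lift A \<noteq> special"
  using card_lift[of A] card_special by auto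

lemma inj_lift: "inj lift"
proof (rule injI)
  fix A B assume "lift A = lift B"
  then have "y v* A = y v* B" for y by (metis join_in_lift)
  then show "A = B"
    by (metis matrix_eq transpose_matrix_vector transpose_transpose)
qed

lemma dim_eq_of_card:
  fixes U :: "(bit ^ 'n) set"
  assumes "vec.subspace U" "card U = 2 ^ n"
  shows "vec.dim U = n"
  using card_subspace_bit[OF assms(1)] assms(2) by simp

abbreviation "partition_3_4 \<equiv> {P :: (bit ^ 7) set set. vector_space_partition P \<and>
  vsp_type P = replicate_mset 16 3 + replicate_mset 1 4}"

text \<open>A vector \<open>join y x\<close> with nonzero \<open>y\<close> lies in the graph of
  \<open>A\<close> exactly when \<open>y v* A = x\<close>, and exactly one codeword does this
  because row combinations are bijective on the code. The vectors with \<open>y = 0\<close> form the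
  special member.\<close>

lemma lift_code_partition:
  assumes C: "MRD_code 3 C"
  shows "lift_code C \<in> partition_3_4"
proof -
  have dims: "vec.dim (lift A) = 3" "vec.dim special = 4" for A
    by (simp_all add: dim_eq_of_card[OF subspace_lift] dim_eq_of_card[OF subspace_special]
        card_lift card_special)
  have ex1: "\<exists>!U. U \<in> lift_code C \<and> v \<in> U" if "v \<noteq> 0" for v
    using that
  proof (induction v rule: join_induct)
    fix y x assume v: "join y x \<noteq> 0"
    show "\<exists>!U. U \<in> lift_code C \<and> join y x \<in> U"
    proof (cases "y = 0")
      case True
      with v have x: "x \<noteq> 0" by simp
      show ?thesis
      proof (rule ex1I)
        show "special \<in> lift_code C \<and> join y x \<in> special"
          using True by (simp add: lift_code_def join_in_special)
        fix U assume U: "U \<in> lift_code C \<and> join y x \<in> U"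
        have "join y x \<notin> lift A" for A using True x by (simp add: join_in_lift)
        with U show "U = special" by (auto simp: lift_code_def)
      qed
    next
      case False
      obtain A where A: "A \<in> C" "y v* A = x" by (rule row_combination_surj[OF C False])
      have inj: "inj_on (\<lambda>A. y v* A) C" using bij_row_combination[OF C False] by (rule bij_betw_imp_inj_on)
      show ?thesis
      proof (rule ex1I)
        show "lift A \<in> lift_code C \<and> join y x \<in> lift A"
          using A by (simp add: lift_code_def join_in_lift)
        fix U assume U: "U \<in> lift_code C \<and> join y x \<in> U"
        then have "U \<noteq> special" using False join_in_special by blast
        with U obtain B where B: "B \<in> C" "U = lift B" by (auto simp: lift_code_def)
        with U have "y v* B = y v* A" by (simp add: join_in_lift A(2))
        then have "B = A" using B(1) A(1) by (rule inj_onD[OF inj])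
        with B show "U = lift A" by simp
      qed
    qed
  qed
  have sub: "vec.subspace U \<and> U \<noteq> {0}" if "U \<in> lift_code C" for U
  proof -
    have "vec.subspace U \<and> card U \<noteq> 1"
      using that unfolding lift_code_def
    proof (elim insertE imageE)
      assume "U = special"
      then show ?thesis by (simp only: subspace_special card_special) simp
    next
      fix A assume "U = lift A"
      then show ?thesis by (simp only: subspace_lift card_lift) simp
    qed
    moreover have "card {0 :: bit ^ 7} = 1" by simp
    ultimately show ?thesis by metis
  qed
  have "vector_space_partition (lift_code C)"
    unfolding vector_space_partition_bit
  proof (intro conjI ballI allI impI)
    show "vec.subspace U" "U \<noteq> {0}" if "U \<in> lift_code C" for U
      using sub[OF that] by (rule conjunct1, rule conjunct2)
    show "\<exists>!U. U \<in> lift_code C \<and> v \<in> U" if "v \<noteq> 0" for v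
      using that by (rule ex1)
  qed
  moreover have "vsp_type (lift_code C) = replicate_mset 16 3 + replicate_mset 1 4"
  proof -
    have "special \<notin> lift ` C" using lift_neq_special by blast
    moreover have "image_mset vec.dim (mset_set (lift ` C)) = replicate_mset 16 3"
    proof -
      have "image_mset vec.dim (mset_set (lift ` C)) = image_mset (\<lambda>_. 3) (mset_set (lift ` C))"
        by (rule image_mset_cong) (auto simp: dims)
      also have "\<dots> = replicate_mset 16 3"
        using C by (simp add: image_mset_const_eq card_image[OF inj_on_subset[OF inj_lift]] MRD_code_3_iff)
      finally show ?thesis .
    qed
    ultimately show ?thesis by (simp add: vsp_type_def lift_code_def dims)
  qed
  ultimately show ?thesis by blast
qed

section \<open>Isomorphisms of codes and of their lifted partitions\<close>

lemma lift_code_isomorphic: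
  assumes "code_isomorphic C D"
  shows "vsp_isomorphic (lift_code C) (lift_code D)"
proof -
  obtain P Q R where PQ: "invertible P" "invertible Q" and D: "D = (\<lambda>A. P ** A ** Q + R) ` C"
    using assms unfolding code_isomorphic_def by blast
  obtain P' where P': "P' ** P = mat 1" "P ** P' = mat 1" using PQ(1) by (rule invertibleE)
  obtain Q' where Q': "Q ** Q' = mat 1" "Q' ** Q = mat 1" using PQ(2) by (rule invertibleE)
  have cancel: "(y v* P') v* P = y" "(y v* P) v* P' = y" "(x v* Q) v* Q' = x" "(x v* Q') v* Q = x" for x y
    by (simp_all add: vector_matrix_mul_assoc P' Q')
  \<comment> \<open>Chosen so that, with \<open>z = y v* P'\<close>, the vector with parts
    \<open>y\<close> and \<open>y v* A\<close> goes to the one with parts \<open>z\<close> and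
    \<open>z v* (P ** A ** Q + R)\<close>.\<close>
  define f where "f v = join (top_part v v* P') (bottom_part v v* Q + (top_part v v* P') v* R)" for v
  have f_join: "f (join y x) = join (y v* P') (x v* Q + (y v* P') v* R)" for y x
    by (simp add: f_def)
  have add: "f (v + w) = f v + f w" for v w
    by (simp add: f_def parts_add join_add vector_matrix_left_distrib ac_simps)
  have inj: "inj f"
  proof (rule injI)
    fix v w assume "f v = f w"
    then have "top_part v v* P' = top_part w v* P' \<and>
        bottom_part v v* Q + (top_part v v* P') v* R = bottom_part w v* Q + (top_part w v* P') v* R"
      unfolding f_def join_eq_iff .
    then have y: "top_part v v* P' = top_part w v* P'"
      and x: "bottom_part v v* Q + (top_part v v* P') v* R = bottom_part w v* Q + (top_part w v* P') v* R"
      by (rule conjunct1, rule conjunct2)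
    from x have "bottom_part v v* Q = bottom_part w v* Q" by (simp only: y add_right_cancel)
    then have "(bottom_part v v* Q) v* Q' = (bottom_part w v* Q) v* Q'" by (rule arg_cong)
    then have "bottom_part v = bottom_part w" by (simp only: cancel)
    moreover from y have "(top_part v v* P') v* P = (top_part w v* P') v* P" by (rule arg_cong)
    then have "top_part v = top_part w" by (simp only: cancel)
    ultimately show "v = w" by (metis join_parts)
  qed
  have "f ` lift A = lift (P ** A ** Q + R)" for A
  proof (rule card_subset_eq)
    show "card (f ` lift A) = card (lift (P ** A ** Q + R))"
      using card_image[OF inj_on_subset[OF inj subset_UNIV], of "lift A"] by (simp add: card_lift)
    have key: "(y v* P') v* (P ** A ** Q + R) = (y v* A) v* Q + (y v* P') v* R" for y
    proof -
      have "(y v* P') v* (P ** A ** Q + R) = y v* (P' ** P ** A ** Q) + (y v* P') v* R"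
        by (simp only: vector_matrix_mult_add_rdistrib vector_matrix_mul_assoc matrix_mul_assoc)
      then show ?thesis by (simp only: P' matrix_mul_lid vector_matrix_mul_assoc)
    qed
    show "f ` lift A \<subseteq> lift (P ** A ** Q + R)"
    proof (rule image_subsetI)
      fix v assume "v \<in> lift A"
      then obtain y where "v = join y (y v* A)" unfolding lift_def by (rule rangeE)
      then show "f v \<in> lift (P ** A ** Q + R)" by (simp only: f_join key join_in_lift)
    qed
  qed simp
  moreover have "f ` special = special"
  proof (rule card_subset_eq)
    show "f ` special \<subseteq> special" by (auto simp: special_def f_join)
    show "card (f ` special) = card special" by (rule card_image) (rule inj_on_subset[OF inj], simp)
  qed simp
  ultimately have "lift_code D = (`) f ` lift_code C"
    by (simp add: lift_code_def D image_image)
  with add inj show ?thesis unfolding vsp_isomorphic_additive by blast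
qed

text \<open>The special member is the only one with 16 elements, hence fixed, which makes
  \<open>f\<close> block triangular: the parts \<open>y\<close>, \<open>x\<close> become
  \<open>y v* M\<close> and \<open>y v* N + x v* Q\<close>. With \<open>M'\<close> the inverse of
  \<open>M\<close>, the graph of \<open>A\<close> then goes to the graph of
  \<open>M' ** A ** Q + M' ** N\<close>.\<close>

lemma lift_code_isomorphicD:
  assumes "vsp_isomorphic (lift_code C) (lift_code D)"
  shows "code_isomorphic C D"
proof -
  obtain f where add: "\<And>x y. f (x + y) = f x + f y" and inj: "inj f"
    and D: "lift_code D = (`) f ` lift_code C"
    using assms unfolding vsp_isomorphic_additive by blast
  have card_f: "card (f ` U) = card U" for U by (rule card_image) (rule inj_on_subset[OF inj], simp)
  have special: "f ` special = special"
  proof -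
    have "f ` special \<in> (`) f ` lift_code C" by (simp add: lift_code_def)
    then have "f ` special \<in> lift_code D" by (simp only: D)
    moreover have "f ` special \<noteq> lift A" for A
      using card_f[of special] card_lift[of A] card_special by auto
    ultimately show ?thesis by (auto simp: lift_code_def)
  qed
  have f_0: "f 0 = 0" by (rule additive_zero) (rule add)
  have f0: "v = 0" if "f v = 0" for v
  proof (rule injD[OF inj])
    show "f v = f 0" by (simp only: that f_0)
  qed
  have join_split: "join (y + y') 0 = join y 0 + join y' 0" "join 0 (x + x') = join 0 x + join 0 x'"
    for y y' x x'
    by (simp_all only: join_add add_0_right)
  obtain M where M: "\<And>y. top_part (f (join y 0)) = y v* M"
    using additive_matrix[of "\<lambda>y. top_part (f (join y 0))"] by (simp only: join_split add parts_add) blast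
  obtain N where N: "\<And>y. bottom_part (f (join y 0)) = y v* N"
    using additive_matrix[of "\<lambda>y. bottom_part (f (join y 0))"] by (simp only: join_split add parts_add) blast
  obtain Q where Q: "\<And>x. bottom_part (f (join 0 x)) = x v* Q"
    using additive_matrix[of "\<lambda>x. bottom_part (f (join 0 x))"] by (simp only: join_split add parts_add) blast
  have top0: "top_part (f (join 0 x)) = 0" for x
  proof -
    have "f (join 0 x) \<in> special" using special by (auto simp: special_def)
    then show ?thesis by (auto simp: special_def)
  qed
  have f_join: "f (join y x) = join (y v* M) (y v* N + x v* Q)" for y x
  proof -
    have "f (join y x) = f (join y 0) + f (join 0 x)" by (simp add: add[symmetric] join_add)
    also have "\<dots> = join (y v* M) (y v* N) + join 0 (x v* Q)"
      by (metis M N Q top0 join_parts)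
    finally show ?thesis by (simp add: join_add)
  qed
  \<comment> \<open>A vector \<open>y\<close> annihilated by \<open>M\<close> gives a vector
    \<open>join y 0\<close> that \<open>f\<close> sends into the special space; as that space is its
    own image, \<open>join y 0\<close> already lies in it.\<close>
  have "invertible M"
  proof (rule invertible_row_kernel)
    fix y assume "y v* M = 0"
    then have "f (join y 0) \<in> f ` special" unfolding special by (simp add: f_join join_in_special)
    then have "join y 0 \<in> special" using inj by (simp add: inj_image_mem_iff)
    then show "y = 0" by (simp add: join_in_special)
  qed
  then obtain M' where M': "invertible M'" "M ** M' = mat 1" "M' ** M = mat 1" by (rule invertibleE)
  have "invertible Q"
  proof (rule invertible_row_kernel)
    fix x assume "x v* Q = 0"
    then have "f (join 0 x) = 0" by (simp add: f_join)
    then show "x = 0" using f0 by fastforce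
  qed
  have "f ` lift A = lift (M' ** A ** Q + M' ** N)" for A
  proof (rule card_subset_eq)
    show "card (f ` lift A) = card (lift (M' ** A ** Q + M' ** N))"
      by (simp add: card_f card_lift)
    have key: "y v* N + (y v* A) v* Q = (y v* M) v* (M' ** A ** Q + M' ** N)" for y
    proof -
      have "(y v* M) v* (M' ** A ** Q + M' ** N)
          = y v* (M ** M' ** A ** Q) + y v* (M ** M' ** N)"
        by (simp only: vector_matrix_mult_add_rdistrib vector_matrix_mul_assoc matrix_mul_assoc)
      then show ?thesis by (simp only: M' matrix_mul_lid vector_matrix_mul_assoc add.commute)
    qed
    show "f ` lift A \<subseteq> lift (M' ** A ** Q + M' ** N)"
    proof (rule image_subsetI)
      fix v assume "v \<in> lift A"
      then obtain y where "v = join y (y v* A)" unfolding lift_def by (rule rangeE)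
      then show "f v \<in> lift (M' ** A ** Q + M' ** N)" by (simp only: f_join key join_in_lift)
    qed
  qed simp
  then have "(`) f ` lift ` C = lift ` (\<lambda>A. M' ** A ** Q + M' ** N) ` C"
    by (simp add: image_image)
  moreover have "(`) f ` lift ` C = lift ` D"
  proof -
    have "(`) f ` lift ` C = (`) f ` lift_code C - {f ` special}"
    proof -
      have "f ` lift A \<noteq> f ` special" for A using lift_neq_special inj by (simp add: inj_image_eq_iff)
      then show ?thesis by (auto simp: lift_code_def)
    qed
    also have "\<dots> = lift ` D" unfolding D[symmetric] special using lift_neq_special
      by (auto simp: lift_code_def)
    finally show ?thesis .
  qed
  ultimately have "D = (\<lambda>A. M' ** A ** Q + M' ** N) ` C"
    using inj_image_eq_iff[OF inj_lift] by metis
  with M' \<open>invertible Q\<close> show ?thesis unfolding code_isomorphic_def by blast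
qed

section \<open>Every partition of the given type comes from a code\<close>

lemma additive_param:
  fixes U :: "(bit ^ 'n) set"
  assumes "vec.subspace U" "vec.dim U = CARD('m)"
  shows "\<exists>h :: bit ^ 'm \<Rightarrow> bit ^ 'n. (\<forall>x y. h (x + y) = h x + h y) \<and> inj h \<and> range h = U"
proof -
  have "vec.dim (UNIV :: (bit ^ 'm) set) = vec.dim U" using assms(2) by (simp add: card_cart_basis)
  from vec.subspace_isomorphism[OF vec.subspace_UNIV assms(1) this]
  obtain h :: "bit ^ 'm \<Rightarrow> bit ^ 'n" where h: "Vector_Spaces.linear (*s) (*s) h" "h ` UNIV = U" "inj h"
    by blast
  from h(1) have "module_hom (*s) (*s) h" by (rule Vector_Spaces.linear.axioms(3))
  with h show ?thesis by (intro exI[of _ h]) (simp add: module_hom.add)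
qed

text \<open>The 4-dimensional member \<open>S\<close> and some 3-dimensional member \<open>T\<close>
  meet only in 0, so F_2^7 is their direct sum and coordinates can be chosen in which
  \<open>S\<close> becomes the special space. Every member other than \<open>S\<close> meets it
  trivially and therefore becomes the graph of a matrix.\<close>

lemma partition_isomorphic_lift_code:
  assumes P: "P \<in> partition_3_4"
  shows "\<exists>C. MRD_code 3 C \<and> vsp_isomorphic (lift_code C) P"
proof -
  have sub: "\<And>U. U \<in> P \<Longrightarrow> vec.subspace U" and ex1: "\<And>v. v \<noteq> 0 \<Longrightarrow> \<exists>!U. U \<in> P \<and> v \<in> U"
    and type: "vsp_type P = add_mset 4 (replicate_mset 16 3)"
    using P by (auto simp: vector_space_partition_bit)
  have "4 \<in># vsp_type P" by (simp add: type)
  then obtain S where S: "S \<in> P" "vec.dim S = 4" by (auto simp: vsp_type_def)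
  have "mset_set P = add_mset S (mset_set (P - {S}))" using S by (simp add: mset_set.remove)
  with type S have rest: "image_mset vec.dim (mset_set (P - {S})) = replicate_mset 16 3"
    by (simp add: vsp_type_def)
  have "size (image_mset vec.dim (mset_set (P - {S}))) = 16" unfolding rest by simp
  then have card_rest: "card (P - {S}) = 16" by simp
  have dim3: "vec.dim U = 3" if "U \<in> P - {S}" for U
  proof -
    have "vec.dim U \<in># image_mset vec.dim (mset_set (P - {S}))" using that by simp
    then show ?thesis unfolding rest by simp
  qed
  have "P - {S} \<noteq> {}"
  proof
    assume "P - {S} = {}"
    with card_rest show False by (simp only: card.empty zero_neq_numeral)
  qed
  then obtain T where T: "T \<in> P - {S}" by blast
  have "vec.subspace T" "vec.dim T = CARD(3)" using sub[of T] dim3[OF T] T by simp_all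
  from additive_param[OF this] obtain a :: "bit ^ 3 \<Rightarrow> bit ^ 7"
    where a: "\<And>x y. a (x + y) = a x + a y" "inj a" "range a = T" by blast
  have "vec.subspace S" "vec.dim S = CARD(4)" using sub[of S] S by simp_all
  from additive_param[OF this] obtain b :: "bit ^ 4 \<Rightarrow> bit ^ 7"
    where b: "\<And>x y. b (x + y) = b x + b y" "inj b" "range b = S" by blast
  define g where "g v = a (top_part v) + b (bottom_part v)" for v
  have g_add: "g (v + w) = g v + g w" for v w by (simp add: g_def parts_add a b ac_simps)
  have ab_0: "a 0 = 0" "b 0 = 0" by (rule additive_zero, rule a, rule additive_zero, rule b)
  have a0: "y = 0" if "a y = 0" for y by (rule injD[OF a(2)]) (simp only: that ab_0)
  have b0: "x = 0" if "b x = 0" for x by (rule injD[OF b(2)]) (simp only: that ab_0)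
  have meet: "v = 0" if "U \<in> P" "U' \<in> P" "U \<noteq> U'" "v \<in> U" "v \<in> U'" for v U U'
  proof (rule ccontr)
    assume "v \<noteq> 0"
    then have "\<exists>!U. U \<in> P \<and> v \<in> U" by (rule ex1)
    with that show False by blast
  qed
  have g0: "v = 0" if "g v = 0" for v
  proof -
    have eq: "a (top_part v) = b (bottom_part v)"
    proof -
      have "a (top_part v) + b (bottom_part v) = 0" using that by (simp only: g_def)
      then have "a (top_part v) - b (bottom_part v) = 0" by (simp only: bit_vec_diff)
      then show ?thesis by (simp only: right_minus_eq)
    qed
    have "a (top_part v) \<in> T" by (simp only: a(3)[symmetric] rangeI)
    moreover have "a (top_part v) \<in> S" by (simp only: eq b(3)[symmetric] rangeI)
    ultimately have top: "a (top_part v) = 0" using meet[of T S] T S(1) by blast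
    then have "b (bottom_part v) = 0" by (simp only: eq)
    then have "bottom_part v = 0" by (rule b0)
    moreover have "top_part v = 0" using top by (rule a0)
    ultimately have "join (top_part v) (bottom_part v) = 0" by (simp only: join_0)
    then show "v = 0" by (simp only: join_parts)
  qed
  have g_0: "g 0 = 0" by (rule additive_zero) (rule g_add)
  have g_inj: "inj g"
  proof (rule injI)
    fix v w assume "g v = g w"
    then have "g (v + w) = 0" by (simp only: g_add bit_vec_double)
    then have "v - w = 0" unfolding bit_vec_diff by (rule g0)
    then show "v = w" by (simp only: right_minus_eq)
  qed
  then have g_surj: "surj g" by (simp add: finite_UNIV_inj_surj)
  let ?P = "(`) ((-`) g) P"
  have sub': "vec.subspace (g -` U)" if "U \<in> P" for U
    using sub[OF that] by (auto simp: subspace_bit_iff g_add g_0)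
  have img: "g ` (g -` U) = U" for U using g_surj by (simp add: surj_image_vimage_eq)
  have card': "card (g -` U) = card U" for U
    using card_image[OF inj_on_subset[OF g_inj subset_UNIV], of "g -` U", symmetric]
    by (simp only: img)
  have special: "g -` S = special"
  proof (rule card_subset_eq[symmetric])
    show "special \<subseteq> g -` S"
      using b(3) by (auto simp: special_def g_def ab_0)
    show "card special = card (g -` S)"
      using card_subspace_bit[OF sub[OF S(1)]] S(2) by (simp add: card' card_special)
  qed simp
  have graph: "\<exists>A. g -` U = lift A" if U: "U \<in> P - {S}" for U
  proof -
    let ?U = "g -` U"
    have subU: "vec.subspace ?U" using U sub' by blast
    have cardU: "card ?U = 8" using card_subspace_bit[of U] sub U dim3[OF U] by (simp add: card')
    \<comment> \<open>Vectors of \<open>?U\<close> with the same top part differ by a vector that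
      \<open>g\<close> sends into both \<open>U\<close> and \<open>S\<close>, hence by 0. Having
      eight elements, \<open>?U\<close> then projects bijectively onto F_2^3.\<close>
    have top_inj: "inj_on top_part ?U"
    proof (rule inj_onI)
      fix v w assume vw: "v \<in> ?U" "w \<in> ?U" "top_part v = top_part w"
      then have "top_part (v + w) = 0" by (simp add: parts_add)
      then have "v + w \<in> special" by (metis join_in_special join_parts)
      then have "g (v + w) \<in> S" using special by blast
      moreover have "g (v + w) \<in> U" using subU vw by (auto simp: subspace_bit_iff)
      ultimately have "g (v + w) = 0" using meet[of U S] U S by blast
      then have "v - w = 0" unfolding bit_vec_diff by (rule g0)
      then show "v = w" by (simp only: right_minus_eq)
    qed
    have "card (top_part ` ?U) = CARD(bit ^ 3)" by (simp add: card_image[OF top_inj] cardU)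
    then have top_surj: "top_part ` ?U = UNIV" by (intro card_subset_eq) auto
    \<comment> \<open>The inverse of the projection is additive because \<open>?U\<close> is closed
      under addition; its bottom part supplies the matrix whose graph is \<open>?U\<close>.\<close>
    define s where "s = inv_into ?U top_part"
    have mem: "y \<in> top_part ` ?U" for y by (simp only: top_surj UNIV_I)
    have s: "s y \<in> ?U" "top_part (s y) = y" for y
      unfolding s_def by (rule inv_into_into[OF mem], rule f_inv_into_f[OF mem])
    have s_eq: "v \<in> ?U \<Longrightarrow> s (top_part v) = v" for v
      unfolding s_def by (rule inv_into_f_f[OF top_inj])
    have s_add: "s (y + y') = s y + s y'" for y y'
    proof -
      have "s y + s y' \<in> ?U" using subU s(1) unfolding subspace_bit_iff by blast
      from s_eq[OF this] show ?thesis by (simp add: parts_add s)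
    qed
    obtain A where A: "\<And>y. bottom_part (s y) = y v* A"
      using additive_matrix[of "\<lambda>y. bottom_part (s y)"] by (simp only: s_add parts_add) blast
    have "lift A \<subseteq> ?U"
    proof
      fix v assume "v \<in> lift A"
      then obtain y where "v = join y (y v* A)" unfolding lift_def by (rule rangeE)
      moreover have "join (top_part (s y)) (bottom_part (s y)) = s y" by (rule join_parts)
      ultimately have "v = s y" by (simp only: s(2) A)
      then show "v \<in> ?U" by (simp only: s(1))
    qed
    then have "lift A = ?U"
      by (rule card_subset_eq[OF finite]) (simp only: card_lift cardU)
    then show ?thesis by blast
  qed
  define C where "C = {A. g ` lift A \<in> P - {S}}"
  have lifts: "(`) g ` lift ` C = P - {S}"
  proof
    show "P - {S} \<subseteq> (`) g ` lift ` C"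
    proof
      fix U assume U: "U \<in> P - {S}"
      from graph[OF this] obtain A where "g -` U = lift A" ..
      then have eq: "g ` lift A = U" using img[of U] by (simp only:)
      then have "A \<in> C" using U by (simp only: C_def mem_Collect_eq)
      then have "g ` lift A \<in> (`) g ` lift ` C" by (intro imageI)
      then show "U \<in> (`) g ` lift ` C" by (simp only: eq)
    qed
    show "(`) g ` lift ` C \<subseteq> P - {S}"
      by (rule image_subsetI, erule imageE) (simp only: C_def mem_Collect_eq)
  qed
  have "g ` special = S" using img[of S] by (simp only: special)
  then have "(`) g ` lift_code C = insert S (P - {S})"
    by (simp only: lift_code_def image_insert lifts)
  then have "P = (`) g ` lift_code C" using S(1) by (simp only: insert_Diff)
  then have iso: "vsp_isomorphic (lift_code C) P"
    unfolding vsp_isomorphic_additive by (intro exI[of _ g] conjI allI g_add g_inj)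
  have inj_g_lift: "inj (\<lambda>A. g ` lift A)"
    by (rule injI) (simp only: inj_image_eq_iff[OF g_inj] inj_eq[OF inj_lift])
  have "card C = card ((\<lambda>A. g ` lift A) ` C)"
    by (rule card_image[symmetric]) (rule inj_on_subset[OF inj_g_lift subset_UNIV])
  also have "(\<lambda>A. g ` lift A) ` C = P - {S}"
    using lifts by (simp only: image_image)
  finally have "card C = 16" using card_rest by simp
  \<comment> \<open>A vector \<open>u\<close> annihilated by \<open>A - B\<close> produces a common
    vector of two distinct members, which must be 0.\<close>
  moreover have "full (A - B)" if AB: "A \<in> C" "B \<in> C" "A \<noteq> B" for A B
    unfolding full_def
  proof (intro allI impI)
    fix u assume "u v* (A - B) = 0"
    then have "join u (u v* A) \<in> lift A" "join u (u v* A) \<in> lift B"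
      by (auto simp: join_in_lift vector_matrix_mult_diff_rdistrib)
    then have "g (join u (u v* A)) \<in> g ` lift A" "g (join u (u v* A)) \<in> g ` lift B"
      by (simp_all only: imageI)
    moreover have "g ` lift A \<in> P" "g ` lift B \<in> P" using AB unfolding C_def by blast+
    moreover have "g ` lift A \<noteq> g ` lift B"
      using AB(3) by (simp only: inj_image_eq_iff[OF g_inj] inj_eq[OF inj_lift] not_False_eq_True)
    ultimately have "g (join u (u v* A)) = 0" using meet by blast
    then have "join u (u v* A) = 0" by (rule g0)
    then show "u = 0" by simp
  qed
  ultimately have "MRD_code 3 C" unfolding MRD_code_3_iff by blast
  with iso show ?thesis by blast
qed

lemma num_partitions_eq_num_codes:
  assumes "num_iso_types {C :: (bit ^ 4 ^ 3) set. MRD_code 3 C} code_isomorphic = n" "0 < n"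
  shows "num_iso_types partition_3_4 vsp_isomorphic = n"
  using equivp_code_isomorphic equivp_vsp_isomorphic _ _ _ assms
proof (rule num_iso_types_transfer[where F = lift_code])
  show "lift_code C \<in> partition_3_4" if "C \<in> {C. MRD_code 3 C}" for C
    using lift_code_partition that by blast
  show "code_isomorphic C D \<longleftrightarrow> vsp_isomorphic (lift_code C) (lift_code D)" for C D
    using lift_code_isomorphic lift_code_isomorphicD by blast
  show "\<exists>C\<in>{C. MRD_code 3 C}. vsp_isomorphic (lift_code C) P" if "P \<in> partition_3_4" for P
    using partition_isomorphic_lift_code[OF that] by blast
qed

section \<open>Tables for vectors of length four\<close>

text \<open>A vector over \<open>\<bbbF>\<^sub>2\<close> of length four is named by the letter whose number, counting from \<open>A\<close> as 0, has
  the vector as its binary digits; \<open>Z\<close> stands for 14, as \<open>O\<close> is an infix operator. \<open>W0\<close> stands for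
  the span of two dependent vectors, \<open>W1\<close> to \<open>W35\<close> are the planes, and \<open>look c (kerrow w)\<close> is the
  nonzero vector orthogonal to \<open>w\<close> and \<open>c\<close>, or \<open>A\<close> if it is not unique.\<close>

datatype (plugins only: size) nib = A | B | C | D | E | F | G | H | I | J | K | L | M | N | Z | P

text \<open>A map on letters is stored as sixteen entries, so that a lookup at a literal letter is
  one rewriting step by \<open>look_T\<close>.\<close>

datatype (plugins only: size) 'a tab =
  T (tA: 'a) (tB: 'a) (tC: 'a) (tD: 'a) (tE: 'a) (tF: 'a) (tG: 'a) (tH: 'a) (tI: 'a) (tJ: 'a) (tK: 'a) (tL: 'a) (tM: 'a) (tN: 'a) (tZ: 'a) (tP: 'a)

primrec look :: "nib \<Rightarrow> 'a tab \<Rightarrow> 'a" where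
"look A t = tA t"
| "look B t = tB t"
| "look C t = tC t"
| "look D t = tD t"
| "look E t = tE t"
| "look F t = tF t"
| "look G t = tG t"
| "look H t = tH t"
| "look I t = tI t"
| "look J t = tJ t"
| "look K t = tK t"
| "look L t = tL t"
| "look M t = tM t"
| "look N t = tN t"
| "look Z t = tZ t"
| "look P t = tP t"

lemma look_T:
  "look A (T aA aB aC aD aE aF aG aH aI aJ aK aL aM aN aZ aP) = aA"
  "look B (T aA aB aC aD aE aF aG aH aI aJ aK aL aM aN aZ aP) = aB"
  "look C (T aA aB aC aD aE aF aG aH aI aJ aK aL aM aN aZ aP) = aC"
  "look D (T aA aB aC aD aE aF aG aH aI aJ aK aL aM aN aZ aP) = aD"
  "look E (T aA aB aC aD aE aF aG aH aI aJ aK aL aM aN aZ aP) = aE"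
  "look F (T aA aB aC aD aE aF aG aH aI aJ aK aL aM aN aZ aP) = aF"
  "look G (T aA aB aC aD aE aF aG aH aI aJ aK aL aM aN aZ aP) = aG"
  "look H (T aA aB aC aD aE aF aG aH aI aJ aK aL aM aN aZ aP) = aH"
  "look I (T aA aB aC aD aE aF aG aH aI aJ aK aL aM aN aZ aP) = aI"
  "look J (T aA aB aC aD aE aF aG aH aI aJ aK aL aM aN aZ aP) = aJ"
  "look K (T aA aB aC aD aE aF aG aH aI aJ aK aL aM aN aZ aP) = aK"
  "look L (T aA aB aC aD aE aF aG aH aI aJ aK aL aM aN aZ aP) = aL"
  "look M (T aA aB aC aD aE aF aG aH aI aJ aK aL aM aN aZ aP) = aM"
  "look N (T aA aB aC aD aE aF aG aH aI aJ aK aL aM aN aZ aP) = aN"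
  "look Z (T aA aB aC aD aE aF aG aH aI aJ aK aL aM aN aZ aP) = aZ"
  "look P (T aA aB aC aD aE aF aG aH aI aJ aK aL aM aN aZ aP) = aP"
  by simp_all

primrec upd :: "nib \<Rightarrow> 'a \<Rightarrow> 'a tab \<Rightarrow> 'a tab" where
"upd A y t = T y (tB t) (tC t) (tD t) (tE t) (tF t) (tG t) (tH t) (tI t) (tJ t) (tK t) (tL t)
   (tM t) (tN t) (tZ t) (tP t)"
| "upd B y t = T (tA t) y (tC t) (tD t) (tE t) (tF t) (tG t) (tH t) (tI t) (tJ t) (tK t) (tL t)
   (tM t) (tN t) (tZ t) (tP t)"
| "upd C y t = T (tA t) (tB t) y (tD t) (tE t) (tF t) (tG t) (tH t) (tI t) (tJ t) (tK t) (tL t)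
   (tM t) (tN t) (tZ t) (tP t)"
| "upd D y t = T (tA t) (tB t) (tC t) y (tE t) (tF t) (tG t) (tH t) (tI t) (tJ t) (tK t) (tL t)
   (tM t) (tN t) (tZ t) (tP t)"
| "upd E y t = T (tA t) (tB t) (tC t) (tD t) y (tF t) (tG t) (tH t) (tI t) (tJ t) (tK t) (tL t)
   (tM t) (tN t) (tZ t) (tP t)"
| "upd F y t = T (tA t) (tB t) (tC t) (tD t) (tE t) y (tG t) (tH t) (tI t) (tJ t) (tK t) (tL t)
   (tM t) (tN t) (tZ t) (tP t)"
| "upd G y t = T (tA t) (tB t) (tC t) (tD t) (tE t) (tF t) y (tH t) (tI t) (tJ t) (tK t) (tL t)
   (tM t) (tN t) (tZ t) (tP t)"
| "upd H y t = T (tA t) (tB t) (tC t) (tD t) (tE t) (tF t) (tG t) y (tI t) (tJ t) (tK t) (tL t)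
   (tM t) (tN t) (tZ t) (tP t)"
| "upd I y t = T (tA t) (tB t) (tC t) (tD t) (tE t) (tF t) (tG t) (tH t) y (tJ t) (tK t) (tL t)
   (tM t) (tN t) (tZ t) (tP t)"
| "upd J y t = T (tA t) (tB t) (tC t) (tD t) (tE t) (tF t) (tG t) (tH t) (tI t) y (tK t) (tL t)
   (tM t) (tN t) (tZ t) (tP t)"
| "upd K y t = T (tA t) (tB t) (tC t) (tD t) (tE t) (tF t) (tG t) (tH t) (tI t) (tJ t) y (tL t)
   (tM t) (tN t) (tZ t) (tP t)"
| "upd L y t = T (tA t) (tB t) (tC t) (tD t) (tE t) (tF t) (tG t) (tH t) (tI t) (tJ t) (tK t) y
   (tM t) (tN t) (tZ t) (tP t)"
| "upd M y t = T (tA t) (tB t) (tC t) (tD t) (tE t) (tF t) (tG t) (tH t) (tI t) (tJ t) (tK t) (tL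
   t) y (tN t) (tZ t) (tP t)"
| "upd N y t = T (tA t) (tB t) (tC t) (tD t) (tE t) (tF t) (tG t) (tH t) (tI t) (tJ t) (tK t) (tL
   t) (tM t) y (tZ t) (tP t)"
| "upd Z y t = T (tA t) (tB t) (tC t) (tD t) (tE t) (tF t) (tG t) (tH t) (tI t) (tJ t) (tK t) (tL
   t) (tM t) (tN t) y (tP t)"
| "upd P y t = T (tA t) (tB t) (tC t) (tD t) (tE t) (tF t) (tG t) (tH t) (tI t) (tJ t) (tK t) (tL
   t) (tM t) (tN t) (tZ t) y"

lemma upd_T:
  "upd A y (T aA aB aC aD aE aF aG aH aI aJ aK aL aM aN aZ aP) = T y aB aC aD aE aF aG aH aI aJ aK
     aL aM aN aZ aP"
  "upd B y (T aA aB aC aD aE aF aG aH aI aJ aK aL aM aN aZ aP) = T aA y aC aD aE aF aG aH aI aJ aK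
     aL aM aN aZ aP"
  "upd C y (T aA aB aC aD aE aF aG aH aI aJ aK aL aM aN aZ aP) = T aA aB y aD aE aF aG aH aI aJ aK
     aL aM aN aZ aP"
  "upd D y (T aA aB aC aD aE aF aG aH aI aJ aK aL aM aN aZ aP) = T aA aB aC y aE aF aG aH aI aJ aK
     aL aM aN aZ aP"
  "upd E y (T aA aB aC aD aE aF aG aH aI aJ aK aL aM aN aZ aP) = T aA aB aC aD y aF aG aH aI aJ aK
     aL aM aN aZ aP"
  "upd F y (T aA aB aC aD aE aF aG aH aI aJ aK aL aM aN aZ aP) = T aA aB aC aD aE y aG aH aI aJ aK
     aL aM aN aZ aP"
  "upd G y (T aA aB aC aD aE aF aG aH aI aJ aK aL aM aN aZ aP) = T aA aB aC aD aE aF y aH aI aJ aK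
     aL aM aN aZ aP"
  "upd H y (T aA aB aC aD aE aF aG aH aI aJ aK aL aM aN aZ aP) = T aA aB aC aD aE aF aG y aI aJ aK
     aL aM aN aZ aP"
  "upd I y (T aA aB aC aD aE aF aG aH aI aJ aK aL aM aN aZ aP) = T aA aB aC aD aE aF aG aH y aJ aK
     aL aM aN aZ aP"
  "upd J y (T aA aB aC aD aE aF aG aH aI aJ aK aL aM aN aZ aP) = T aA aB aC aD aE aF aG aH aI y aK
     aL aM aN aZ aP"
  "upd K y (T aA aB aC aD aE aF aG aH aI aJ aK aL aM aN aZ aP) = T aA aB aC aD aE aF aG aH aI aJ y
     aL aM aN aZ aP"
  "upd L y (T aA aB aC aD aE aF aG aH aI aJ aK aL aM aN aZ aP) = T aA aB aC aD aE aF aG aH aI aJ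
     aK y aM aN aZ aP"
  "upd M y (T aA aB aC aD aE aF aG aH aI aJ aK aL aM aN aZ aP) = T aA aB aC aD aE aF aG aH aI aJ
     aK aL y aN aZ aP"
  "upd N y (T aA aB aC aD aE aF aG aH aI aJ aK aL aM aN aZ aP) = T aA aB aC aD aE aF aG aH aI aJ
     aK aL aM y aZ aP"
  "upd Z y (T aA aB aC aD aE aF aG aH aI aJ aK aL aM aN aZ aP) = T aA aB aC aD aE aF aG aH aI aJ
     aK aL aM aN y aP"
  "upd P y (T aA aB aC aD aE aF aG aH aI aJ aK aL aM aN aZ aP) = T aA aB aC aD aE aF aG aH aI aJ
     aK aL aM aN aZ y"
  by simp_all

primrec addrow :: "nib \<Rightarrow> nib tab" where
"addrow A = T A B C D E F G H I J K L M N Z P"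
| "addrow B = T B A D C F E H G J I L K N M P Z"
| "addrow C = T C D A B G H E F K L I J Z P M N"
| "addrow D = T D C B A H G F E L K J I P Z N M"
| "addrow E = T E F G H A B C D M N Z P I J K L"
| "addrow F = T F E H G B A D C N M P Z J I L K"
| "addrow G = T G H E F C D A B Z P M N K L I J"
| "addrow H = T H G F E D C B A P Z N M L K J I"
| "addrow I = T I J K L M N Z P A B C D E F G H"
| "addrow J = T J I L K N M P Z B A D C F E H G"
| "addrow K = T K L I J Z P M N C D A B G H E F"
| "addrow L = T L K J I P Z N M D C B A H G F E"
| "addrow M = T M N Z P I J K L E F G H A B C D"
| "addrow N = T N M P Z J I L K F E H G B A D C"
| "addrow Z = T Z P M N K L I J G H E F C D A B"
| "addrow P = T P Z N M L K J I H G F E D C B A"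

datatype (plugins only: size) plane =
  W0 | W1 | W2 | W3 | W4 | W5 | W6 | W7 | W8 | W9 | W10 | W11 | W12 | W13 | W14 | W15 | W16 | W17
    | W18 | W19 | W20 | W21 | W22 | W23 | W24 | W25 | W26 | W27 | W28 | W29 | W30 | W31 | W32 |
    W33 | W34 | W35

primrec planerow :: "nib \<Rightarrow> plane tab" where
"planerow A = T W0 W0 W0 W0 W0 W0 W0 W0 W0 W0 W0 W0 W0 W0 W0 W0"
| "planerow B = T W0 W0 W1 W1 W2 W2 W3 W3 W4 W4 W5 W5 W6 W6 W7 W7"
| "planerow C = T W0 W1 W0 W1 W8 W9 W8 W9 W10 W11 W10 W11 W12 W13 W12 W13"
| "planerow D = T W0 W1 W1 W0 W14 W15 W15 W14 W16 W17 W17 W16 W18 W19 W19 W18"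
| "planerow E = T W0 W2 W8 W14 W0 W2 W8 W14 W20 W21 W22 W23 W20 W21 W22 W23"
| "planerow F = T W0 W2 W9 W15 W2 W0 W15 W9 W24 W25 W26 W27 W25 W24 W27 W26"
| "planerow G = T W0 W3 W8 W15 W8 W15 W0 W3 W28 W29 W30 W31 W30 W31 W28 W29"
| "planerow H = T W0 W3 W9 W14 W14 W9 W3 W0 W32 W33 W34 W35 W35 W34 W33 W32"
| "planerow I = T W0 W4 W10 W16 W20 W24 W28 W32 W0 W4 W10 W16 W20 W24 W28 W32"
| "planerow J = T W0 W4 W11 W17 W21 W25 W29 W33 W4 W0 W17 W11 W25 W21 W33 W29"
| "planerow K = T W0 W5 W10 W17 W22 W26 W30 W34 W10 W17 W0 W5 W30 W34 W22 W26"
| "planerow L = T W0 W5 W11 W16 W23 W27 W31 W35 W16 W11 W5 W0 W35 W31 W27 W23"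
| "planerow M = T W0 W6 W12 W18 W20 W25 W30 W35 W20 W25 W30 W35 W0 W6 W12 W18"
| "planerow N = T W0 W6 W13 W19 W21 W24 W31 W34 W24 W21 W34 W31 W6 W0 W19 W13"
| "planerow Z = T W0 W7 W12 W19 W22 W27 W28 W33 W28 W33 W22 W27 W12 W19 W0 W7"
| "planerow P = T W0 W7 W13 W18 W23 W26 W29 W32 W32 W29 W26 W23 W18 W13 W7 W0"

primrec kerrow :: "plane \<Rightarrow> nib tab" where
"kerrow W0 = T A A A A A A A A A A A A A A A A"
| "kerrow W1 = T A A A A I I I I E E E E M M M M"
| "kerrow W2 = T A A I I A A I I C C K K C C K K"
| "kerrow W3 = T A A I I I I A A G G Z Z Z Z G G"
| "kerrow W4 = T A A E E C C G G A A E E C C G G"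
| "kerrow W5 = T A A E E K K Z Z E E A A Z Z K K"
| "kerrow W6 = T A A M M C C Z Z C C Z Z A A M M"
| "kerrow W7 = T A A M M K K G G G G K K M M A A"
| "kerrow W8 = T A I A I A I A I B J B J B J B J"
| "kerrow W9 = T A I A I I A I A F N F N N F N F"
| "kerrow W10 = T A E A E B F B F A E A E B F B F"
| "kerrow W11 = T A E A E J N J N E A E A N J N J"
| "kerrow W12 = T A M A M B N B N B N B N A M A M"
| "kerrow W13 = T A M A M J F J F F J F J M A M A"
| "kerrow W14 = T A I I A A I I A D L L D D L L D"
| "kerrow W15 = T A I I A I A A I H P P H P H H P"
| "kerrow W16 = T A E E A D H H D A E E A D H H D"
| "kerrow W17 = T A E E A L P P L E A A E P L L P"
| "kerrow W18 = T A M M A D P P D D P P D A M M A"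
| "kerrow W19 = T A M M A L H H L H L L H M A A M"
| "kerrow W20 = T A C B D A C B D A C B D A C B D"
| "kerrow W21 = T A C J L A C J L C A L J C A L J"
| "kerrow W22 = T A K B L A K B L B L A K B L A K"
| "kerrow W23 = T A K J D A K J D D J K A D J K A"
| "kerrow W24 = T A C F H C A H F A C F H C A H F"
| "kerrow W25 = T A C N P C A P N C A P N A C N P"
| "kerrow W26 = T A K F P K A P F F P A K P F K A"
| "kerrow W27 = T A K N H K A H N H N K A N H A K"
| "kerrow W28 = T A G B H B H A G A G B H B H A G"
| "kerrow W29 = T A G J P J P A G G A P J P J G A"
| "kerrow W30 = T A Z B P B P A Z B P A Z A Z B P"
| "kerrow W31 = T A Z J H J H A Z H J Z A Z A H J"
| "kerrow W32 = T A G F D D F G A A G F D D F G A"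
| "kerrow W33 = T A G N L L N G A G A L N N L A G"
| "kerrow W34 = T A Z F L L F Z A F L A Z Z A L F"
| "kerrow W35 = T A Z N D D N Z A D N Z A A Z N D"

section \<open>Arithmetic on letters\<close>

definition add :: "nib \<Rightarrow> nib \<Rightarrow> nib" where
  "add a b = look b (addrow a)"

text \<open>Passing through the span of \<open>a\<close> and \<open>b\<close> replaces a table of
  \<open>16 ^ 3\<close> entries by 36 rows of 16; F_2^4 has 35 planes, and one more row serves
  dependent pairs.\<close>

definition kr :: "nib \<Rightarrow> nib \<Rightarrow> nib \<Rightarrow> nib" where
  "kr a b c = look c (kerrow (look b (planerow a)))"

text \<open>The values at \<open>A\<close> and \<open>I\<close> are junk, chosen such that \<open>comb u\<close> is a nonzero combination
  for every \<open>u\<close>.\<close>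

primrec comb :: "nib \<Rightarrow> nib \<Rightarrow> nib \<Rightarrow> nib \<Rightarrow> nib" where
  "comb A a b c = a" | "comb B a b c = a" | "comb C a b c = b" | "comb D a b c = add a b"
| "comb E a b c = c" | "comb F a b c = add a c" | "comb G a b c = add b c"
| "comb H a b c = add (add a b) c"
| "comb I a b c = a" | "comb J a b c = a" | "comb K a b c = b" | "comb L a b c = add a b"
| "comb M a b c = c" | "comb N a b c = add a c" | "comb Z a b c = add b c"
| "comb P a b c = add (add a b) c"

text \<open>The linear map with values \<open>a\<close>, \<open>b\<close>, \<open>c\<close>,
  \<open>d\<close> at the unit vectors \<open>B\<close>, \<open>C\<close>, \<open>E\<close>,
  \<open>I\<close>, tabulated at all letters.\<close>

definition lintab :: "nib \<Rightarrow> nib \<Rightarrow> nib \<Rightarrow> nib \<Rightarrow> nib tab" where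
  "lintab a b c d = T A a b (add a b) c (add a c) (add b c) (add (add a b) c)
     d (add a d) (add b d) (add (add a b) d) (add c d) (add (add a c) d) (add (add b c) d)
     (add (add (add a b) c) d)"

datatype (plugins only: size) mat = X nib nib nib

primrec kd :: "mat \<Rightarrow> mat \<Rightarrow> nib" where
  "kd (X a b c) n = (case n of X a' b' c' \<Rightarrow> kr (add a a') (add b b') (add c c'))"

text \<open>Tests on letters are lookups in tables of truth values, so that evaluation never has to
  decide an equation between letters.\<close>

definition falses :: "bool tab" where
  "falses = T False False False False False False False False
     False False False False False False False False"

definition nonzero :: "bool tab" where
  "nonzero = T False True True True True True True True
     True True True True True True True True"

definition only :: "nib \<Rightarrow> bool tab" where
  "only a = upd a True falses"

definition all_nonzero :: "nib tab \<Rightarrow> bool" where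
  "all_nonzero t \<longleftrightarrow> (\<forall>x. x \<noteq> A \<longrightarrow> look x t \<noteq> A)"

definition keep :: "bool \<Rightarrow> 'a \<Rightarrow> 'a list \<Rightarrow> 'a list" where
  "keep t x l = (if t then x # l else l)"

section \<open>Filtering of candidates and tests for embeddings\<close>

text \<open>Marks the kernels still admissible for the difference of \<open>m\<close> and a further
  codeword: nonzero, and not already taken by a difference of \<open>m\<close> with an element of
  \<open>k\<close>.\<close>

primrec fmask :: "mat list \<Rightarrow> mat \<Rightarrow> bool tab" where
  "fmask [] m = nonzero"
| "fmask (n # k) m = upd (kd m n) False (fmask k m)"

text \<open>The three addition rows of the new codeword are passed as arguments, so they are
  computed once and shared by all candidates.\<close>

primrec flt :: "nib tab \<Rightarrow> nib tab \<Rightarrow> nib tab \<Rightarrow> bool tab \<Rightarrow> mat list \<Rightarrow> mat list" where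
  "flt ra rb rc t [] = []"
| "flt ra rb rc t (m # l) = keep
     (case m of X a b c \<Rightarrow> look (kr (look a ra) (look b rb) (look c rc)) t) m (flt ra rb rc t l)"

primrec prune :: "mat \<Rightarrow> mat list \<Rightarrow> mat list \<Rightarrow> mat list" where
  "prune (X a b c) k l = flt (addrow a) (addrow b) (addrow c) (fmask k (X a b c)) l"

primrec sel :: "nib \<Rightarrow> bool tab \<Rightarrow> mat list \<Rightarrow> mat list" where
  "sel u t [] = []"
| "sel u t (m # l) = keep (case m of X a b c \<Rightarrow> look (comb u a b c) t) m (sel u t l)"

primrec memb :: "bool tab \<Rightarrow> bool tab \<Rightarrow> bool tab \<Rightarrow> mat list \<Rightarrow> bool" where
  "memb ra rb rc [] = False"
| "memb ra rb rc (m # l) =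
     ((case m of X a b c \<Rightarrow> look a ra \<and> look b rb \<and> look c rc) \<or> memb ra rb rc l)"

primrec has :: "mat list \<Rightarrow> mat \<Rightarrow> bool" where
  "has l (X a b c) = memb (only a) (only b) (only c) l"

text \<open>\<open>p\<close>, \<open>q\<close>, \<open>r\<close> stand for the rows of the left
  factor and \<open>x\<close>, \<open>y\<close>, \<open>z\<close> are the rows of the translation.
  The right factor acts on each row separately and has been applied beforehand through
  \<open>lintab\<close>.\<close>

definition affine_image :: "nib \<Rightarrow> nib \<Rightarrow> nib \<Rightarrow> nib \<Rightarrow> nib \<Rightarrow> nib \<Rightarrow> nib \<Rightarrow> nib \<Rightarrow> nib \<Rightarrow> mat" where
  "affine_image p q r x y z a b c = X (add x (comb p a b c)) (add y (comb q a b c)) (add z (comb r a b c))"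

primrec embeds :: "nib tab \<Rightarrow> nib \<Rightarrow> nib \<Rightarrow> nib \<Rightarrow> nib \<Rightarrow> nib \<Rightarrow> nib \<Rightarrow> mat list \<Rightarrow> mat list \<Rightarrow> bool" where
  "embeds t p q r x y z l [] = True"
| "embeds t p q r x y z l (m # e) \<longleftrightarrow> (case m of X a b c \<Rightarrow>
     has l (affine_image p q r x y z (look a t) (look b t) (look c t))) \<and> embeds t p q r x y z l e"

primrec embeds_hd :: "nib tab \<Rightarrow> nib \<Rightarrow> nib \<Rightarrow> nib \<Rightarrow> nib \<Rightarrow> nib \<Rightarrow> nib \<Rightarrow> mat list \<Rightarrow> mat list list \<Rightarrow> bool" where
  "embeds_hd t p q r x y z l [] = False"
| "embeds_hd t p q r x y z l (e # env) = embeds t p q r x y z l e"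

definition drop16 :: "'a list \<Rightarrow> 'a list" where
  "drop16 l = drop 16 l"

primrec drops :: "nib \<Rightarrow> ('a list \<Rightarrow> 'a list) \<Rightarrow> 'a list \<Rightarrow> 'a list" where
  "drops A f l = l" | "drops B f l = f l" | "drops C f l = f (f l)" | "drops D f l = f (f (f l))"
| "drops E f l = f (f (f (f l)))" | "drops F f l = f (f (f (f (f l))))"
| "drops G f l = f (f (f (f (f (f l)))))" | "drops H f l = f (f (f (f (f (f (f l))))))"
| "drops I f l = f (f (f (f (f (f (f (f l)))))))"
| "drops J f l = f (f (f (f (f (f (f (f (f l))))))))"
| "drops K f l = f (f (f (f (f (f (f (f (f (f l)))))))))"
| "drops L f l = f (f (f (f (f (f (f (f (f (f (f l))))))))))"
| "drops M f l = f (f (f (f (f (f (f (f (f (f (f (f l)))))))))))"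
| "drops N f l = f (f (f (f (f (f (f (f (f (f (f (f (f l))))))))))))"
| "drops Z f l = f (f (f (f (f (f (f (f (f (f (f (f (f (f l)))))))))))))"
| "drops P f l = f (f (f (f (f (f (f (f (f (f (f (f (f (f (f l))))))))))))))"

text \<open>The right factor has the rows \<open>a\<close>, \<open>b\<close>, \<open>c\<close>,
  \<open>d\<close>. Completing \<open>p\<close>, \<open>q\<close>, \<open>r\<close> by the unit
  vector \<open>I\<close> subjects the 3 by 3 left factor to the same test for invertibility as the
  4 by 4 right factor.\<close>

definition embedding where
  "embedding i j a b c d p q r x y z l env \<longleftrightarrow>
     all_nonzero (lintab a b c d) \<and> all_nonzero (lintab p q r I) \<and>
     embeds_hd (lintab a b c d) p q r x y z l (drops j tl (drops i drop16 env))"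

definition length16 :: "'a list \<Rightarrow> bool" where
  "length16 l \<longleftrightarrow> length l = 16"

definition guard :: "bool \<Rightarrow> 'a \<Rightarrow> 'a option" where
  "guard t e = (if t then Some e else None)"

definition save :: "mat list \<Rightarrow> mat list list \<Rightarrow> mat list list option" where
  "save k env = Some (k # env)"

text \<open>A node of a certificate concerns a partial code \<open>k\<close> and a list \<open>l\<close> of candidates containing every
  further codeword. \<open>Q\<close> and \<open>U\<close> embed a configuration treated before, the one at position \<open>16 i + j\<close> of
  \<open>env\<close>, into \<open>k\<close> or, when only 16 matrices are left, into \<open>l @ k\<close>. \<open>R\<close> branches over the codeword whose
  rows have a prescribed value \<open>v\<close> of the combination \<open>u\<close>, and \<open>S\<close> adds \<open>k\<close> to \<open>env\<close>.\<close>

datatype (plugins only: size) cert =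
    Q nib nib nib nib nib nib nib nib nib nib nib nib
  | U nib nib nib nib nib nib nib nib nib nib nib nib
  | R nib nib "cert list"
  | S cert

text \<open>A \<open>Q\<close> leaf inspects the partial code alone, so the filtering of its
  candidates is saved.\<close>

primrec narrow :: "cert \<Rightarrow> mat \<Rightarrow> mat list \<Rightarrow> mat list \<Rightarrow> mat list" where
  "narrow (Q i j a b c d p q r x y z) m k l = []"
| "narrow (U i j a b c d p q r x y z) m k l = prune m k l"
| "narrow (R u v ts) m k l = prune m k l"
| "narrow (S t) m k l = prune m k l"

text \<open>\<open>env\<close> is threaded through the tree: a configuration saved in one branch is
  available in all later ones. A branching selects from \<open>k @ l\<close>, because the codeword
  with the prescribed combination may have been chosen already. Lists of subtrees that do not match
  the candidates in length are rejected.\<close>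

fun check :: "cert \<Rightarrow> mat list \<Rightarrow> mat list \<Rightarrow> mat list list \<Rightarrow> mat list list option"
and checks :: "mat list \<Rightarrow> cert list \<Rightarrow> mat list \<Rightarrow> mat list \<Rightarrow> mat list list \<Rightarrow> mat list list option" where
  "check (Q i j a b c d p q r x y z) k l env = guard (embedding i j a b c d p q r x y z k env) env"
| "check (U i j a b c d p q r x y z) k l env =
     guard (length16 (l @ k) \<and> embedding i j a b c d p q r x y z (l @ k) env) env"
| "check (R u v ts) k l env = checks (sel u (only v) (k @ l)) ts k l env"
| "check (S t) k l env = Option.bind (check t k l env) (save k)"
| "checks [] [] k l env = Some env"
| "checks (m # ms) (t # ts) k l env =
     Option.bind (check t (m # k) (narrow t m k l) env) (\<lambda>env'. checks ms ts k l env')"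
| "checks _ _ k l env = None"

definition nibs :: "nib list" where
  "nibs = [A, B, C, D, E, F, G, H, I, J, K, L, M, N, Z, P]"

definition mats :: "mat list" where
  "mats = concat (map (\<lambda>a. concat (map (\<lambda>b. map (X a b) nibs) nibs)) nibs)"

section \<open>Soundness of the certificate checker\<close>

lemma UNIV_nib: "UNIV = set nibs"
proof -
  have "x \<in> set nibs" for x by (cases x) (simp_all add: nibs_def)
  then show ?thesis by (rule UNIV_eq_I)
qed

lemma set_mats: "set mats = UNIV"
proof -
  have eq: "set mats = (\<Union>a. \<Union>b. range (X a b))" by (simp add: mats_def UNIV_nib[symmetric])
  have "m \<in> set mats" for m unfolding eq by (cases m) blast
  then show ?thesis by (rule UNIV_eq_I[symmetric])
qed

lemma look_upd: "look j (upd i y t) = (if i = j then y else look j t)"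
  by (cases i; cases j) simp_all

lemma look_nonzero: "look j nonzero \<longleftrightarrow> j \<noteq> A"
  by (cases j) (simp_all add: nonzero_def)

lemma look_only: "look j (only i) \<longleftrightarrow> j = i"
proof -
  have "\<not> look j falses" by (cases j) (simp_all add: falses_def)
  then show ?thesis by (auto simp: only_def look_upd)
qed

section \<open>Translation of letters into vectors and matrices\<close>

definition vec4 :: "bit \<Rightarrow> bit \<Rightarrow> bit \<Rightarrow> bit \<Rightarrow> bit ^ 4" where
  "vec4 a b c d = (\<chi> i. if i = 1 then a else if i = 2 then b else if i = 3 then c else d)"

text \<open>Polymorphic, so that it also assembles a matrix from its three rows.\<close>

definition vec3 :: "'a \<Rightarrow> 'a \<Rightarrow> 'a \<Rightarrow> 'a ^ 3" where
  "vec3 a b c = (\<chi> i. if i = 1 then a else if i = 2 then b else c)"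

lemma vec4_eq_iff: "vec4 a b c d = vec4 a' b' c' d' \<longleftrightarrow> a = a' \<and> b = b' \<and> c = c' \<and> d = d'"
  by (simp add: vec_eq_iff forall_4 vec4_def)

lemma vec3_eq_iff: "vec3 a b c = vec3 a' b' c' \<longleftrightarrow> a = a' \<and> b = b' \<and> c = c'"
  by (simp add: vec_eq_iff forall_3 vec3_def)

lemma vec4_add: "vec4 a b c d + vec4 a' b' c' d' = vec4 (a + a') (b + b') (c + c') (d + d')"
  by (simp add: vec_eq_iff forall_4 vec4_def)

lemma vec3_add: "vec3 a b c + vec3 a' b' c' = vec3 (a + a') (b + b') (c + c')"
  by (simp add: vec_eq_iff forall_3 vec3_def)

lemma vec4_0: "vec4 0 0 0 0 = 0" and vec3_0: "vec3 0 0 0 = 0"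
  by (simp_all add: vec_eq_iff forall_3 forall_4 vec3_def vec4_def)

lemma vec4_exhaust: "\<exists>a b c d. x = vec4 a b c d"
  by (rule exI[of _ "x $ 1"], rule exI[of _ "x $ 2"], rule exI[of _ "x $ 3"], rule exI[of _ "x $ 4"])
    (simp add: vec_eq_iff forall_4 vec4_def)

lemma vec3_exhaust: "\<exists>a b c. x = vec3 a b c"
  by (rule exI[of _ "x $ 1"], rule exI[of _ "x $ 2"], rule exI[of _ "x $ 3"])
    (simp add: vec_eq_iff forall_3 vec3_def)

lemma dot_vec4: "dot (vec4 a b c d) (vec4 a' b' c' d') = a * a' + b * b' + c * c' + d * d'"
  by (simp only: dot_def sum_4 vec4_def vec_lambda_beta) simp

text \<open>The least significant digit comes first, which makes \<open>B\<close>, \<open>C\<close>,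
  \<open>E\<close>, \<open>I\<close> the unit vectors.\<close>

primrec nvec :: "nib \<Rightarrow> bit ^ 4" where
  "nvec A = vec4 0 0 0 0" | "nvec B = vec4 1 0 0 0" | "nvec C = vec4 0 1 0 0" | "nvec D = vec4 1 1 0 0"
| "nvec E = vec4 0 0 1 0" | "nvec F = vec4 1 0 1 0" | "nvec G = vec4 0 1 1 0" | "nvec H = vec4 1 1 1 0"
| "nvec I = vec4 0 0 0 1" | "nvec J = vec4 1 0 0 1" | "nvec K = vec4 0 1 0 1" | "nvec L = vec4 1 1 0 1"
| "nvec M = vec4 0 0 1 1" | "nvec N = vec4 1 0 1 1" | "nvec Z = vec4 0 1 1 1" | "nvec P = vec4 1 1 1 1"

lemma bit_add: "0 + a = a" "a + 0 = a" "1 + 1 = (0 :: bit)" for a :: bit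
  by simp_all

lemma nvec_add: "nvec (add a b) = nvec a + nvec b"
  by (cases a; cases b)
    (simp_all only: add_def addrow.simps look_T nvec.simps vec4_add bit_add)

lemma nvec_eq_iff: "nvec a = nvec b \<longleftrightarrow> a = b"
  by (cases a; cases b) (simp_all only: nvec.simps vec4_eq_iff nib.distinct zero_neq_one one_neq_zero simp_thms)

lemma nvec_A: "nvec A = 0"
  by (simp add: vec4_0)

lemma nvec_eq_0_iff: "nvec a = 0 \<longleftrightarrow> a = A"
  using nvec_eq_iff[of a A] by (simp only: nvec_A)

lemma nvec_surj: "\<exists>n. x = nvec n"
proof -
  have "card (range nvec) = CARD(nib)" by (rule card_image) (simp add: inj_def nvec_eq_iff)
  also have "\<dots> = CARD(bit ^ 4)" by (simp add: UNIV_nib nibs_def)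
  finally have "range nvec = UNIV" by (intro card_subset_eq) auto
  then show ?thesis by (metis UNIV_I imageE)
qed

lemma add_eq_A_iff: "add a b = A \<longleftrightarrow> a = b"
proof -
  have "add a b = A \<longleftrightarrow> nvec a - nvec b = 0" by (simp only: nvec_eq_0_iff[symmetric] nvec_add bit_vec_diff)
  then show ?thesis by (simp only: right_minus_eq nvec_eq_iff)
qed

primrec mvec :: "mat \<Rightarrow> bit ^ 4 ^ 3" where
  "mvec (X a b c) = vec3 (nvec a) (nvec b) (nvec c)"

lemma mvec_eq_iff: "mvec m = mvec n \<longleftrightarrow> m = n"
  by (cases m; cases n) (simp add: vec3_eq_iff nvec_eq_iff)

lemma mvec_surj: "\<exists>m. x = mvec m"
proof -
  obtain a b c where x: "x = vec3 a b c" using vec3_exhaust[of x] by blast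
  obtain a' b' c' where "a = nvec a'" "b = nvec b'" "c = nvec c'" using nvec_surj by metis
  then have "x = mvec (X a' b' c')" by (simp add: x)
  then show ?thesis ..
qed

lemma mvec_add: "mvec (X (add a a') (add b b') (add c c')) = mvec (X a b c) + mvec (X a' b' c')"
  by (simp add: vec3_add nvec_add)

lemma vec3_times_vec3: "vec3 u v w v* vec3 a b c = u *s a + v *s b + w *s c" for a :: "bit ^ 'n"
  by (simp add: vector_matrix_mult_rows sum_3 row_def vec3_def)

text \<open>The junk values at \<open>A\<close> and \<open>I\<close> copy those of
  \<open>comb\<close>, so that \<open>nvec_comb\<close> and \<open>cvec_neq_0\<close> hold for every
  letter.\<close>

primrec cvec :: "nib \<Rightarrow> bit ^ 3" where
  "cvec A = vec3 1 0 0" | "cvec B = vec3 1 0 0" | "cvec C = vec3 0 1 0" | "cvec D = vec3 1 1 0"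
| "cvec E = vec3 0 0 1" | "cvec F = vec3 1 0 1" | "cvec G = vec3 0 1 1" | "cvec H = vec3 1 1 1"
| "cvec I = vec3 1 0 0" | "cvec J = vec3 1 0 0" | "cvec K = vec3 0 1 0" | "cvec L = vec3 1 1 0"
| "cvec M = vec3 0 0 1" | "cvec N = vec3 1 0 1" | "cvec Z = vec3 0 1 1" | "cvec P = vec3 1 1 1"

lemma nvec_comb: "nvec (comb u a b c) = cvec u v* mvec (X a b c)"
  by (cases u) (simp_all add: nvec_add vec3_times_vec3)

lemma cvec_neq_0: "cvec u \<noteq> 0"
  by (cases u) (simp_all add: vec3_0[symmetric] vec3_eq_iff)

lemma vec3_neq_0_cases:
  assumes "x \<noteq> (0 :: bit ^ 3)"
  shows "\<exists>u \<in> {B, C, D, E, F, G, H}. x = cvec u"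
proof -
  obtain a b c where x: "x = vec3 a b c" using vec3_exhaust[of x] by blast
  with assms show ?thesis
    by (cases a; cases b; cases c) (simp_all add: vec3_0 vec3_eq_iff)
qed

lemma list_all_nibs: "list_all f nibs \<longleftrightarrow> (\<forall>a. f a)"
  unfolding list_all_iff by (simp only: UNIV_nib[symmetric] ball_UNIV)

section \<open>Correctness of the kernel table\<close>

text \<open>Evaluated for all 4096 triples by rewriting; the tables are thereby proved correct
  rather than assumed to be.\<close>

lemma kr_orthogonal:
  "dot (nvec a) (nvec (kr a b c)) = 0"
  "dot (nvec b) (nvec (kr a b c)) = 0"
  "dot (nvec c) (nvec (kr a b c)) = 0"
proof -
  have "list_all (\<lambda>a. list_all (\<lambda>b. list_all (\<lambda>c. dot (nvec a) (nvec (kr a b c)) = 0 \<and>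
      dot (nvec b) (nvec (kr a b c)) = 0 \<and> dot (nvec c) (nvec (kr a b c)) = 0) nibs) nibs) nibs"
    by (simp only: nibs_def list.pred_inject kr_def planerow.simps kerrow.simps look_T nvec.simps dot_vec4
        bit_add mult_zero_left mult_zero_right mult_1_left simp_thms)
  then show "dot (nvec a) (nvec (kr a b c)) = 0" "dot (nvec b) (nvec (kr a b c)) = 0"
    "dot (nvec c) (nvec (kr a b c)) = 0"
    by (simp_all only: list_all_nibs)
qed

text \<open>Again an evaluation of all triples. The letters \<open>B\<close> to \<open>H\<close>
  name the seven nonzero combinations of three rows.\<close>

lemma kr_eq_A_iff: "kr a b c = A \<longleftrightarrow> (\<exists>u \<in> {B, C, D, E, F, G, H}. comb u a b c = A)"
proof -
  have "list_all (\<lambda>a. list_all (\<lambda>b. list_all (\<lambda>c. look (kr a b c) nonzero \<longleftrightarrow>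
      look a nonzero \<and> look b nonzero \<and> look (add a b) nonzero \<and> look c nonzero \<and>
      look (add a c) nonzero \<and> look (add b c) nonzero \<and> look (add (add a b) c) nonzero)
      nibs) nibs) nibs"
    by (simp only: nibs_def list.pred_inject kr_def add_def addrow.simps planerow.simps kerrow.simps
        look_T nonzero_def simp_thms)
  then have "look (kr a b c) nonzero \<longleftrightarrow>
      look a nonzero \<and> look b nonzero \<and> look (add a b) nonzero \<and> look c nonzero \<and>
      look (add a c) nonzero \<and> look (add b c) nonzero \<and> look (add (add a b) c) nonzero"
    by (simp only: list_all_nibs)
  then show ?thesis by (auto simp: look_nonzero)
qed

lemma full_mvec: "full (mvec (X a b c)) \<longleftrightarrow> kr a b c \<noteq> A"
proof -
  have "full (mvec (X a b c)) \<longleftrightarrow> (\<forall>u \<in> {B, C, D, E, F, G, H}. cvec u v* mvec (X a b c) \<noteq> 0)"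
    unfolding full_def using vec3_neq_0_cases cvec_neq_0 by metis
  also have "\<dots> \<longleftrightarrow> kr a b c \<noteq> A"
    unfolding kr_eq_A_iff nvec_comb[symmetric] nvec_eq_0_iff by blast
  finally show ?thesis .
qed

text \<open>Orthogonality to the rows puts the tabulated vector into the kernel, and a nonzero
  kernel vector of a full matrix is unique. Otherwise both sides take their default value 0.\<close>

lemma kap_mvec: "kap (mvec (X a b c)) = nvec (kr a b c)"
proof (cases "full (mvec (X a b c))")
  case True
  show ?thesis
  proof (rule kap_eqI[OF True])
    show "nvec (kr a b c) \<noteq> 0" using True by (simp only: full_mvec nvec_eq_0_iff not_False_eq_True)
    have "mvec (X a b c) *v v = vec3 (dot (nvec a) v) (dot (nvec b) v) (dot (nvec c) v)" for v
      by (simp only: vec_eq_iff forall_3 matrix_vector_mult_def dot_def mvec.simps) (simp add: vec3_def)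
    then show "mvec (X a b c) *v nvec (kr a b c) = 0" by (simp only: kr_orthogonal vec3_0)
  qed
next
  case False
  then have "kr a b c = A" by (simp only: full_mvec simp_thms)
  with False show ?thesis by (simp only: kap_def if_False nvec_A)
qed

lemma kap_diff: "kap (mvec m - mvec n) = nvec (kd m n)"
  and full_diff: "full (mvec m - mvec n) \<longleftrightarrow> kd m n \<noteq> A"
  by (cases m; cases n; simp only: kd.simps mat.case bit_mat_diff mvec_add[symmetric] kap_mvec full_mvec)+

lemma kd_refl: "kd m m = A"
proof (rule ccontr)
  assume "kd m m \<noteq> A"
  then have "full (mvec m - mvec m)" by (simp only: full_diff not_False_eq_True)
  then have "cvec B = 0" by (simp only: full_def diff_self vector_matrix_mult_0_right simp_thms)
  then show False by (simp only: cvec_neq_0)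
qed

lemma kd_neq_A:
  assumes "MRD_code 3 \<C>" "mvec m \<in> \<C>" "mvec n \<in> \<C>" "m \<noteq> n"
  shows "kd m n \<noteq> A"
  using assms unfolding MRD_code_3_iff full_diff[symmetric] mvec_eq_iff[symmetric] by blast

text \<open>If both kernels were the same vector, then \<open>m\<close>, \<open>n\<close> and
  \<open>x\<close> would be three codewords with the same value at it, whereas
  \<open>card_column_fibre\<close> allows only two.\<close>

lemma kd_inj:
  assumes \<C>: "MRD_code 3 \<C>" "mvec m \<in> \<C>" "mvec n \<in> \<C>" "mvec x \<in> \<C>" and neq: "m \<noteq> n" "m \<noteq> x" "n \<noteq> x"
  shows "kd m n \<noteq> kd m x"
proof
  assume eq: "kd m n = kd m x"
  let ?v = "nvec (kd m n)"
  have "full (mvec m - mvec n)" "full (mvec m - mvec x)"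
    using kd_neq_A[OF \<C>(1)] \<C> neq by (simp_all only: full_diff)
  then have "(mvec m - mvec n) *v ?v = 0" "(mvec m - mvec x) *v ?v = 0"
    using kap_kernel[of "mvec m - mvec n"] kap_kernel[of "mvec m - mvec x"] by (simp_all only: kap_diff eq)
  then have "mvec n *v ?v = mvec m *v ?v" "mvec x *v ?v = mvec m *v ?v"
    by (simp_all only: matrix_vector_mult_diff_rdistrib right_minus_eq)
  then have sub: "{mvec m, mvec n, mvec x} \<subseteq> {\<A> \<in> \<C>. \<A> *v ?v = mvec m *v ?v}"
    using \<C> by blast
  have "?v \<noteq> 0" using kd_neq_A[OF \<C>(1-3) neq(1)] by (simp only: nvec_eq_0_iff not_False_eq_True)
  from card_column_fibre[OF \<C>(1) this] have "card {mvec m, mvec n, mvec x} \<le> 2"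
    using card_mono[OF _ sub] by simp
  with neq show False by (simp add: mvec_eq_iff)
qed

section \<open>Candidate lists and covered configurations\<close>

definition exhausts :: "mat list \<Rightarrow> mat list \<Rightarrow> bool" where
  "exhausts k l \<longleftrightarrow> (\<forall>\<C>. MRD_code 3 \<C> \<longrightarrow> mvec ` set k \<subseteq> \<C> \<longrightarrow> \<C> \<subseteq> mvec ` (set k \<union> set l))"

text \<open>This holds vacuously if no code contains \<open>k\<close>, which is how a branching with
  an empty list of candidates closes a branch.\<close>

definition covered :: "mat list set \<Rightarrow> mat list \<Rightarrow> bool" where
  "covered rs k \<longleftrightarrow> (\<forall>\<C>. MRD_code 3 \<C> \<longrightarrow> mvec ` set k \<subseteq> \<C> \<longrightarrow>
     (\<exists>r\<in>rs. code_isomorphic (mvec ` set r) \<C>))"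

lemma look_fmask: "look j (fmask k m) \<longleftrightarrow> j \<noteq> A \<and> (\<forall>n\<in>set k. j \<noteq> kd m n)"
  by (induction k) (auto simp: look_nonzero look_upd)

lemma set_prune: "set (prune m k l) = {n \<in> set l. kd m n \<noteq> A \<and> (\<forall>x\<in>set k. kd m n \<noteq> kd m x)}"
proof (cases m)
  case (X a b c)
  have "set (flt (addrow a) (addrow b) (addrow c) t l) = {n \<in> set l. look (kd m n) t}" for t
    by (induction l) (auto simp: keep_def X add_def split: mat.splits)
  then show ?thesis by (simp add: X look_fmask)
qed

text \<open>A further codeword differs from \<open>m\<close> by a full matrix, and by
  \<open>kd_inj\<close> the kernel of this difference cannot repeat one between \<open>m\<close> and
  an element of \<open>k\<close>.\<close>

lemma exhausts_prune:
  assumes "exhausts k l"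
  shows "exhausts (m # k) (prune m k l)"
  unfolding exhausts_def
proof (intro allI impI subsetI)
  fix \<C> \<D> assume \<C>: "MRD_code 3 \<C>" "mvec ` set (m # k) \<subseteq> \<C>" and \<D>: "\<D> \<in> \<C>"
  then have "\<D> \<in> mvec ` (set k \<union> set l)"
    using assms unfolding exhausts_def by auto
  then obtain n where n: "\<D> = mvec n" "n \<in> set k \<union> set l" by blast
  have "n \<in> set (m # k) \<union> set (prune m k l)"
  proof (rule ccontr)
    assume "n \<notin> set (m # k) \<union> set (prune m k l)"
    then have nn: "n \<noteq> m" "n \<notin> set k" "n \<notin> set (prune m k l)" by auto
    have mem: "mvec m \<in> \<C>" "mvec n \<in> \<C>" using \<C>(2) \<D> n by auto
    have "kd m n \<noteq> A" using kd_neq_A[OF \<C>(1) mem] nn(1) by blast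
    moreover have "kd m n \<noteq> kd m x" if "x \<in> set k" for x
    \<comment> \<open>\<open>m\<close> may occur in \<open>k\<close> already; then
      \<open>kd m x\<close> is \<open>A\<close>, which the nonzero kernel cannot equal.\<close>
    proof (cases "x = m")
      case True
      with \<open>kd m n \<noteq> A\<close> show ?thesis by (simp add: kd_refl)
    next
      case False
      have "mvec x \<in> \<C>" using \<C>(2) that by auto
      then show ?thesis using kd_inj[OF \<C>(1) mem(1,2)] nn that False by metis
    qed
    ultimately show False using nn n(2) unfolding set_prune by blast
  qed
  with n(1) show "\<D> \<in> mvec ` (set (m # k) \<union> set (prune m k l))" by blast
qed

lemma exhausts_mats: "exhausts [] mats"
  unfolding exhausts_def set_mats using mvec_surj by (metis UNIV_I UnI2 image_iff subsetI)

lemma set_sel: "set (sel u (only v) l) = {m \<in> set l. cvec u v* mvec m = nvec v}"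
proof -
  define g where "g m \<longleftrightarrow> cvec u v* mvec m = nvec v" for m
  have sel: "sel u (only v) (m # l) = keep (g m) m (sel u (only v) l)" for m l
  proof (cases m)
    case (X a b c)
    have "g m \<longleftrightarrow> look (comb u a b c) (only v)"
      by (simp only: g_def X look_only nvec_comb[symmetric] nvec_eq_iff)
    then show ?thesis by (simp only: sel.simps X mat.case)
  qed
  have "set (sel u (only v) l) = {m \<in> set l. g m}"
    by (induction l) (auto simp: keep_def sel simp del: sel.simps(2))
  then show ?thesis by (simp only: g_def)
qed

text \<open>On a code each nonzero row combination takes every value, so any code containing
  \<open>k\<close> contains one of the selected matrices.\<close>

lemma covered_branch:
  assumes k: "exhausts k l" and br: "\<And>m. m \<in> set (sel u (only v) (k @ l)) \<Longrightarrow> covered rs (m # k)"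
  shows "covered rs k"
  unfolding covered_def
proof (intro allI impI)
  fix \<C> assume \<C>: "MRD_code 3 \<C>" "mvec ` set k \<subseteq> \<C>"
  obtain \<A> where \<A>: "\<A> \<in> \<C>" "cvec u v* \<A> = nvec v"
    by (rule row_combination_surj[OF \<C>(1) cvec_neq_0])
  then obtain m where m: "m \<in> set (k @ l)" "\<A> = mvec m"
    using k \<C> unfolding exhausts_def set_append by blast
  then have "m \<in> set (sel u (only v) (k @ l))" using \<A>(2) by (simp add: set_sel)
  then have "covered rs (m # k)" by (rule br)
  moreover have "mvec ` set (m # k) \<subseteq> \<C>" using \<C>(2) \<A>(1) m(2) by auto
  ultimately show "\<exists>r\<in>rs. code_isomorphic (mvec ` set r) \<C>"
    using \<C>(1) unfolding covered_def by blast
qed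

lemma code_isomorphic_trans: "code_isomorphic \<A> \<C> \<Longrightarrow> code_isomorphic \<C> \<D> \<Longrightarrow> code_isomorphic \<A> \<D>"
  by (rule equivp_transp[OF equivp_code_isomorphic])

lemma code_isomorphic_sym: "code_isomorphic \<A> \<C> \<Longrightarrow> code_isomorphic \<C> \<A>"
  by (rule equivp_symp[OF equivp_code_isomorphic])

text \<open>Pull the code back: the preimage of a code containing \<open>k\<close> is an isomorphic
  code, and it contains \<open>e\<close>.\<close>

lemma covered_transform:
  assumes inv: "invertible \<P>" "invertible \<Q>" and e: "covered rs e"
    and img: "\<And>m. m \<in> set e \<Longrightarrow> \<P> ** mvec m ** \<Q> + \<R> \<in> mvec ` set k"
  shows "covered rs k"
  unfolding covered_def
proof (intro allI impI)
  fix \<C> assume \<C>: "MRD_code 3 \<C>" "mvec ` set k \<subseteq> \<C>"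
  let ?f = "\<lambda>\<A>. \<P> ** \<A> ** \<Q> + \<R>"
  let ?D = "?f -` \<C>"
  have "surj ?f" using inj_affine[OF inv] by (simp add: finite_UNIV_inj_surj)
  then have "?f ` ?D = \<C>" by (rule surj_image_vimage_eq)
  then have D: "code_isomorphic ?D \<C>" unfolding code_isomorphic_def using inv by metis
  then have "MRD_code 3 ?D" using MRD_code_isomorphic[OF \<C>(1)] code_isomorphic_sym by blast
  moreover have "mvec ` set e \<subseteq> ?D" using img \<C>(2) by blast
  ultimately obtain r where "r \<in> rs" "code_isomorphic (mvec ` set r) ?D"
    using e unfolding covered_def by blast
  with D show "\<exists>r\<in>rs. code_isomorphic (mvec ` set r) \<C>" using code_isomorphic_trans by blast
qed

section \<open>Affine maps described by letters\<close>

definition qmat :: "nib \<Rightarrow> nib \<Rightarrow> nib \<Rightarrow> nib \<Rightarrow> bit ^ 4 ^ 4" where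
  "qmat a b c d = (\<chi> i. if i = 1 then nvec a else if i = 2 then nvec b else if i = 3 then nvec c else nvec d)"

lemma vec4_times_qmat: "vec4 u v w x v* qmat a b c d = u *s nvec a + v *s nvec b + w *s nvec c + x *s nvec d"
  by (simp add: vector_matrix_mult_rows sum_4 row_def qmat_def vec4_def)

lemma nvec_lintab: "nvec (look n (lintab a b c d)) = nvec n v* qmat a b c d"
  by (cases n) (simp_all add: lintab_def nvec_add vec4_times_qmat vec4_0)

lemma invertible_qmat:
  assumes "all_nonzero (lintab a b c d)"
  shows "invertible (qmat a b c d)"
proof (rule invertible_row_kernel)
  fix x assume x: "x v* qmat a b c d = 0"
  obtain n where n: "x = nvec n" using nvec_surj by blast
  with x have "look n (lintab a b c d) = A" by (simp only: nvec_lintab[symmetric] nvec_eq_0_iff)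
  then have "n = A" using assms unfolding all_nonzero_def by blast
  then show "x = 0" by (simp only: n nvec_A)
qed

lemma cvec_nvec: "p \<noteq> A \<Longrightarrow> p \<noteq> I \<Longrightarrow> nvec p = vec4 a b c d \<Longrightarrow> cvec p = vec3 a b c"
  by (cases p) (simp_all add: vec4_eq_iff)

text \<open>A linear relation among the first three digits of \<open>p\<close>, \<open>q\<close>,
  \<open>r\<close> extends to one among \<open>p\<close>, \<open>q\<close>, \<open>r\<close>,
  \<open>I\<close>, since the last unit vector absorbs whatever remains in the fourth digit. Such a
  relation would show up as an entry \<open>A\<close> in the table.\<close>

lemma invertible_pmat:
  assumes nz: "all_nonzero (lintab p q r I)"
  shows "invertible (vec3 (cvec p) (cvec q) (cvec r))"
proof (rule invertible_row_kernel, rule ccontr)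
  fix w assume w: "w v* vec3 (cvec p) (cvec q) (cvec r) = 0" "w \<noteq> 0"
  let ?t = "lintab p q r I"
  have nz': "look n ?t \<noteq> A" if "n \<noteq> A" for n using nz that unfolding all_nonzero_def by blast
  have I: "x \<noteq> A \<and> x \<noteq> I" if "x \<noteq> A" "add x I \<noteq> A" for x using that by (auto simp: add_eq_A_iff)
  \<comment> \<open>The entries at \<open>B\<close> and \<open>J\<close> are \<open>p\<close> and
    \<open>add p I\<close>. That neither is \<open>A\<close> excludes for \<open>p\<close> the
    letters \<open>A\<close> and \<open>I\<close>, where \<open>cvec\<close> has junk values;
    likewise for \<open>q\<close> and \<open>r\<close>.\<close>
  have pqr: "p \<noteq> A \<and> p \<noteq> I" "q \<noteq> A \<and> q \<noteq> I" "r \<noteq> A \<and> r \<noteq> I"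
    using nz'[of B] nz'[of J] nz'[of C] nz'[of K] nz'[of E] nz'[of M]
    by (simp_all only: lintab_def look_T nib.distinct not_False_eq_True simp_thms I)
  obtain p1 p2 p3 p4 where p: "nvec p = vec4 p1 p2 p3 p4" using vec4_exhaust by blast
  obtain q1 q2 q3 q4 where q: "nvec q = vec4 q1 q2 q3 q4" using vec4_exhaust by blast
  obtain r1 r2 r3 r4 where r: "nvec r = vec4 r1 r2 r3 r4" using vec4_exhaust by blast
  obtain w1 w2 w3 where w': "w = vec3 w1 w2 w3" using vec3_exhaust[of w] by blast
  have smult: "x *s vec4 a b c d = vec4 (x * a) (x * b) (x * c) (x * d)" for x a b c d
    by (simp only: vec_eq_iff forall_4 vec4_def vector_smult_component vec_lambda_beta) simp
  have smult3: "x *s vec3 a b c = vec3 (x * a) (x * b) (x * c)" for x a b c :: bit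
    by (simp only: vec_eq_iff forall_3 vec3_def vector_smult_component vec_lambda_beta) simp
  from w(1) have eqs: "w1 * p1 + w2 * q1 + w3 * r1 = 0" "w1 * p2 + w2 * q2 + w3 * r2 = 0"
    "w1 * p3 + w2 * q3 + w3 * r3 = 0"
    unfolding w' vec3_times_vec3 cvec_nvec[OF conjunct1[OF pqr(1)] conjunct2[OF pqr(1)] p]
      cvec_nvec[OF conjunct1[OF pqr(2)] conjunct2[OF pqr(2)] q]
      cvec_nvec[OF conjunct1[OF pqr(3)] conjunct2[OF pqr(3)] r] smult3 vec3_add vec3_0[symmetric] vec3_eq_iff
    by blast+
  \<comment> \<open>The coefficient of \<open>I\<close> that cancels the fourth digits.\<close>
  define e where "e = w1 * p4 + w2 * q4 + w3 * r4"
  obtain n where n: "vec4 w1 w2 w3 e = nvec n" using nvec_surj by blast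
  have "nvec (look n ?t) = vec4 0 0 0 (e + e)"
    unfolding nvec_lintab n[symmetric] vec4_times_qmat p q r nvec.simps smult vec4_add
    by (simp only: eqs e_def mult_zero_right mult_1_right add_0_right)
  also have "e + e = 0" by (cases e) simp_all
  finally have "look n ?t = A" by (simp only: vec4_0 nvec_eq_0_iff)
  with nz' have "n = A" by blast
  then have "vec4 w1 w2 w3 e = vec4 0 0 0 0" by (simp only: n nvec.simps)
  with w(2) show False by (simp add: w' vec4_eq_iff vec3_0)
qed

lemma vec3_matrix_mult: "vec3 a b c ** y = vec3 (a v* y) (b v* y) (c v* y)" for a :: "bit ^ 'n"
  by (simp only: vec_eq_iff forall_3 matrix_matrix_mult_def vector_matrix_mult_def vec_lambda_beta)
    (simp add: vec3_def mult.commute)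

lemma mvec_affine_image:
  "mvec (affine_image p q r x y z (look a (lintab a1 b1 c1 d1)) (look b (lintab a1 b1 c1 d1)) (look c (lintab a1 b1 c1 d1))) =
   vec3 (cvec p) (cvec q) (cvec r) ** mvec (X a b c) ** qmat a1 b1 c1 d1 + mvec (X x y z)"
proof -
  have "mvec (X (look a (lintab a1 b1 c1 d1)) (look b (lintab a1 b1 c1 d1)) (look c (lintab a1 b1 c1 d1)))
      = mvec (X a b c) ** qmat a1 b1 c1 d1"
    by (simp only: mvec.simps nvec_lintab vec3_matrix_mult)
  then have comb: "nvec (comb u (look a (lintab a1 b1 c1 d1)) (look b (lintab a1 b1 c1 d1)) (look c (lintab a1 b1 c1 d1)))
      = (cvec u v* mvec (X a b c)) v* qmat a1 b1 c1 d1" for u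
    by (simp only: nvec_comb vector_matrix_mul_assoc)
  show ?thesis
    unfolding affine_image_def mvec_add add.commute[of "mvec (X x y z)"] add_right_cancel
    by (simp only: mvec.simps comb vec3_matrix_mult)
qed

lemma has_iff: "has l m \<longleftrightarrow> m \<in> set l"
proof (cases m)
  case (X a b c)
  have "memb (only a) (only b) (only c) l \<longleftrightarrow> X a b c \<in> set l"
    by (induction l) (auto simp: look_only split: mat.splits)
  then show ?thesis by (simp add: X)
qed

lemma set_drops:
  assumes "\<And>l. set (f l) \<subseteq> set l"
  shows "set (drops j f l) \<subseteq> set l"
proof -
  have "x \<in> set l" if "x \<in> set (f l)" for x l using assms that by blast
  then show ?thesis by (cases j) auto
qed

text \<open>Whatever position is read, the configuration found there belongs to \<open>env\<close>
  and so is covered; the affine map then carries this over to \<open>k\<close>.\<close>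

lemma embedding_sound:
  assumes "embedding i j a b c d p q r x y z k env" and env: "\<And>e. e \<in> set env \<Longrightarrow> covered rs e"
  shows "covered rs k"
proof -
  let ?env = "drops j tl (drops i drop16 env)"
  have nz: "all_nonzero (lintab a b c d)" "all_nonzero (lintab p q r I)"
    and hd: "embeds_hd (lintab a b c d) p q r x y z k ?env"
    using assms(1) unfolding embedding_def by blast+
  from hd obtain e es where e: "?env = e # es" "embeds (lintab a b c d) p q r x y z k e"
    by (cases ?env) simp_all
  have "set ?env \<subseteq> set (drops i drop16 env)"
    by (rule set_drops) (metis list.set_sel(2) subsetI tl_Nil)
  also have "\<dots> \<subseteq> set env"
    by (rule set_drops) (simp add: drop16_def set_drop_subset)
  finally have "covered rs e" using env e(1) by auto
  moreover have "vec3 (cvec p) (cvec q) (cvec r) ** mvec m ** qmat a b c d + mvec (X x y z) \<in> mvec ` set k"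
    if "m \<in> set e" for m
  proof -
    obtain a' b' c' where m: "m = X a' b' c'" by (cases m)
    from e(2) that have "has k (affine_image p q r x y z (look a' (lintab a b c d)) (look b' (lintab a b c d))
        (look c' (lintab a b c d)))"
      unfolding m by (induction e) auto
    then show ?thesis unfolding m mvec_affine_image[symmetric] has_iff by (rule imageI)
  qed
  ultimately show ?thesis
    using covered_transform[OF invertible_pmat[OF nz(2)] invertible_qmat[OF nz(1)]] by blast
qed

section \<open>Soundness of certificates\<close>

text \<open>A code inside \<open>l @ k\<close> has 16 elements and hence is all of it. So
  \<open>l @ k\<close> itself, and not just \<open>k\<close>, may be compared with earlier
  configurations.\<close>

lemma covered_leaf:
  assumes k: "exhausts k l" and len: "length16 (l @ k)" and cov: "covered rs (l @ k)"
  shows "covered rs k"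
  unfolding covered_def
proof (intro allI impI)
  fix \<C> assume \<C>: "MRD_code 3 \<C>" "mvec ` set k \<subseteq> \<C>"
  have sub: "\<C> \<subseteq> mvec ` set (l @ k)"
    using k \<C> unfolding exhausts_def by (metis set_append sup_commute)
  have "card (mvec ` set (l @ k)) \<le> card (set (l @ k))" by (rule card_image_le) (rule finite_set)
  also have "\<dots> \<le> 16" using card_length[of "l @ k"] len by (simp only: length16_def)
  also have "16 = card \<C>" using \<C>(1) by (simp only: MRD_code_3_iff)
  finally have "\<C> = mvec ` set (l @ k)" using sub by (intro card_seteq) auto
  then show "\<exists>r\<in>rs. code_isomorphic (mvec ` set r) \<C>"
    using cov \<C>(1) unfolding covered_def by blast
qed

lemma narrow_exhausts: "exhausts k l \<Longrightarrow> (\<exists>i j a b c d p q r x y z. t = Q i j a b c d p q r x y z) \<or>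
  exhausts (m # k) (narrow t m k l)"
  by (cases t) (simp_all add: exhausts_prune)

text \<open>The disjunction in the first hypothesis accommodates \<open>Q\<close> leaves, to which
  \<open>narrow\<close> passes an empty candidate list whatever codes contain \<open>k\<close>; for
  them the embedding is the whole argument.\<close>

lemma check_sound:
  "check t k l env = Some env' \<Longrightarrow>
     (\<exists>i j a b c d p q r x y z. t = Q i j a b c d p q r x y z) \<or> exhausts k l \<Longrightarrow>
     \<forall>e\<in>set env. covered rs e \<Longrightarrow> covered rs k \<and> (\<forall>e\<in>set env'. covered rs e)"
  "checks ms ts k l env = Some env' \<Longrightarrow> exhausts k l \<Longrightarrow> \<forall>e\<in>set env. covered rs e \<Longrightarrow>
     (\<forall>m\<in>set ms. covered rs (m # k)) \<and> (\<forall>e\<in>set env'. covered rs e)"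
proof (induction t k l env and ms ts k l env arbitrary: env' and env' rule: check_checks.induct)
  case (1 i j a b c d p q r x y z k l env)
  then have "embedding i j a b c d p q r x y z k env" "env' = env" by (auto simp: guard_def split: if_splits)
  with 1 show ?case using embedding_sound by blast
next
  case (2 i j a b c d p q r x y z k l env)
  then have "length16 (l @ k)" "embedding i j a b c d p q r x y z (l @ k) env" "env' = env"
    by (auto simp: guard_def split: if_splits)
  moreover have "exhausts k l" using 2 by blast
  ultimately show ?case using 2(3) embedding_sound covered_leaf by blast
next
  case (3 u v ts k l env)
  then have k: "exhausts k l" by blast
  with 3 have "(\<forall>m\<in>set (sel u (only v) (k @ l)). covered rs (m # k)) \<and> (\<forall>e\<in>set env'. covered rs e)"
    by simp
  with covered_branch[OF k] show ?case by blast
next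
  case (4 t k l env)
  from 4(2) obtain env1 where env1: "check t k l env = Some env1" "env' = k # env1"
    by (auto simp: save_def bind_eq_Some_conv)
  have "exhausts k l" using 4(3) by blast
  with 4(1)[OF env1(1)] 4(4) have "covered rs k \<and> (\<forall>e\<in>set env1. covered rs e)" by blast
  with env1(2) show ?case by simp
next
  case (6 m ms t ts k l env)
  from 6(3) obtain env1 where env1: "check t (m # k) (narrow t m k l) env = Some env1"
    "checks ms ts k l env1 = Some env'"
    by (auto simp: bind_eq_Some_conv)
  have "covered rs (m # k) \<and> (\<forall>e\<in>set env1. covered rs e)"
    by (rule 6(1)[OF env1(1) narrow_exhausts[OF 6(4)] 6(5)])
  moreover have "(\<forall>m\<in>set ms. covered rs (m # k)) \<and> (\<forall>e\<in>set env'. covered rs e)"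
    by (rule 6(2)[OF env1 6(4)]) (use calculation in blast)
  ultimately show ?case by simp
qed simp_all

section \<open>Verification of the representatives and the start of the search\<close>

primrec apart :: "mat \<Rightarrow> mat list \<Rightarrow> bool" where
  "apart m [] = True"
| "apart m (n # l) \<longleftrightarrow> look (kd m n) nonzero \<and> apart m l"

primrec good :: "mat list \<Rightarrow> bool" where
  "good [] = True"
| "good (m # l) \<longleftrightarrow> apart m l \<and> good l"

lemma apart_iff: "apart m l \<longleftrightarrow> (\<forall>n\<in>set l. kd m n \<noteq> A)"
  by (induction l) (simp_all add: look_nonzero)

lemma kd_commute: "kd m n = kd n m"
proof -
  have "mvec m - mvec n = mvec n - mvec m" by (simp only: bit_mat_diff add.commute)
  then have "nvec (kd m n) = nvec (kd n m)" by (simp only: kap_diff[symmetric])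
  then show ?thesis by (simp only: nvec_eq_iff)
qed

text \<open>A repeated entry would have difference zero and therefore kernel letter
  \<open>A\<close>.\<close>

lemma good_distinct: "good l \<Longrightarrow> distinct l"
  by (induction l) (auto simp: apart_iff kd_refl)

lemma good_MRD_code:
  assumes "good l" "length16 l"
  shows "MRD_code 3 (mvec ` set l)"
proof -
  have "inj_on mvec (set l)" by (rule inj_onI) (simp only: mvec_eq_iff)
  then have "card (mvec ` set l) = 16"
    using assms good_distinct[of l] by (simp only: card_image distinct_card length16_def)
  moreover have "kd m n \<noteq> A" if "m \<in> set l" "n \<in> set l" "m \<noteq> n" for m n
    using assms(1) that by (induction l) (auto simp: apart_iff kd_commute)
  then have "full (mvec m - mvec n)" if "m \<in> set l" "n \<in> set l" "m \<noteq> n" for m n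
    unfolding full_diff using that by blast
  ultimately show ?thesis unfolding MRD_code_3_iff by blast
qed

text \<open>A code that contains a code of the same size equals it. This entitles the
  representatives to be the initial \<open>env\<close>.\<close>

lemma covered_self:
  assumes "MRD_code 3 (mvec ` set r)" "r \<in> rs"
  shows "covered rs r"
  unfolding covered_def
proof (intro allI impI)
  fix \<C> assume "MRD_code 3 \<C>" "mvec ` set r \<subseteq> \<C>"
  then have "mvec ` set r = \<C>"
    using assms(1) unfolding MRD_code_3_iff by (intro card_subset_eq) auto
  then show "\<exists>r\<in>rs. code_isomorphic (mvec ` set r) \<C>"
    using assms(2) equivp_reflp[OF equivp_code_isomorphic] by blast
qed

text \<open>In characteristic two, adding one codeword to all of them moves that codeword to zero,
  so the search may start from codes containing zero.\<close>

lemma covered_zero_all: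
  assumes "covered rs [X A A A]" "MRD_code 3 \<C>"
  shows "\<exists>r\<in>rs. code_isomorphic (mvec ` set r) \<C>"
proof -
  have "card \<C> \<noteq> 0" using assms(2) unfolding MRD_code_3_iff by simp
  then obtain \<A> where \<A>: "\<A> \<in> \<C>" by (metis card.empty ex_in_conv)
  let ?D = "(\<lambda>\<B>. mat 1 ** \<B> ** mat 1 + \<A>) ` \<C>"
  have iso: "code_isomorphic \<C> ?D" unfolding code_isomorphic_def
    by (intro exI[of _ "mat 1"] exI[of _ \<A>] conjI invertible_mat_1 refl)
  have "mvec (X A A A) = 0" by (simp add: vec4_0 vec3_0)
  also have "0 = mat 1 ** \<A> ** mat 1 + \<A>" by simp
  finally have zero: "mvec (X A A A) = mat 1 ** \<A> ** mat 1 + \<A>" .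
  have "mvec (X A A A) \<in> ?D" unfolding zero using \<A> by (rule imageI)
  then have "mvec ` set [X A A A] \<subseteq> ?D"
    by (simp only: list.set image_insert image_empty insert_subset empty_subsetI simp_thms)
  then obtain r where "r \<in> rs" "code_isomorphic (mvec ` set r) ?D"
    using assms(1) MRD_code_isomorphic[OF assms(2) iso] unfolding covered_def by blast
  with iso show ?thesis using code_isomorphic_trans code_isomorphic_sym by blast
qed

lemma check_classifies:
  assumes "check t [X A A A] (prune (X A A A) [] mats) rs \<noteq> None"
    and "\<And>r. r \<in> set rs \<Longrightarrow> MRD_code 3 (mvec ` set r)" and "MRD_code 3 \<C>"
  shows "\<exists>r\<in>set rs. code_isomorphic (mvec ` set r) \<C>"
proof -
  obtain env' where "check t [X A A A] (prune (X A A A) [] mats) rs = Some env'"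
    using assms(1) by blast
  moreover have "exhausts [X A A A] (prune (X A A A) [] mats)"
    by (rule exhausts_prune[OF exhausts_mats])
  moreover have "\<forall>r\<in>set rs. covered (set rs) r" using assms(2) covered_self by blast
  ultimately have "covered (set rs) [X A A A]" using check_sound(1) by blast
  then show ?thesis using assms(3) by (rule covered_zero_all)
qed

section \<open>Evaluation by rewriting\<close>

text \<open>The rewrite rules below contain no conditionals and no case distinctions, since congruence
  rules for these would make the simplifier traverse normalised subterms again and again.\<close>

definition switch :: "bool \<Rightarrow> ('b \<Rightarrow> 'a) \<Rightarrow> ('b \<Rightarrow> 'a) \<Rightarrow> 'b \<Rightarrow> 'a" where
  "switch t f g x = (if t then f x else g x)"

definition rest_matches :: "nib \<Rightarrow> bool tab \<Rightarrow> nib \<Rightarrow> bool tab \<Rightarrow> bool tab \<Rightarrow> mat list \<Rightarrow> bool" where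
  "rest_matches b rb c rc ra l \<longleftrightarrow> look b rb \<and> look c rc \<or> memb ra rb rc l"

lemma memb_Cons:
  "memb ra rb rc (X a b c # l) = switch (look a ra) (rest_matches b rb c rc ra) (memb ra rb rc) l"
  by (simp add: rest_matches_def switch_def)

lemma switch_simps: "switch True f g x = f x" "switch False f g x = g x"
  by (simp_all add: switch_def)

lemma keep_simps: "keep True x l = x # l" "keep False x l = l"
  by (simp_all add: keep_def)

lemma guard_simps: "guard True e = Some e" "guard False e = None"
  by (simp_all add: guard_def)

lemma all_nonzero_T:
  "all_nonzero (T aA aB aC aD aE aF aG aH aI aJ aK aL aM aN aZ aP) =
   (look aB nonzero \<and> look aC nonzero \<and> look aD nonzero \<and> look aE nonzero \<and> look aF nonzero \<and>
    look aG nonzero \<and> look aH nonzero \<and> look aI nonzero \<and> look aJ nonzero \<and> look aK nonzero \<and>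
    look aL nonzero \<and> look aM nonzero \<and> look aN nonzero \<and> look aZ nonzero \<and> look aP nonzero)"
proof -
  have "(\<forall>x. f x) \<longleftrightarrow> list_all f nibs" for f by (simp only: list_all_nibs)
  then show ?thesis
    by (simp add: all_nonzero_def nibs_def look_nonzero)
qed

lemma kd_X: "kd (X a b c) (X a' b' c') = kr (add a a') (add b b') (add c c')"
  by simp

lemma flt_Cons: "flt ra rb rc t (X a b c # l) =
    keep (look (kr (look a ra) (look b rb) (look c rc)) t) (X a b c) (flt ra rb rc t l)"
  by simp

lemma sel_Cons: "sel u t (X a b c # l) = keep (look (comb u a b c) t) (X a b c) (sel u t l)"
  by simp

lemma embeds_Cons: "embeds t p q r x y z l (X a b c # e) \<longleftrightarrow>
    has l (affine_image p q r x y z (look a t) (look b t) (look c t)) \<and> embeds t p q r x y z l e"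
  by simp

lemma drop16_Cons:
  "drop16 (aA # aB # aC # aD # aE # aF # aG # aH # aI # aJ # aK # aL # aM # aN # aZ # aP # l) = l"
  by (simp add: drop16_def)

lemma length16_16:
  "length16 [aA, aB, aC, aD, aE, aF, aG, aH, aI, aJ, aK, aL, aM, aN, aZ, aP] = True"
  by (simp add: length16_def)

text \<open>The continuation \<open>checks ms ts k l\<close> is left unapplied, so the remaining
  siblings are evaluated only once the first one has delivered its environment.\<close>

lemma checks_Cons: "checks (m # ms) (t # ts) k l env =
    Option.bind (check t (m # k) (narrow t m k l) env) (checks ms ts k l)"
  by simp

lemma bool_simps:
  "(True \<and> b) = b" "(False \<and> b) = False" "(True \<or> b) = True" "(False \<or> b) = b" for b
  by simp_all

lemmas eval_simps = look_T upd_T addrow.simps planerow.simps kerrow.simps add_def kr_def comb.simps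
  lintab_def falses_def nonzero_def only_def all_nonzero_T keep_simps kd_X fmask.simps flt.simps(1) flt_Cons
  prune.simps sel.simps(1) sel_Cons switch_simps rest_matches_def memb.simps(1) memb_Cons affine_image_def
  has.simps embeds.simps(1) embeds_Cons embeds_hd.simps drop16_Cons drops.simps embedding_def guard_simps
  save_def length16_16 narrow.simps check.simps checks.simps(1) checks_Cons bind.bind_lunit
  append.simps list.sel(3) bool_simps

section \<open>Evaluation of the invariant\<close>

fun count :: "bool tab \<Rightarrow> nib list \<Rightarrow> nib list \<Rightarrow> nat" where
  "count t (a # as) (b # bs) = (if look (add a b) t then Suc (count t as bs) else count t as bs)"
| "count t _ _ = 0"

definition tick :: "bool \<Rightarrow> nat \<Rightarrow> nat" where
  "tick t n = (if t then Suc n else n)"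

lemma tick_simps: "tick True n = Suc n" "tick False n = n"
  by (simp_all add: tick_def)

lemma count_Cons: "count t (a # as) (b # bs) = tick (look (add a b) t) (count t as bs)"
  by (simp add: tick_def)

text \<open>\<open>as\<close> lists the kernels seen from one codeword and the rows
  \<open>bs\<close> those seen from the others; \<open>a\<close> is the kernel joining the two
  codewords whose rows are compared.\<close>

fun squares :: "nib list \<Rightarrow> nib list \<Rightarrow> nib list list \<Rightarrow> nat" where
  "squares as (a # as') (bs # bss) = (count (only a) as bs)\<^sup>2 + squares as as' bss"
| "squares as _ _ = 0"

primrec total :: "nib list list \<Rightarrow> nib list list \<Rightarrow> nat" where
  "total [] bss = 0"
| "total (as # ass) bss = (squares as as bss)\<^sup>2 + total ass bss"

primrec kds :: "mat \<Rightarrow> mat list \<Rightarrow> nib list" where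
  "kds m [] = []"
| "kds m (n # l) = kd m n # kds m l"

primrec kdss :: "mat list \<Rightarrow> mat list \<Rightarrow> nib list list" where
  "kdss [] l = []"
| "kdss (m # ms) l = kds m l # kdss ms l"

text \<open>Introduced so that the matrix of kernels is normalised once, although it enters
  \<open>total\<close> twice.\<close>

definition diagonal :: "nib list list \<Rightarrow> nat" where
  "diagonal ass = total ass ass"

definition list_invariant :: "mat list \<Rightarrow> nat" where
  "list_invariant l = diagonal (kdss l l)"

text \<open>In characteristic two the sum of three kernels vanishes exactly when two of them add up
  to the third, which turns the condition into a lookup.\<close>

lemma triangles_list:
  assumes "distinct l"
  shows "triangles (mvec ` set l) (mvec m) (mvec n) = count (only (kd m n)) (kds m l) (kds n l)"
proof -
  have "kap (mvec m - mvec n) + kap (mvec m - mvec x) + kap (mvec n - mvec x) = 0 \<longleftrightarrow>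
      look (add (kd m x) (kd n x)) (only (kd m n))" for x
  proof -
    have eq: "kap (mvec m - mvec n) + kap (mvec m - mvec x) + kap (mvec n - mvec x) =
        nvec (add (kd m n) (add (kd m x) (kd n x)))"
      by (simp only: kap_diff nvec_add add.assoc)
    show ?thesis unfolding eq nvec_eq_0_iff add_eq_A_iff look_only by (rule eq_commute)
  qed
  then have "{\<D> \<in> mvec ` set l. kap (mvec m - mvec n) + kap (mvec m - \<D>) + kap (mvec n - \<D>) = 0} =
      mvec ` {x \<in> set l. look (add (kd m x) (kd n x)) (only (kd m n))}"
    by blast
  then have "triangles (mvec ` set l) (mvec m) (mvec n) =
      card (mvec ` {x \<in> set l. look (add (kd m x) (kd n x)) (only (kd m n))})"
    by (simp only: triangles_def)
  also have "\<dots> = card {x \<in> set l. look (add (kd m x) (kd n x)) (only (kd m n))}"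
    by (rule card_image) (rule inj_onI, simp only: mvec_eq_iff)
  also have "\<dots> = length (filter (\<lambda>x. look (add (kd m x) (kd n x)) (only (kd m n))) l)"
    using assms by (simp only: set_filter[symmetric] distinct_card distinct_filter)
  also have "\<dots> = count (only (kd m n)) (kds m l) (kds n l)"
  proof -
    have "length (filter (\<lambda>x. look (add (kd m x) (kd n x)) t) l) = count t (kds m l) (kds n l)" for t
      by (induction l) simp_all
    then show ?thesis .
  qed
  finally show ?thesis .
qed

lemma code_invariant_list:
  assumes "distinct l"
  shows "code_invariant (mvec ` set l) = list_invariant l"
proof -
  have inj: "inj_on mvec (set l)" by (rule inj_onI) (simp only: mvec_eq_iff)
  have sum: "(\<Sum>\<A>\<in>mvec ` set l. f \<A>) = sum_list (map (\<lambda>m. f (mvec m)) l)" for f :: "_ \<Rightarrow> nat"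
    using assms by (simp add: sum.reindex[OF inj] sum_list_distinct_conv_sum_set)
  have squares: "sum_list (map (\<lambda>n. (count (only (kd m n)) (kds m l) (kds n l))\<^sup>2) l') =
      squares (kds m l) (kds m l') (kdss l' l)" for m l'
    by (induction l') simp_all
  have total: "sum_list (map (\<lambda>m. (squares (kds m l) (kds m l) (kdss l l))\<^sup>2) l') = total (kdss l' l) (kdss l l)"
    for l'
    by (induction l') simp_all
  show ?thesis
    unfolding code_invariant_def sum triangles_list[OF assms] squares total list_invariant_def diagonal_def ..
qed

lemmas nat_simps = power2_eq_square Suc_numeral Suc_1 One_nat_def[symmetric] mult_zero_left mult_1_left
  mult_1_right numeral_times_numeral mult_num_simps numeral_plus_numeral one_plus_numeral numeral_plus_one
  one_add_one add_0_left add_0_right add_num_simps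

lemmas invariant_simps = list_invariant_def diagonal_def kds.simps kdss.simps total.simps squares.simps(1)
  squares.simps(2) count.simps(2) tick_simps count_Cons nat_simps

section \<open>The classification\<close>

text \<open>Each code is listed by third rows, which run through all sixteen letters. Every code
  contains zero and \<open>X B C E\<close>, whose rows are the first three unit vectors.\<close>

definition reps :: "mat list list" where
  "reps = [[X A A A,X P F B,X F K C,X K P D,X B C E,X Z H F,X E I G,X L N H,X C D I,X N G J,X H J K,X I M L,X D B M,X M E N,X G L Z,X J Z P],
    [X A A A,X K Z B,X F K C,X P E D,X B C E,X L M F,X E I G,X Z G H,X C D I,X I N J,X H J K,X N H L,X D B M,X J P N,X G L Z,X M F P],
    [X A A A,X K N B,X F K C,X P H D,X B C E,X L P F,X E I G,X Z F H,X C D I,X I Z J,X H J K,X N E L,X D B M,X J M N,X G L Z,X M G P],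
    [X A A A,X P F B,X F K C,X K P D,X B C E,X I M F,X E I G,X M E H,X C D I,X N G J,X L N K,X H J L,X D B M,X Z H N,X G L Z,X J Z P],
    [X A A A,X J Z B,X F K C,X N G D,X B C E,X I M F,X E I G,X M E H,X C D I,X P F J,X L N K,X H J L,X D B M,X Z H N,X K P Z,X G L P],
    [X A A A,X P G B,X F K C,X L M D,X B C E,X Z E F,X E I G,X K Z H,X C D I,X N F J,X J P K,X H J L,X D B M,X M H N,X I N Z,X G L P],
    [X A A A,X M G B,X F K C,X I P D,X B C E,X N E F,X E I G,X J N H,X C D I,X K M J,X Z F K,X H J L,X D B M,X L Z N,X P H Z,X G L P],
    [X A A A,X P G B,X L N C,X F K D,X B C E,X Z E F,X E I G,X K P H,X C D I,X N F J,X J Z K,X H J L,X D B M,X M H N,X G L Z,X I M P],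
    [X A A A,X K N B,X P F C,X F K D,X B C E,X M E F,X E I G,X J P H,X C D I,X N G J,X L Z K,X H J L,X D B M,X Z H N,X G L Z,X I M P],
    [X A A A,X P G B,X J N C,X F K D,X B C E,X I P F,X E I G,X Z E H,X C D I,X N F J,X L Z K,X H J L,X D B M,X K M N,X G L Z,X M H P],
    [X A A A,X P F B,X K H C,X H J D,X B C E,X I M F,X E I G,X Z L H,X C D I,X F K J,X L N K,X M E L,X D B M,X G P N,X N G Z,X J Z P],
    [X A A A,X P F B,X J Z C,X H M D,X B C E,X M E F,X E I G,X K P H,X C D I,X F K J,X L N K,X N J L,X D B M,X Z H N,X G L Z,X I G P],
    [X A A A,X G L B,X L N C,X N G D,X B C E,X Z J F,X E I G,X P F H,X C D I,X F K J,X H Z K,X I M L,X D B M,X M E N,X K P Z,X J H P],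
    [X A A A,X I N B,X F L C,X Z G D,X B C E,X N H F,X E I G,X J P H,X C D I,X K Z J,X M F K,X H K L,X D B M,X G J N,X P E Z,X L M P],
    [X A A A,X H N B,X J H C,X P K D,X B C E,X L P F,X E I G,X K F H,X C D I,X I Z J,X Z J K,X M E L,X D B M,X F M N,X N G Z,X G L P],
    [X A A A,X F L B,X K N C,X P G D,X B C E,X E J F,X L P G,X Z E H,X C D I,X H I J,X I Z K,X N F L,X D B M,X G K N,X J M Z,X M H P],
    [X A A A,X F L B,X P G C,X K N D,X B C E,X E J F,X Z E G,X L P H,X C D I,X H I J,X N F K,X I Z L,X D B M,X G K N,X M H Z,X J M P],
    [X A A A,X F P B,X J N C,X N E D,X B C E,X E J F,X L Z G,X Z F H,X C D I,X K M J,X M L K,X H I L,X D B M,X P H N,X G K Z,X I G P],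
    [X A A A,X F P B,X P H C,X K M D,X B C E,X E J F,X N E G,X J N H,X C D I,X L Z J,X M L K,X H I L,X D B M,X Z F N,X G K Z,X I G P],
    [X A A A,X K Z B,X M F C,X Z L D,X B C E,X E J F,X P E G,X F N H,X C D I,X N H J,X J P K,X H I L,X D B M,X L M N,X G K Z,X I G P],
    [X A A A,X P E B,X L M C,X Z L D,X B C E,X E J F,X N H G,X F N H,X C D I,X K Z J,X M F K,X H I L,X D B M,X J P N,X G K Z,X I G P],
    [X A A A,X I P B,X F L C,X N E D,X B C E,X E J F,X L Z G,X M G H,X C D I,X K M J,X Z F K,X H I L,X D B M,X P H N,X G K Z,X J N P],
    [X A A A,X F P B,X M K C,X I H D,X B C E,X E J F,X L M G,X Z G H,X C D I,X P L J,X J F K,X H Z L,X D B M,X K E N,X G N Z,X N I P],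
    [X A A A,X I P B,X M K C,X P G D,X B C E,X E J F,X N H G,X F N H,X C D I,X K Z J,X Z F K,X G I L,X D B M,X L E N,X J M Z,X H L P],
    [X A A A,X F P B,X L F C,X Z L D,X B C E,X E J F,X N E G,X J N H,X C D I,X K G J,X G Z K,X M K L,X D B M,X P I N,X I H Z,X H M P],
    [X A A A,X I P B,X P G C,X L E D,X B C E,X E J F,X K Z G,X F N H,X C D I,X H L J,X Z F K,X M K L,X D B M,X G I N,X N H Z,X J M P],
    [X A A A,X K Z B,X P G C,X L E D,X B C E,X E J F,X I P G,X F N H,X C D I,X N H J,X G I K,X M K L,X D B M,X Z F N,X H L Z,X J M P],
    [X A A A,X M F B,X E K C,X I P D,X B C E,X N H F,X F I G,X J N H,X C D I,X Z G J,X G J K,X K M L,X D B M,X P E N,X H L Z,X L Z P],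
    [X A A A,X M F B,X E K C,X I P D,X B C E,X G M F,X K H G,X J N H,X C D I,X Z G J,X L E K,X P J L,X D B M,X F Z N,X H L Z,X N I P],
    [X A A A,X J N B,X E K C,X P E D,X B C E,X I H F,X N I G,X G Z H,X C D I,X L G J,X Z J K,X F P L,X D B M,X K M N,X H L Z,X M F P],
    [X A A A,X K G B,X E K C,X H M D,X B C E,X N H F,X I P G,X Z L H,X C D I,X F I J,X L E K,X G Z L,X D B M,X P J N,X J N Z,X M F P],
    [X A A A,X J N B,X E K C,X I E D,X B C E,X M L F,X H M G,X K F H,X C D I,X Z G J,X G P K,X F I L,X D B M,X P J N,X N H Z,X L Z P],
    [X A A A,X I E B,X E M C,X N L D,X B C E,X J H F,X Z J G,X G N H,X C D I,X K F J,X H Z K,X M I L,X D B M,X P K N,X F P Z,X L G P],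
    [X A A A,X M L B,X E M C,X K E D,X B C E,X L G F,X N J G,X F Z H,X C D I,X Z I J,X G P K,X I H L,X D B M,X J F N,X P K Z,X H N P],
    [X A A A,X M L B,X E M C,X L H D,X B C E,X Z K F,X I F G,X F P H,X C D I,X N I J,X J G K,X H Z L,X D B M,X K E N,X P J Z,X G N P],
    [X A A A,X F P B,X L G C,X Z J D,X B C E,X E M F,X I E G,X M I H,X C D I,X P K J,X G N K,X J H L,X D B M,X K F N,X N L Z,X H Z P],
    [X A A A,X N K B,X F L C,X I B D,X B C E,X M I F,X E J G,X J D H,X C E I,X P Z J,X H P K,X K F L,X D G M,X Z M N,X G N Z,X L H P]]"

lemma good_reps: "list_all good reps" "list_all length16 reps"
  by (simp_all only: reps_def list.pred_inject good.simps apart.simps eval_simps)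

lemma invariants_reps:
  "map list_invariant reps =
     [3936256, 3097600, 4129024, 8914296, 12560128, 6889552, 4469760, 6779008, 5995240,
      4118992, 4490512, 5902720, 4571440, 3261224, 3901392, 12390400, 8667136, 5218336,
      6692800, 3264832, 3296032, 8689024, 2889984, 6683584, 4949264, 7855960, 3741616,
      7311616, 7409824, 2818048, 2657560, 4633216, 5372056, 1982464, 4697088, 8068288,
      1597696]"
  by (simp only: reps_def list.map invariant_simps eval_simps)

text \<open>Together with \<open>code_invariant_isomorphic\<close> this shows that no two
  representatives are isomorphic.\<close>

lemma distinct_invariants: "distinct (map list_invariant reps)"
  unfolding invariants_reps by simp

section \<open>The certificate of the search\<close>

text \<open>The pieces \<open>cert1\<close> to \<open>cert29\<close> are subtrees of
  \<open>cert\<close>, separated because of their size. Each starts with \<open>S\<close>, so its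
  configuration becomes available to the branches that follow it.\<close>

definition cert1 where "cert1 = S (R B F [S (R B G [R B H [R B I [R B M [U A A B C E I B C E A A A],
 R B M [U A B B C E I B C E A A A],S (R B M [U A C B C E I B C E A A A]),
 Q A A B D H Z B D G G L Z],S (R E D [R B J [U A E B C E I B C E A A A]])],
 R B H [Q A A B C E I B C E B C E,R B I [R B M [U A G B C E I B C E A A A],
 R B M [U A H B C E I B C E A A A],R B M [U A H B D H Z B D G C D I],
 R B M [U A I B C E I B C E A A A]]],S (R B H [R E J [R B L []],R E N [R B P []]]),
 Q A A B C F K B C F B C E,Q A A B D H Z B D G C D I,Q A A B D G N B D H D B M]),
 R B G [S (R B H [Q A A B D G N B D H A A A,R B I [R B J [R B K [U A L B C E I B C E A A A],
 R B K [U A M B C E I B C E A A A]],R B J [R B K [U A M B C F K B C F D B M],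
 R B K [U A K C D L Z B C G Z E F]],R B J [R B K [U A J B C K Z C D G N F K],
 R B K [U A M B C G L B C G B C E]],R B J [R B K [U A M B C H J B C H C D I],
 R B K [U A N B C E I B C E A A A]]]]),Q A A B D E M B D E B C E,S (R B H [S (R B J [R B I []]),
 S (R B I [R B K []])]),Q A A B D E M B D E B C E,S (R B H [Q A C B C G L B C G D B M,
 Q A B B D G N B D H C D I]),Q A A B D F P B D F A A A],S (R F B [R B H [R B N [],R F D []],
 R B H [R B K [],R F D []],R D K [R B H [R B I [R B G [R B K [U B B D B G L C D H C D I],
 R B J [U B D B C E I B C E A A A]]],R B I [R B G [U B E B C E I B C E A A A]],
 R B G [R B I [U B D G L P F D B F E I G]]],R B I [R B G [R B H [U A M K P I M C D G A A A]]]],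
 R B N [R C N []],R C P [R C H [R B G [R B H [U A M E I G L B C E A A A]]],
 R B H [R B Z [R B G [R B I [U B B D C P K B D F A A A],R B I [U B E C B M I D C E D B M]]],
 R B N [R B G [R B I [U B D B D J H D C F B C E]]],R B G [R B J [U B F B C E I B C E A A A]]]],
 R D J [R E K [],R B P []],R D H [R D I []],R C M [R D F [],R F D []]]),
 Q A A B C F K B C F B C E,Q A A B D G N B D H C D I,Q A A B D H Z B D G D B M,
 R C J [S (R C K [S (R F B []),Q A A B D G N B D H C D I]),Q A A B C F K B C F B C E,
 R B I [R B L [],R B L [R B H [U B E B C L N C D H C D I]],R C E [R B H []],R C N [R B M []]],
 R B M [R B J [R B H [R B I [R B K [U B E B D M I C B E A A A]]]],R F B [],R B P [R B K []],
 R B Z [R G F []]],S (R C G [R B K [],R F H []]),S (R B K [R F H [],R C G []]),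
 Q A B B C F K B C F B C E,Q A A B C F K B C F B C E],S (R B H [R C J [R C M [R C H []],
 R C F [R B I [R B J [U B G C B G M C B E P H L]]]],
 R C J [R B J [R B K [R B M [U B L B C E I B C E A A A]]],R D I [R B L []]],
 S (R B Z [R B K [R B G [R B I [U B D B J N C E H C D B M]]],
 R C Z [R B G [R B J [U B D B N J C E D C H K Z]]],R B K [R B J []]]),
 Q A A B C F K B C F B C E]),Q A A B D G N B D H C D I,S (R E C [Q A G D B J Z D B G B C E,
 R B Z [R B I [R B G []]],R B G [Q A G D B L N D B F A A A,R C P []],R E F [R B I []],
 R B H [Q A G C B M I D C E D B M,Q A G C B P K D C H C D I,
 R B I [R B K [U B G L K D N H E F D B M]]],R B Z [R D G []]]),
 S (R F H [Q A H D B L N D B F A A A,R D E [R B P [R B G []]],R E F [R C H []],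
 R B H [Q A H C B M I D C E D B M,Q A H C B P K D C H C D I,
 R C H [R B N [U B P B C E I B C E A A A]]],R B G [Q A H D B J Z D B G B C E,R D K []],
 R D E [R B M []]]),Q A B B C F K B C F B C E,Q A A B C F K B C F B C E,
 Q A B B D H Z B D G D B M,Q A A B D H Z B D G D B M,Q A B B D G N B D H C D I,
 Q A A B D G N B D H C D I])"
definition cert2 where "cert2 = S (R C K [Q A A B C F K B C F A A A,Q A A B D F P B D F A A A,Q A A C D P F C D G A A A,
 Q A A C B P K D C H A A A,Q A A D C K F C B G A A A,Q A A D B K P D B H A A A,
 S (R C I [R C L [R B I [Q A A B C M E D B E A A A,Q A A B D M I C B E A A A,
 Q A A B E M K C H D C D I,Q A A B H K C D E G A A A,
 S (R B J [R B K [R B M [U C C B C E I B C E A A A],R B M [U B K B D L F D C H Z F G]],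
 R B K [R B M [U B I B D J G D C F I Z K],R B M [U B I B C N H D B F I Z K]],
 R B K [R B M [U B I B F J C D E C A A A],R B M [U B I B E L C D E B C D I]],
 R B K [R B M [U B I B H K C D E G D B M],R B M [U B I B G I C D E F B C E]]]),
 R B J [R B K [R B M [U B J B C M F D B E J M Z],R B M [U B J B D I F D C E J M Z]],
 R B K [R B M [U B L B D J E D C E N E K],R B M [U C E B C E I B C E A A A]],
 R B K [R B M [U B J B G I D D E F J N Z],R B M [U B J B H K D D E G J N Z]],
 R B K [R B M [U B J B E K H D F B J N P],R B M [U B J B F I G D F C J N P]]],
 Q A A B H C I B E H A A A,Q A A B E H I B H C A A A],S (R E B []),Q A A B D E M B D E A A A],
 R B F [Q A A B C E I B C E C D I,Q A C D C L F C B F F L C,S (R B I [Q A C D C E M D C E A A A,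
 Q A C B D M I C B E A A A,R B Z [],R B Z []])],R C L [Q A B B D E M B D E C D I,
 Q A A B C E I B C E C D I,R B I [Q A D D C E M D C E A A A,
 R B M [R B J [R B K [U B P D C M I B D E A A A]]],
 R B M [R B J [R B K [U B N C D H K D B H N H J]]],
 R B N [R B J [R B K [U B L C B K H B D F H I L]]]]]]),S (R B H [Q A A B D E M B D E A A A,
 Q A A C D M E C D E A A A,R B I [S (R B J [R B P [],R B N []]),Q A A D C J H C B H D B M,
 R B J [R B K [U C J B C E I B C E A A A],R B M [R B L [U C K B C E I B C E A A A]],
 R B K [U C L B C E I B C E A A A],R B N [U C M B C E I B C E A A A]],
 S (R B Z [R B L [R B N [R B F [U C G C Z F G E G B F L C,U C M C D M E C D E A A A]]],
 R B K [R B N [R B F [U C G B G K I C E H F L B,U C L B C F K B C F B C E]]]]),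
 Q A A C D Z H C D F D B M,Q A A D B K P D B H B C E,
 S (R D K [R B J [R B Z [R B F [U C Z B C E I B C E A A A,U C K D B I M D B E A A A]]],
 R B K [R B Z [R B F [U C Z C D Z H C D F D B M,U C L C D M E C D E A A A]]]]),
 Q A A C D N G C D H C D I,Q A A D B J Z D B G D B M]]),S (R B H [Q A E B D E M B D E A A A,
 Q A A D C K F C B G A A A,Q A A B D E M B D E A A A]),S (R D P [Q A A B D E M B D E A A A,
 R B F [R B L [R B J [],R B G [R B H [U D B G B J N D G E F L B]],
 R B G [R B H [U D B G B P M D H F D B M]]],S (R B L [R B K []]),Q A A B D E M B D E A A A,
 R G C [R B G [U D D B C E I B C E A A A]]],R B L [],R C N [R H K []],
 R B F [R B K [S (R B I []),R H D [R B G [R B I [U C D G H E L D F E A A A],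
 R B I [U C E G H D L D H G A A A]]],Q A A B F D Z B F D B C E],R C H [R B I [],R B K []],
 R B J [Q A L Z H P F C B E M K C,R B P [R B G [R B H [U D F B C E I B C E A A A],
 R B H [U D D C L M K D F E P G D]]],Q A L D B H J C D F A A A]]]),
 S (R D P [Q A D B D E M B D E A A A,Q A A B D E M B D E A A A,
 R B F [R B J [Q A A B D E M B D E B C E,R E P [R B G [R B K [U C G E B I G B H D I H Z],
 R B K [U C I B F J C D E C A A A]]],Q A A B F G K B H D F L B],S (R C E [R B L []]),
 Q A A B D E M B D E A A A,R F J [R B H [U D I B C E I B C E A A A]]],
 R B F [R B I [Q A N B C M E D B E A A A,Q A N B G J E D F E F L B,Q A B B F G K B H D E J F],
 R B I [R B J [],R B P []],R B I [Q A N B C M E D B E A A A,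
 R B J [R B H [U D J B C E I B C E A A A]],R B H [U D K B C E I B C E A A A]]],
 Q A B B D F P B D F B C E]),Q A A B C H J B C H D B M,Q A C B C H J B C H D B M,
 Q A A B C F K B C F B C E,Q A C B C F K B C F B C E,Q A C B C G L B C G C D I,
 Q A A B C G L B C G C D I])"
definition cert3 where "cert3 = S (R B H [Q A A B C H J B C H A A A,Q A A C D P F C D G A A A,Q A A D C I E C B E A A A,
 S (R H C [R D N [R B M [Q A P E F Z N B F C C D I],R D E [R B P []],R C N [R B P []],
 R B N [R B I []]],R F C [R B N [],R E Z []],R H L [R E F [],R B M []],
 Q A A C B L G B D H A A A,Q A A C D F K D B H A A A,R C I [R C P [],R C M []]]),
 Q A A B C H J B C H D B M,S (R F D [R F M [R B I [Q B A D B E I C D E A A A,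
 Q A B B D L G D C G E K C,Q A B B C Z H D B G A A A,R B N [R B J [U D Z B C E I B C E A A A]]],
 S (R F B []),R F B []],Q B B Z M P G G F C A A A,Q A B C D Z H C D F C D I,
 R B L [R C Z [R B K [R B I [R B J [U D J J B M H G F B N F J],
 R B J [U E A B C E I B C E A A A]]]],R B K [R B P []]],R B K [Q A B C M B E F E C J G K,
 R E H [R B G [R B I [U E A D B Z H B C H D B M]]],R B P [U D J J B E Z F G B M H N]],
 Q B B B D Z J C B H A A A,Q B B C M P J G H C A A A,R F M [Q A A B C E I B C E D B M,
 R C G [Q B B D B N G B C G A A A]],R B J [R C E [],Q A C B C M E D B E A A A,
 R C E [R B K [R B F [R B G [U C N C B G Z C B H E K C],R B G [U E B B C E I B C E A A A]]]]],
 Q A C M C P G F H B A A A,R C M [R B N [R B I [U E B B C H J B C H A A A]],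
 Q A C B C M E D B E A A A,R D J []]]),R B M [Q B C C B E M C B E A A A,
 R B N [Q B C C D G L D B F A A A,R B Z [Q B C B M K J E C B E K C]],
 R C H [Q B C C D H J D B G A A A,R B N [R B F [R B I [U D C C D I M B C E C D I],
 R B I [U D C C D L N B C G D B M]]],R B N [R B J [R B F [U C L C D I Z B C E K N D]]]],
 S (R E D [R F B [],R B F [R B G [R B I [R B J [U D C C B I E B D E A A A],
 R B J [U D C C B L G B D H A A A]]],Q A C C D P F C D G D B M],R B J []]),
 Q A A B C G L B C G B C E,Q A E B D L G D C G A A A,Q A E C D H J D B G A A A,
 S (R F E [Q B D C D J Z B C H A A A,Q B D C B F P C B G A A A]),Q A A B C G L B C G B C E],
 S (R E H [R F H [R C J [R B F [R B I [U D K D B G L C D H A A A]]]],Q B E C B L G B D H A A A,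
 R E P [],Q A F D B Z H B C H A A A,R E P [R B J [R B F [U E F B C E I B C E A A A]],
 R D H [R B F [U D F B M E L H C D B C E]]],Q B E B C K P C D G A A A]),
 S (R G Z [Q A G D B H J C D F A A A,R G J [R C J [R B F [R B J [U D K C B H Z C B H B C E]]]],
 Q B F B D N L C B F A A A,R E P [],R E P [R B Z [R B F [U C N L K I G G F E A A A]],
 R B I [R B F [U E H B C E I B C E A A A]]],Q B F C B F P C B G A A A]),
 S (R E N [R B G [Q B G C D N G C D H A A A,R B L []],R B G [Q B G C B N L D C G A A A,
 R C F []],R B F [R B J [Q A H C B J H B D G A A A],R G H [R B L []],R H L []],
 Q A E F B M Z D E B C D I,R E P [R B F [],R B Z []],R E P [R B F [],R C M []]]),
 S (R G F [R E H [R D E [R B M []]],R G Z [R B M [R B I []]],Q B H C B I E B D E A A A,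
 R F N [R B J [R B F [U E J C D E I D B E A A A]]],Q B H C D G L D B F A A A,
 R E K [R B I [R B G [U E I B C J Z C D F C D I]]]]),S (R F C [Q A A B D E M B D E B C E,
 Q A A B D M I C B E C D I,R C F [],R H C [],R H L [R B L []],R E Z [R C P [],R B N []]]),
 Q A A B C H J B C H D B M,Q A B B C H J B C H D B M,Q A C B C H J B C H D B M,
 Q A D B C H J B C H D B M,Q A E B C H J B C H D B M])"
definition cert4 where "cert4 = S (R E B [Q A A D B I M D B E A A A,Q A A C B M I D C E A A A,Q A L B C F K B C F A A A,
 Q A A D C K F C B G B C E,Q B K D B L N D B F A A A,
 S (R E D [S (R B F [R C J [R B H [R B G [R B J [U E J E H B M E H B B C E]]]],
 R B K [R B H [U E C N H C M C B G H N F]]]),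
 S (R B J [R C K [R B G [R B F [U E Z B C E I B C E A A A]]],
 R B G [R B H [U D P G L B E B D G G N K]]]),Q A A C B I E B D E A A A,
 Q A B C B I E B D E A A A,Q A B C B M I D C E A A A,Q A A C B E M C B E A A A]),
 Q A D C B I E B D E A A A,Q A D D B E I C D E A A A,Q B N D B H J C D F A A A,
 Q A Z B C N G D B F A A A,Q A D D C H Z D C F B C E,Q A D D B M E B C E A A A,
 Q A D D C Z J B D G C D I,R F I [R B K [R B G [R B L []],
 R B I [R B G [U E M N G Z H H E B A A A]]],Q A D D B J Z D B G A A A,Q B N B D G N B D H A A A,
 R B K [R B F [R B G [R B I [U D K J H C B B C G H Z P]]],R B F [R B L []]],
 Q A D D B M E B C E B C E,R F C [Q A D D B G L C D H B C E,R B K [Q A D J H F P D H B N K F]],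
 R E K [Q A D D B F K C D G A A A,R B K [R B F [R B G [U D M E M K F B C H A A A]]]],
 Q B N B C K P C D G A A A],S (R F M [Q A D C D Z H C D F B C E,Q A D B C H J B C H B C E,
 R D L [R B K [R B H [R B I [U D B L C P I B H E A A A]]],
 R B J [R B H [R B I [U F B B C E I B C E A A A]]]],
 R B J [R B G [R B F [R B K [U E P K F G N E D B E M C]]],
 R B N [R B F [U F C B C E I B C E A A A]]],Q A A D C P K B D F D B M,Q A D C D L N B C G C D I,
 Q A D B C Z H D B G A A A,Q A D C D E I D B E A A A]),Q A E C B E M C B E A A A,
 Q B Z D B P F B C F A A A,Q A P B D J H D C F A A A,Q A A B C M E D B E A A A,
 Q A A B C I M C D E A A A])"
definition cert5 where "cert5 = S (R B E [cert1,Q A A B D E M B D E A A A,Q A A D B I M D B E A A A,Q A A D C I E C B E A A A,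
 Q A A C B M I D C E A A A,Q A A C D M E C D E A A A,cert2,Q A A C D N G C D H A A A,
 Q A A D C J H C B H A A A,cert3,Q A A B C F K B C F B C E,Q A A D B K P D B H A A A,
 Q A A D B J Z D B G C D I,Q A A C D Z H C D F A A A,Q A A C D N G C D H B C E,
 Q A A B D F P B D F B C E,Q A A B D E M B D E A A A,Q A A C B P K D C H A A A,
 Q A A C B Z J D C F C D I,Q A A D C L G C B F A A A,Q A A D C J H C B H B C E,cert4,
 Q A A B D E M B D E A A A,S (R F E [Q B A B C F K B C F A A A,Q A F F B I L D H B A A A,
 R B G [Q A F B D G N B D H A A A,Q A F C B P K D C H C D I,Q A F C B Z J D C F A A A,
 Q A F B C G L B C G A A A,Q A F D B K P D B H C D I,Q A F D B J Z D B G A A A,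
 Q B A B C G L B C G A A A,Q B P B D G N B D H A A A,Q B P B C G L B C G A A A,
 R E P [R B I [R B K [R B M [U F F B C E I B C E A A A]],
 R B K [R B M [U E E E M B H B C F E M F]],R B K [R B M [U E J F P Z J B E G Z L H]],
 Q A A C B N L D C G D B M],R F N [],Q A F C D F K D B H A A A],Q A A B D G N B D H A A A,
 Q A A B C G L B C G A A A],Q A F D C I E C B E A A A,Q A F C D M E C D E A A A,
 Q A A C D H J D B G A A A,Q B P C D J Z B C H A A A,Q A F D C G N D C G A A A,
 Q B P D B F K C D G A A A,Q A A C D M E C D E D B M,Q A F C D J Z B C H C D I,
 Q B P D C N L B D H A A A,Q A F C D H J D B G A A A,Q A A D C G N D C G A A A,
 Q A F D C M I B D E C D I,Q A A D C I E C B E C D I,Q B P C B F P C B G A A A]),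
 Q A A B D I E D C E A A A,Q A A B C M E D B E A A A,Q A B B D F P B D F B C E,
 Q A B B C F K B C F B C E,Q A A B D F P B D F B C E,Q A A B D K F D C H B C E,
 Q A A B C P F D B H B C E,Q A A B C G L B C G C D I,Q A B B D L G D C G C D I,
 Q A B B C L N C D H C D I,Q A A B D N L C B F C D I,Q A A B C L N C D H C D I,
 Q A A B D H Z B D G D B M,Q A B B D Z J C B H D B M,Q A B B C Z H D B G D B M,
 Q A A B D Z J C B H D B M,Q A A B C J Z C D F D B M])"
definition cert6 where "cert6 = S (R B E [Q A A F B I C B E C A A A,S (R D E [R B N [R B H [R B G []],R B L []],R E D [R H E [],
 R H G []],R D K [R C P [],R C J [R B H [R B I [R B J [U E F I N B K C D E D B N,
 U F A M B F H H D C J P F]],R B P [R B I [U E J F I P D B C F G J H,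
 U F E B D E Z C D G K Z J]]]]],R B Z [Q A A Z E H L B C E A A A,Q A A E L K M B E H F I B],
 R E M [R B K []]]),Q A A B D E N B D E A A A,S (R B I [S (R D Z [R G E [],
 R D L [R B G [R B L [U E L E Z B C B H F A A A]]]]),S (R E C [R B M [],
 R D H [R B G [R B J [U D Z E F P C C G D K M D]]]]),Q A B B C E J B C E B C E,
 Q A A B C E J B C E B C E,S (R C G [R D I [],R B G [R B J [R B K [U D P E F K G C F D P K H]]],
 R E Z []]),S (R B N [Q A E F N B G B D E A A A,R B P [R B K [R B G []]],R C F []]),
 S (R D I [R D J [],R C J [R B J [U F J B C M H D C G F I B],R F D []],R B J [R B H []]]),
 Q A B B C E J B C E B C E,Q A A B C E J B C E B C E,Q A C B C E J B C E B C E]),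
 S (R E F [R H F [R B K []],R B N [R C K []],R H I [R B P [R B G []]],R C J [R B L [R B P []],
 R G N []]]),Q A A B D E N B D E A A A,S (R F B [R D K [R D J []],
 R C N [R B K [R B Z [R B G [U F M G P D B B D G D B N]]],R B I [R B H []]],
 R C N [R B L [R B M []],R D K []],R E M [R D G []]]),S (R D F [R F B [R D H []],
 R B I [R C H [],R C H [],R B N []],R D E [R C P []],R C H [R B N []],R B P [R B K [],R B L []],
 R C N [R B M [R B L [R B I [U E Z M I G D B C F P J H]]],R C Z []]]),
 S (R F B [R D F [R B J []],R E P [R D G [],R B Z []],R D E [R D J [],R B I []],R D P [R B P [],
 R B G []],R C H [R E H [],R H G [],R B I [R B G [U F C E H N C G E D B C E]]],
 R H F [R B I [R B L []]]]),Q A B B D E N B D E A A A,Q A C B D E N B D E A A A,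
 Q A A B D E N B D E A A A,S (R E F [R F B [R B H [],R B N []],Q A L N B G D E B C B C E,
 R D G [R B Z [R B G [R B H [U E K G P M L C B E J P L]]],R B N []],R B N [R B I [R B M []]]]),
 S (R B G [R F C [],R H G [R C F []],R F C [],R B Z [R E J []],
 R E G [R C L [R B H [R B I [R B J [U E I Z K F M B C H N L M],
 R B J [U F I K J C G E H G L H J]]]],R B I []],R C M [],Q A F B P C J F B G A A A]),
 Q A B B D E N B D E A A A,Q A A B D E N B D E A A A,
 R C N [R B I [R B L [R B N [R B K [U F K N F B L C B E J H P]],
 R B G [R B J [U F J D H B I E F H C D I]]],R B P [R B K [R B G [U F K F Z B C F G B I G L]]],
 S (R E H [R B G [U F J I M B L D C E D B N]]),
 R D G [R B J [R B G [U E N D I H J D G B G K J]]],Q A A B J E L F G B B C E,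
 R B K [R B P [R B G [U F L F G B J E H F J M P]],R B M [U E N D L H K D G C F I B]]],R C M [],
 R C M [Q A F B C P E D B H C D I,Q A E B C P E D B H C D I],
 R B G [R C K [R B L [U G F F N B D B C E B C E]],
 R D P [R B N [R B K [U F L P L F M D B E P L M]]],R B J [R B K [U E K B E K M C H B D B N]],
 R B K [U F L H G F I D F H G M L],R B H [R B K [R B J [U F L K F B C G D C J F K]],
 R B L [R B J [U E N N P J Z C F D H J M]],R B K [U F L F H B M E D F M F L],
 R B J [R B L [U F L F I B Z B D E J H K]]],R B H []],R D I [Q A H F N B L B D E A A A,
 S (R B J [R C J [],R B G []]),R E C []],
 R B H [R B Z [R B G [R B I [U F L N J B P D B E C D I]]],
 R B J [R B G [R B I [U E Z P N L M C F B F I B]]],R B M [R B G [U F L C G B N E B H D B N]],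
 R B P [R B I [R B J [U F L P L B C H B D G Z J]]],R B I [],R D F []],
 R C M [Q A F B C N F D B E D B N,Q A G B C N F D B E D B N],R D I [Q A A B D E N B D E A A A,
 R G N [R B K [R C J []],R B J [R B H []]],R B H []],R B G [Q A G B C M G D B F A A A,
 Q A F B C M G D B F A A A]]])"
definition cert7 where "cert7 = S (R E F [Q A A B C F K B C F A A A,Q A A B D E M B D E B C E,
 S (R B G [S (R C L [R B I [R B J [R B L [U F M G K B F B D H C D I]],
 S (R B J [R B K [U F N K M B D D G C P J H]])],R B K [Q A B B D N J C B E D B N,
 Q A B B D M I C B E C D I],R B H [R B I [R B J [U F N F J B D B H E E P F]],
 Q A A B E H L B G C F M B],R B H [Q A B N J B C H F E A A A,
 R B M [R B I [R B K [U F N D M B H B E C B C E]]]]]),Q A A B F H M B H D E P F,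
 Q A C B D G N B D H B C E,Q A A B C F L B C F B C E,Q A A B D E M B D E B C E,
 Q A C B C H J B C H A A A,Q A C B D E Z B D F D B N,Q A A B F C N B E D B C E,
 Q A A B H F P B H F E P F,Q A C B C F I B C E C D I,Q A A B E D K B F C B C E,
 Q A A B E C P B E C A A A,R B I [S (R B Z []),Q A A B M E Z F D B E P F,
 Q A A B I M K G F B G Z J,Q A A B G J E D G E F M B,Q A D B D P K C B G C D I,
 Q A A B F H M B H D E P F,Q A A B L E C E H F B C E],Q A D B E D P B E C E P F,
 Q A D B F C J B F D F M B]),S (R B E [S (R F C []),Q A A B C G J B C H C D I,
 Q B F I J H F E F D B C E,R E M [S (R B Z []),Q A A B D P L C B G B C E]]),
 Q A A B D E N B D E A A A,S (R H B [Q A A B C L P C D G B C E,Q A H B C H J B C H A A A,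
 Q A A B D J G D C F C D I,Q A D B J D M F E D A A A,Q A H B C P H D B G A A A,
 R B E [Q A H B D G P B D G D B N,R B G [R B P [R B K [R B H [U F D D C E P B C H P L Z,
 U F G M F Z G D C F M J D]]]]],R B N [Q A H B C L Z C D G D B N,
 R B E [Q A H B C H L B C G C D I],R B H [Q A D B M C J F B D A A A]],
 Q A H B D J H D C F A A A]),S (R G B [Q A B B D P L C B G B C E,Q A I B D H Z B D G B C E,
 Q A E B M C J F B D A A A,Q A B B C Z G D B G C D I,Q A I B D N J C B E D B N,
 Q A I B D L G D C G A A A,Q A A B D M K C B F D B N,R D N [R B G [Q A E B J D M F E D A A A],
 R B E [R B M [R B P [R B G [U F N E Z I D C D H P I G,U G B M J N H D B F F M B]]],
 R B G [R B H [R B J [U G P B D J M C D F F M B]]]],R B G [Q A I N G K I B D F G N Z]],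
 R B N [R B L [],R B H [Q A I H P Z F C D E I H F]]]),Q A J B C M E D B E B C E,
 S (R F P [Q A J B C F I B C E C D I,Q A C B D I E D C E A A A,Q A F B J D M F E D A A A,
 Q A J B D Z L C B G D B N,Q A J B D K G D C G B C E,R D K [Q A F B M C J F B D A A A,R C P []],
 Q A A B D L F D C H B C E]),S (R F L [Q A D B D P L C B G B C E,Q A K B D F N B D E D B N,
 Q A G B M C J F B D A A A,Q A D B C N E D B E A A A,Q A K B D P K C B G C D I,
 Q A K B D L G D C G A A A,R B L [R B G [Q A G B J D M F E D A A A],R B G [],
 Q A K B C M G D B F A A A],Q A C B D P L C B G B C E]),Q A L B D N L C B F C D I,
 S (R E M [Q A E B D N I C B E A A A,Q A E B C N E D B E A A A,R D G [R B P [],R B N []],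
 Q B L P H E J B D E F M B]),Q A M B C I P C D F D B N,Q A B B D E N B D E A A A,
 Q A C B D E N B D E A A A,Q A M B D J E D C E B C E,Q A E B D E N B D E A A A,
 Q A D B D E N B D E A A A,Q A A B D E N B D E A A A])"
definition cert8 where "cert8 = S (R B E [Q A N B C H L B C G C D I,S (R E Z [Q A N B C H J B C H A A A,R B H [R B P [],
 R F G []],R E K [R E F [],R E F []],R B N [R C M [],R D E []],R G N [R G F []],R B G [R B J [],
 R D H []]]),S (R B K [R B J [R B H [R B G [U G F C G H J G B F Z H C]],R B L []],
 R B G [R B J []],R B G [R B M [],R B N [],R H G []],R B H [R B N []],R D Z [R B M []],
 Q A Z B D N J C B E D B N]),Q A P B D G P B D G D B N,Q A B B C F L B C F B C E,
 Q A A B C F L B C F B C E,S (R H G [Q A P B C G L B C G A A A,Q A C B C G L B C G A A A,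
 Q A P B D P K C B G C D I,R C I [R B G [],R B G []],R E F [R C G [Q A P F C P J F H G P G M],
 R C L []],R B G [Q A P B C F I B C E C D I,R B P []],R B H [R B L [],R C H []],
 Q A P B D I H D C F B C E]),S (R B G [R F B [R C H [U F P L H E Z B D E E K D],R B L []],
 Q B A B C H J B C H A A A,Q B A B C F I B C E C D I,R H G [Q A D B C G L B C G A A A],
 R B M [R F G [],R B P [R B H [R B J []]]],R G Z [R D J []],R E G [R B I [],R B I []]]),
 Q A A B C F L B C F B C E,Q A B B C F L B C F B C E,Q C B F B Z C B E C A A A,
 R B G [Q B B B D G N B D H B C E,Q B B B C H J B C H A A A,Q B B B D E Z B D F D B N,
 Q B B B C F I B C E C D I,R E F [S (R B I [R B N [R B H [R B J [U F I N H B D B D H A A A]]]]),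
 Q A A B D H N B D H C D I],R B J [R B N [R B H [R B K [U G E C N I L C E B F Z B]]],
 R B N [R B H [R B I [U G E D I P N C G F E M G]]]]],S (R D J [R F B [R B P [],
 R B L [R B H [R B I [R B J [U F Z F Z K H C D E P J Z],R B J [U G Z G F C N D E F J E G]],
 R B I [R B J [U F Z N K G P B C E P J Z],R B J [U G Z K J C F E H F K G C]],
 R B I [R B J [U G Z Z N C J H D F I H K],R B K [U F Z J G Z L D B E P J Z]],
 R B I [R B K [U G A J G D B C D G A A A],R B J [U G B E M G P B C F D B N]]]]],
 R E F [R E K [R B H [U F K N H B D B D H A A A]],R B J []],Q A E B C I M C D E C D I,
 Q A D B C I M C D E C D I,Q A E B C J P C D F A A A,Q A D B C J P C D F A A A]),
 Q A A B C F L B C F B C E,Q B D B E C M B E C B C E,R C I [S (R D N [R B M [R B N []]]),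
 Q B E B D G N B D H B C E,Q A A B C H L B C G C D I,Q B E B D F N B D E D B N,
 S (R B L [R B G [R B I []],R C P []]),S (R C G [R B I []]),Q A B B C H L B C G C D I,
 Q A A B C H L B C G C D I],S (R C M [R H L [R B H []],R F J [],Q A I B D N J C B E D B N,
 Q A H B D N J C B E D B N,Q A I B D M L C B F A A A,Q A H B D M L C B F A A A]),
 Q A A B C F L B C F B C E])"
definition cert9 where "cert9 = S (R B E [R B F [R B P [R B M []],R F P [R B N [R B L []],R D G []],Q A A B D J H D C F A A A,
 Q A A B D K G D C G B C E,Q A A B C Z H D B G B C E,Q A A B D M I C B E C D I,
 Q A A B D Z L C B G D B N,Q A A B C J N C D E D B N,Q A A B C K P C D G C D I],
 R B F [R B P [R B H []],R C Z [R B K [R C G []]],Q A A B D J H D C F A A A,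
 Q A A B D K G D C G B C E,Q A A B C Z H D B G B C E,Q A A B D M I C B E C D I,
 Q A A B D Z L C B G D B N,Q A A B C J N C D E D B N,Q A A B C K P C D G C D I],
 S (R D L [R D G [R B P [R B N []],R E C [R B K []]],Q A A B D Z L C B G D B N,
 Q A A B D K F D C H A A A,R B F [Q B I B D H M B D H D B N,R B M [],
 R B L [R B I [R B J [U H G K F E G D C F L N H]]]],
 R D G [R B F [R B H [U H C Z L B C G B C B C E]]],R B K [R H G [],R B P []],R D G [R H B []]]),
 R E M [Q A B B C J N C D E D B N,R D I [Q A B B D J H D C F A A A],
 R C Z [Q A B B D Z L C B G D B N],R E J [R C K [],R B K []],R B K [R B F [],R B H []]],
 Q B J B C F K B C F A A A,R E C [Q B J B C Z H D B G B C E,R B P [Q C J G J B C B C E A A A],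
 R B N [R B P [],R B M []],R B P [R D K [],Q C J C E B M E B G Z H C],R B I [R B J [],R B J []],
 R B Z [Q C J G C P B E B C A A A,R C I []]],S (R B M [Q B J B D K G D C G B C E,
 R C N [R B F [],R B J []],R C P [Q A B B D N L C B F C D I,Q B J B D N L C B F C D I],
 R D H [Q B J B C M E D B E B C E,R B J [R B I [R B F [U G I Z K J G D C E M H Z]],
 Q C J I N B K B C E B C E]],R C N [R B L [R B J [U G F H L C D B C E D B N]],R D J []],
 R C I [R C M []]]),S (R B F [Q A A B D G M B D H A A A,R F L [R B M []],R B P [R B N []],
 Q A B B D F N B D E D B N,Q A C B D M I C B E C D I,Q A C B D Z L C B G D B N,
 Q A C B C J N C D E D B N,Q A C B C K P C D G C D I]),Q A D B D E M B D E B C E,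
 Q A D B C I M C D E C D I,Q A D B C L Z C D G D B N,S (R B F [Q A B B D G M B D H A A A,
 R B L [Q B L B D Z J C B H C D I],R E M [],Q A C B D F N B D E D B N,Q A D B D M I C B E C D I,
 Q A D B D Z L C B G D B N,Q A D B C J N C D E D B N,Q A D B C K P C D G C D I]),
 Q A E B D N J C B E D B N,Q A E B D P K C B G C D I,R B F [Q A C B D G M B D H A A A,
 R C H [R C K [R C F []],Q A A B D J E D C E B C E],R B P [R B J []],Q A D B D F N B D E D B N,
 Q A E B D J H D C F A A A,Q A E B D K G D C G B C E,Q A E B C Z H D B G B C E],
 Q A E B C N G D B F B C E,Q A E B C P H D B G A A A,Q A E B D I H D C F B C E,
 R B F [Q A C B D G M B D H A A A,R C Z [Q A B B C H J B C H A A A],R B P [R B I []],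
 Q A D B D F N B D E D B N,Q A E B D J H D C F A A A,Q A E B D K G D C G B C E,
 Q A E B C Z H D B G B C E]])"
definition cert10 where "cert10 = S (R H G [Q A A B D E Z B D F D B N,Q A A B C H I B C H B C E,Q A F B D I H D C F B C E,
 Q A A B C F I B C E C D I,Q A F B C Z H D B G B C E,Q B N B D H Z B D G B C E,
 Q B A B C G L B C G A A A,Q A F B D H Z B D G B C E,Q B N B C Z H D B G B C E,
 Q A A B C Z H D B G B C E,Q A A B D L H D C G C D I,R F L [Q A F B D L G D C G A A A,
 Q A A B D E P B D F C D I,Q A F B D F N B D E D B N,Q A A B D P K C B G C D I,
 Q A A B C I P C D F D B N,Q A A B D J E D C E B C E,
 R E M [R C N [R B J [R B E [U G M K H L F B C H K H G]]]],
 R B G [R B F [R B E [R B H [U G M E Z F M D B G P I J]]],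
 R B J [R B E [U I D C D P L B D F F M C]],Q A F B C Z F D B H A A A]],
 Q A A B C I Z C D F B C E,R F L [Q A F B D L G D C G A A A,Q A F B C K P C D G C D I,
 Q B N B D F N B D E D B N,Q A F B D F N B D E D B N,Q A F B C E K B C F C D I,
 Q A A B C K P C D G C D I,R B J [R B K [R B G [R B L [R B E [U G Z C B J M C B H J G L,
 U G P C K G F G C D E Z J]]],R B H [R B L [R B E [U G P D E L J E C F F Z K,
 U H I E L I N E B C L F G]]]],Q A A B C Z G D B G C D I],Q A A B C I P C D F D B N,
 Q B N B C K P C D G C D I],R C Z [Q A F B D L G D C G A A A,R C N [Q A F J G H K D B F H N P,
 Q A A B D P I C B H D B N],Q A F B D M I C B E C D I,Q A F B D Z L C B G D B N,
 Q B A B C H J B C H A A A,R B E [Q A A B C G L B C G A A A,Q B A B C F K B C F A A A],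
 Q A F B D F N B D E D B N,Q A A B C M G D B F A A A,Q A A B D Z J C B H C D I],
 Q B N B D I H D C F B C E,Q A A B C K Z C D G A A A,R H Z [Q B N B D G P B D G D B N,
 Q A F B C Z F D B H A A A,Q A A B D P I C B H D B N,Q B N B C Z F D B H A A A,
 Q A A B C K P C D G C D I,Q A A B C I P C D F D B N,
 R B K [R B H [R B F [R B E [U G Z C B L E B C G J H G]]],R F I [],
 R B H [Q C N K N G J B D E A A A]]]])"
definition cert11 where "cert11 = S (R E B [cert6,Q A A B D F P B D F B C E,cert7,cert8,Q A A B D F P B D F B C E,cert9,
 Q A A B D H N B D H C D I,Q A F B D M K C B F D B N,Q A F B D I E D C E A A A,
 Q A A B C G I B C H D B N,Q A A B D E N B D E A A A,Q A F B C N E D B E A A A,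
 Q A F B C J Z C D F C D I,cert10,Q A A B C I N C D E A A A,Q B Z B C N E D B E A A A,
 Q A B B D Z I C B H B C E,Q A A B C N E D B E A A A,S (R F B [Q B Z B D E M B D E B C E,
 Q B B B C F K B C F A A A,Q A B B D F Z B D F A A A,Q A G B C L N C D H C D I,
 Q A G B C Z F D B H A A A,Q A B B D G Z B D G C D I,Q A G B D P I C B H D B N,
 S (R G H [Q A G B C L Z C D G D B N,Q A G B D K G D C G B C E,Q A G B C H J B C H A A A,
 Q A G B D G N B D H B C E,Q B Z B D K G D C G B C E,Q A A B D G N B D H B C E,
 Q A A B D K G D C G B C E,R F J [R B E [R B H [U I B J H F N E D C A A A]],R D F []],
 Q A B B D J G D C F C D I,R C E [R B N [R B E [R B F [U I B F Z M I H E C A A A]]],R B G []]]),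
 Q A B B C K Z C D G A A A,Q B P C I D H B E H B C E,Q A C B D Z K C B G A A A,
 Q B P B D P I C B H D B N,S (R H B [Q A C B D H P B D G A A A,Q A H B C P H D B G A A A,
 Q B P C N D L E F H C D I,Q A B B C P H D B G A A A,Q B P B C I M C D E C D I,
 R H L [R E D [Q C P J F B C B C E A A A],R H D []],Q A B B D H P B D G A A A]),
 Q A D B C I Z C D F B C E,Q A C B D Z K C B G A A A,Q C A B C L N C D H C D I,
 R H B [Q A D B D H P B D G A A A,Q A I B C P H D B G A A A,Q A B B C I N C D E A A A,
 Q A D B C N H D B F C D I,Q A D B D K H D C G D B N,Q A A B C I N C D E A A A],
 R G B [Q C A B D H Z B D G B C E,Q B D B C G L B C G A A A,Q C A C E D Z F B H D B N,
 Q C A B D N J C B E D B N,Q C A B C K P C D G C D I,Q C A D G C J F E D C D I]]),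
 S (R E J [Q A E B D F M B D E C D I,Q A J B C I M C D E C D I,Q A E B D G M B D H A A A,
 Q A J B D J H D C F A A A,Q C B B D E Z B D F D B N,Q C B B C F I B C E C D I,
 Q A J B C F I B C E C D I,Q A J B D E Z B D F D B N,R D G [Q A E B C M E D B E B C E,
 Q C B B C P F D B H B C E,Q A E B C P H D B G A A A,Q C B B C M G D B F A A A,
 Q A D B D G M B D H A A A,Q A D B D Z J C B H C D I,Q A D B D L G D C G A A A,
 Q A A B D J G D C F C D I,Q A D B D N J C B E D B N,Q A D B D L F D C H B C E,
 Q A A B D N J C B E D B N],Q A E B C Z F D B H A A A,Q A E B C M F D B E C D I,
 Q A D B C I M C D E C D I,Q A A B C I M C D E C D I,R G K [Q A D B C N H D B F C D I,
 Q A A B C L N C D H C D I,Q A E B C N H D B F C D I,Q A E B C P H D B G A A A,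
 Q C B B D K F D C H A A A,Q A A B D L H D C G C D I,Q C B B C L N C D H C D I,
 Q A D B D H N B D H C D I],Q A E B C K M C D H D B N,Q A D B D F M B D E C D I,
 Q A D B D M I C B E C D I,Q A E B C I M C D E C D I,Q A A B D I F D C E C D I,
 Q A D B D I F D C E C D I]),Q C C B D M K C B F D B N,Q A F B D N I C B E A A A,
 Q A A B C N E D B E A A A,Q A A B C I N C D E A A A,Q A F B C P E D B H C D I,
 Q A F B C N E D B E A A A,Q C C B C J Z C D F C D I,Q A F B C I N C D E A A A,
 Q A E B D I E D C E A A A,Q A B B D E N B D E A A A,Q A A B D E N B D E A A A,
 Q C C B D I E D C E A A A,Q A F B C K N C D H B C E,Q A E B D N I C B E A A A,
 Q A E B D E N B D E A A A,Q A F B D L E D C H D B N,Q A F B D I E D C E A A A,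
 Q A A B D N I C B E A A A,Q A A B D I E D C E A A A])"
definition cert12 where "cert12 = S (R D C [S (R B E [R E Z [],R C G [R C L [R B G [U H L F E G M F G E F K D]]],R B Z [R B K [],
 R C I []],R B P [R B G [R B F []],R B G []],R F G [],
 R B F [R B G [R B H [R B J [U H D J Z E B H E G D E K]]]]]),S (R E B [R H I [R E J [],
 R B L [Q A C G D H Z E F G M Z D]],R G J [R B E []],R D I [R B J []],R B G [R C H [],
 R B L [R B K []]],R E Z [R F C []],Q D F G F B P E F H N J B]),
 R E Z [Q A D Z L M K C D E I B G,S (R B L [R D G [],R B E []]),R B L [R B G [],
 R B H [R B E []]],S (R B E [R B Z [],R C F [R B F [R B G [U I D P B F H H D F C D I]]],
 R B Z [R B F [U I D P B D L E C F J N C]],R B F [R B G [R B H [U I D P B J N G B F K M Z]],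
 R B M []],Q A E B Z I E E B G A A A,R B H [R B J []]]),Q A A D C I E C B E A A A,
 Q A B D C I E C B E A A A],R D M [R E M [Q A F Z C E H E H C A A A,Q D I J H I D E F H A A A],
 Q D I Z F E I B D E G K C,Q A F F Z B M C D E I B G,Q A F L F P M D B E I B G,
 S (R B E [R C I [],R C L []]),R D Z [Q D J M Z K H E F D A A A,Q D J J H I D E F H A A A],
 Q A A D C I E C B E A A A],Q A D D C I E C B E A A A,Q A E D C I E C B E A A A,
 R E Z [R B K [R B E [R B F [R B J [U H Z P C E H E H G B C E]]],R B H [R B E []],
 R B E [R B H [U H L M K N J B D H G K Z]],R E H []],S (R D M [R B L []]),R B H [R B L [],
 R B E [R B F [U J A I M B D G F H N J F]]],S (R H E [R F L []]),Q A A D C I E C B E A A A,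
 Q A B D C I E C B E A A A],R D Z [S (R E B [R B H []]),Q A A D C I E C B E A A A,
 R E F [R B M [R B E [R B F [U I D M K I L E F G E M D]]]],S (R B L [R B H []]),
 Q A A D C I E C B E A A A,Q D N J H I D E F H A A A]])"
definition cert13 where "cert13 = S (R D C [R B L [R B E [R B F [],R D G []],R F D [R C L [],R B F []],R C L [R B G [R B I []]],
 Q E F H C B I E B C C D I,R C L [R F E []],R C G [R B P []],R B G [R B E []]],
 R E H [Q B C K M N I E C F M Z D,R D K [R C K []],R D G [R B I []],R E F [R B L []],
 R E F [R B G []],R C F [R C L []],Q B C G D H Z E F G M Z D],R B L [R B J [R D N [R C K []],
 R B I []],R B I [R B J []],Q E F H C B I E B C C D I,R B F [R B E []],R E D [R B J [],
 R B F []],R C F [R B F []],Q A G B L C H C F G B C E,R D J [R B G [],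
 Q A A Z C P I G H E Z H F]],R B H [R C M [R B M []],R F N [R B G []],R B F [R B P [],
 Q A F J K L G H F B F N H],R D K [],R D I [R E H []],R D I [R E H []]],R D J [R C J [R B F []],
 Q E F M N Z E E B D A A A,R H C [R D G [],Q A A M I D N C E D Z M B],
 R D I [Q A A N P H L H B E A A A,Q B C N D M F D E F A A A,R D P []],
 R B M [Q B C H C B I E B C C D I],R H B [R G D [],Q B C G D H M E F G Z M B],
 Q A G M Z K H F G E K B N],R H Z [R D G [R B N []],R B P [R F D [],R D G []],R C I [R B M [],
 R G E []],R D M [Q A A F H L E H B C D E K],Q A G M Z K H F G E K B N,R D M [R B J []]],
 R F E [R B E [Q E F F B I C B E C A A A],R F B [],Q E F M N F P E B D A A A,
 Q B C J M I Z D C E G I C,R B N [Q B C J B M Z E F C B C E,R B I []],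
 R D F [Q B C M N J P E B D A A A,R B E []],Q E F H C B I E B C C D I,R F B [R B I []]],
 R C Z [Q A G L B N D F E H C D I,R F E [Q A F M J C P C D H K B N],Q A A M P K Z G B D K B N,
 R F E [R F C []],R D F [R B F [Q B C L N B P B E D Z L B],R H L []],R B H [R B J [],
 Q A B N I D H B G C K B N],R B I [R B F [R B M []],R B G []]]])"
definition cert14 where "cert14 = S (R D C [R D Z [R B N [R D F [],R B H [R B F [U I L E I F Z E G H M B C]]],R E N [R B Z []],
 R B L [R D E [],R D E []],R B K [R B L [],R F E []],R D J [Q A K E L F D B C E M B C],
 R H D [R B K []]],R G K [Q A H Z E C F H D B I K Z,Q A F Z E C F H D B I K Z,R C L [R E F [],
 Q A L P J M B H B F B C E],Q A E Z E C F H D B I K Z,Q A A Z E C F H D B I K Z,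
 R C Z [R C J []],R D E [Q A H F C M D G H D P J D]],R G F [R B F [R B I []],
 Q B H F P E I B D E M B C,R E Z [R B E []],R D P [R D Z []],R B E [R B F [],
 R B F [Q A G P L F C E F D M B C]],R G I [R D I []]],R B K [R B L [R C J [],R B Z []],
 R C G [R C Z [Q B H P F L I D B E M B C],R B E [R B F []]],Q A G D J Z C B H D D E K,
 R E L [R B F [],R B G [R B H [R B E [R B F [U J G Z B D K G C H P J D,
 U J E B D E M D C F F M D]]],Q B H P F L I D B E M B C]],R E D [Q A F D K Z P B G C A A A,
 Q A M J K P Z C F B A A A],R D J [R B F [R B E []]],R F C [R B G []],
 R C Z [Q B H P F L I D B E M B C,Q B H Z P M I E D F A A A]],R E Z [R C L [R B L []],
 R D G [R B J [],R B I []],R D G [R E F []],R B Z [R B N [],R C K []],R B F [R C F [],R B Z []],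
 R H K [R C H []]],R B J [R B F [R B I [],R B P []],R B E [R F N [],R D E []],R B L [R D G [],
 R B N []],R F P [R B H []],R B L [Q A K D E C M F D E D E K],R B L [R E N [],R C F []]],
 R F E [Q A H N J D I E D G D E K,R C N [R C H []],R H F [Q A E K I B N B G F J N B,R B K []],
 Q A B N J D I E D G D E K,R B N [R B E [],R B Z []],Q A E E J M K F D E D E K,
 Q A F N J D I E D G D E K],R C H [R E H [],R C Z [Q A L I L Z C B H F D E K,
 Q A A J K F N C D F J H G],R B P [R B F [],R B Z [Q B H B L N C E H G A A A]],
 R B F [Q A C N P Z I H G D A A A,R G M [],Q A B C F Z I H E F F P Z],
 R E H [R B H [Q A L G P D H D G E B C E]],R C I [R H L [],Q A B C H Z E H G F L J M]]])"
definition cert15 where "cert15 = S (R D C [R H K [R H D [Q A M Z N B H F H D I K G],R C G [R B N [],R E C []],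
 R H D [R B G [Q B H Z D B L E H C J G F]],R B G [R B N [R B L []]],R B G [R F G []]],
 R G K [Q A F K E P G G D C I K Z,R C Z [Q A A Z K F C F B D I K Z,R B N []],
 Q A G Z E C F H D B I K Z,R C Z [R B J []],Q A L Z E C F H D B I K Z,Q A F Z E C F H D B I K Z,
 R B F [R E F [],R B E []],Q A C Z E C F H D B I K Z],R E L [Q B I F P E J B D E M B D,
 Q A I J K B F G B F H I L,R D M [R D P [],R C I [R B E []]],R B G [R B E [],
 Q A A C I P G D E F D E K],R C P [R B F []],R D K []],
 R C P [R C M [R B K [Q A B K D B F D E C K F J],Q A N H B M I F G E M B D],
 S (R H C [Q A L K E F I B F D C D I]),Q A A B D L G D C G A A A,
 S (R D J [R B G [Q B J K F J Z D C E M B D]]),Q A A B D L G D C G A A A,R B K [R B F [],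
 Q A K K B H C B G E K G H]],S (R D L [R C L [R B N []],R C H [R B F []],R E B [R E Z []],
 R B Z [R B F [Q A J N C B I F E G A A A]],R C F [R F B [],R B Z [Q A H P N F L F G H K I H]],
 Q A N Z M L N B F H A A A,Q A N K G F E F E H M B D]),R F C [R B P [R E F []],
 R F D [Q B K M G Z F G E H M B D],R F N [R D G []],R D G [Q B L B M I D E D B B C E,R D P []],
 R C F [R B N [],R B N []]],R F E [R C G [R B I [R B K []],R C Z []],Q A L N J D I E D G D E K,
 R C N [Q A I L Z B C F D H I G M],Q A F N J D I E D G D E K,Q A Z N J D I E D G D E K,
 R B N [R B Z [],R B J []],R C N [Q A A N E I D E B G D E K],Q A I E J M K F D E D E K,
 Q A J N J D I E D G D E K],R B J [R G I [],Q B L I K G F D E F B C E,R C P [R B Z []],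
 R C F [R B F []],R B P [R E F []],R C N [R B N [],R B F [R G I []]]]])"
definition cert16 where "cert16 = S (R D C [S (R D J [R B H [R B J [],R H F [],Q B M B Z E H E C F F M B,R C J [R B J []]],
 S (R B H [R B P []]),Q A A B D Z J C B H C D I,R B H [R B F [U J B B L D N F E G G N H],
 R B L [R B F [R B G [U K H B L G F F H G B C E]]],R C I []]]),S (R D J [S (R D F [R C F [],
 R G C []]),Q A A B D Z J C B H C D I,R B K [R C J [],R B J [Q F C G F B L E F H J N F],
 R C I []],R B E [R B Z [R B H [R B K [R B F [U J Z P B J E B F G J P N,
 U J M B J L H G H D N F J]]],R B F [R B G [R B H [U J B F G M I G F H D E K]]]],
 R B G [R B H [R B L [R B F [U J Z H D I B F C G K Z C,U J J B I D F F E C A A A]]],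
 Q F C B K J Z E F G P G B],Q F C C P I E E F G A A A,Q B P J B P C E F C A A A,
 R B L [R B G [R B F [R B H [U I Z D F K L E F G I K H]]],
 R C H [R B K [R B F [U K A J B C N E G D A A A,U J Z K Z I D F G B F N J]]]],
 R B L [Q B P H Z P D E H G A A A,R B F [R B G [U J L I M C F E H G B C E]]]]]),
 S (R D J [Q A A K Z C P E H C D E K,S (R C M [R F B [],R B L [U J F P J B E G C H Z H F]]),
 Q A A B D Z J C B H C D I,R D I [Q F E P F E I B C E G Z C,Q F E B K I Z E F G P G B,
 Q F E J B P C E F C A A A]]),S (R D J [S (R H C [R D E [Q B A N E C I B D H A A A],R B Z []]),
 Q A A B D Z J C B H C D I,R B K [R E P [],R B I [],Q A Z G F H N F E G C D I],
 Q A F K E D F H E B M B Z]),S (R D J [R E G [R C F [],R D I []],R C F [R D E [],R D G []],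
 Q A C K Z C P E H C D E K,Q A G K E D F H E B M B Z]),S (R D J [Q A B K E D F H E B M B Z,
 Q A F K Z C P E H C D E K,Q A A K Z C P E H C D E K,Q A A K E D F H E B M B Z]),
 Q A B B D Z J C B H C D I,Q A A B D Z J C B H C D I])"
definition cert17 where "cert17 = S (R D C [S (R D M [Q B D N Z M K E G F E I H,R D G [R D K []],R E F [R B F [],R B G []],
 R C L [R B H []],Q B C K J N F D G B A A A]),
 S (R E B [R B G [R B L [Q C L N P Z I E G F A A A]],R B H [Q C L C N H E E G F G I B,
 R B J [Q F Z G F B L E F H J N F,R B P [R B L [R B E [U L E N P D J F E H D E K,
 U K I P C I G F G H F J N]]]],R B J [R B P [R B N [R B E [U J N B L D G H F G K G C,
 U K Z J F I Z C B G F J N]]],R B E [R B F [U J N Z J M E G E H G I B]]],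
 R B K [Q C L P C M H E G F G I B,Q B G J E Z F C E D Z B D],R B L [Q A P Z L B J G F E L N F,
 R B E [R B F [U J Z H J D F E F G D E K]]]],R F B [R C L []],Q B D L J F N G D B C D I,
 R E G [R B J [Q A D K G B D D E F D E K]],R B M [Q F Z M I P N E F G Z B D,R F B [],
 R B N []]]),Q A A B D M I C B E C D I,Q A B B D M I C B E C D I,R B M [R B E [R B H [],
 R B G [Q B K I Z P M F C G G M F],R B G []],R E H [R C H []],R B I [Q B L J G M I E F D A A A],
 R B E [R B I []],Q F P M I P N E F G Z B D,R H P [Q B J C E D L F G B D E K]],
 R D F [R E M [Q C B D F P C H E G B C E],R G J [R D Z [],R E P []],Q B A F H B P H F G K I N,
 R H I [Q B J H L D F C H B C D I],R B P [R B J [],R B E [U K H J G H F E F H P L B]],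
 R E B [R B I []],R E M [Q A C E G N K H E B M J Z],R B N []],
 R D L [R D K [Q F P I N G J B C E Z B D,Q C M I J G K E G D B C E],S (R B M [R B H []]),
 Q A A B D M I C B E C D I,Q G A M I P N E F G Z B D,S (R E G [R E L [],R C K []]),
 Q A A B D M I C B E C D I],R H E [R C P [Q C B L H G C C B G F I J],R D M [R B I []],
 R B J [R B E [],Q A H L I E C F D H B C E],R C P [Q C Z I M P K E G F Z B D,
 Q B H N I C D C B H L J N],R B H [R B G [],R B N []],R C I [Q B L H K P Z G F B A A A,
 Q A E I L C F E D B A A A],Q C Z I D C N E D G M K C,Q B G L J F N G D B C D I]])"
definition cert18 where "cert18 = S (R C B [S (R D C [R H L [Q A A K M N I E C F M Z D,R F D [R C L []],R E Z [R B Z []],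
 R F D [R B E [R B F [U I G L J M B C G F A A A]]],R D F [R B K []],Q D D M K N P E B G M Z D,
 R B K [R B G [R B E [U I F N I B C F H B B C E]],R C I []]],R C G [R C L [],R B G [R B E [],
 R B J [R B F [U H N E C F K H G D F K H]]],R B K [R B Z [],R F L []],R C L [R B J []],
 R E Z [R B K []]],R B J [R E J [R B G [],R E N []],R B E [R C I [],R B G []],R B P [R B M [],
 R B F []],R D N [R B M [R C M []]],R B M [R B H [R B K [R B L []]],R B G []],R F I [R B F []],
 R B F [R H G []]],R B J [R D P [R C I []],R E C [R B H [R B K []],R B P []],R D N [R B P []],
 R E L [R B H []],R D N [R B P [],R B H [R C J []]],R B F [R B E [],
 R B P [R B G [R B H [U H N N D J I C F G Z L G]]]]],R G D [R D N [R G B []],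
 R D N [R B J [R B E []]],R H Z [R B M [R B G []]],R C I [R B J []],R B E [R B F []],
 R D L [R C F [],R E C []],Q A A N D M F D E F A A A,Q D D Z D M E B E H A A A],
 R B G [R B K [R B M [],R B H []],R F P [R C P []],
 R C F [R B P [R B F [U I F E B G K F D E H N B]]],R D E [R C P []],R F E [R C F [],R B F []],
 R E B [R B E [R B F [R B J [R B L [U H L H N J F D G C B C E]]]]],R D E [R B K []]],
 R E Z [R C J [R B Z []],R D N [R C H []],R B E [R B K []],R C M [R B H []],
 R G B [R B G [R B E []]]],R D I [R C Z [R B J [],R D K []],R D P [R F E []],
 R C M [R B E [R B K []],R B H []],R H E [],R F Z [],R C J [R B J [],R B Z [R B G []]],
 R B H [R B K [],R B G []]]]),cert12,S (R D C [R D E [R F I [R C G []],R G J [R B H []],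
 R H C [],R H Z [R D Z [],R B P []],R B F [R B E []]],R C J [R B L [R B G []],R B N [R B Z [],
 R B E []],R D F [],R C N [R B N []],R B P [R B J []],R E J [R D N []]],
 Q A K C D M E C D E B C E,R C J [R B Z [R F P [],R B P []],R H P [Q A K J N P I F B H G J L],
 R B E [R B P [],R B J []],R E C [R B G []],R E J [R B Z []],R B M [R B F []]],
 R D F [R D N [R D P []],R B K [R D I [],R B E []],R B K [R B G []],R B K [R C N [],R B E []],
 R D N [R C H []],R B L [R B J [],R C F []]],R E B [R B L [R B P []],Q D Z N B G I E B C A A A,
 R B P [R B N []],Q A L B M H I E D B A A A,R D M [],R B L [R D I []],R C K [R B J [],
 R B J []]],R C J [R B J [R B E [R B G []]],R C M [R B J []],R F C [R C P []],R D E [R B F []],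
 R C L [R B K [R B G [R B E [U I L K B M D H E G I B M]]],R H P []],
 R H B [Q D Z B K Z J E F H P N B]],R B K [R B E [R E L [],R C G []],R B E [R B F []],
 R F H [R E G []],R B N [R B E [],R G I []],R B E [R B N []],R B E [R C K []]]]),
 S (R D C [R C I [R E Z [R B H []],R C H [R B H []],R C G [R D F []],R C G [R B Z []],
 R F G [R B H [],R F L []],R E Z [R B P [R B I []],R B N []],R C H [R B N [],
 R B H [R B E [U I A K P B M D C G K F J]]]],R G E [Q D P B P J F E B G A A A,
 Q A A Z K C N H C B A A A,R C H [R E H []],R B I [R B E []],R C G [R G P []],R C H [R B H [],
 R B E [Q A M F K G Z B D E E N C]],R C H [R B L [],R B K []]],Q A L C D M E C D E B C E,
 R G J [R D J [R D E [],R C I []],R G I [R C G []],R B H [R B L []],R E C [R B E []],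
 R B K [R D M [],R C F []],R B E [R D J [],R B G [R B I []],R B K []]],R B H [R B K [],
 R D L [R C H []],R C G [R D K []],R C H [R B K [],R C K []],R C H [R E B []],R F L [R E B []]],
 R B P [R F G [],R B H [R C G [R B L []],R B F []],R D P [R D F [],R F E []],R B H [R B K [],
 R C K []],R F B [R B E []],R B H [R F G []]],R F G [R B Z [R G B [],R B G []],R B I [R B L [],
 R D Z []],R B I [R B L [],R F H []],R D G [R C J []],R C F [R F I []],
 R D E [R B E [R B K [R B F [U I J K B P D E F G I M F]]],R F B []],R G F [R D N []]],
 R F H [R B H [R B N []],R F M [],R B H [R F G []],R B H [R H P []],R F C [],R B H [R C H [],
 R B K []]]]),S (R D C [R B L [R B G [R B F [],Q A N P F I L D C E M Z B],
 Q E A K I F D B E H L H D,R B G [R C F [],Q A N P F I L D C E M Z B],Q A N K C P G B E G B C E,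
 R C F [R B G [],R C G []],R G E [R C J []]],R E B [R B L [R C K [Q A N D G C M E G F Z K C],
 R E M [],Q A N G D H Z E F G M Z D],R B L [R B P [],Q A N K C P G B E G B C E],
 Q A N F P C L D B E G L B,R B L [Q A M I C D G B E H B C E,R B G [Q A N K P J Z C B E M Z D],
 R B K []],R F C [Q A N F H B L E C D C D I],
 R H Z [R B F [R B G [R B H [U H M F P D C C B H H J G]]],R B F []],R E H [R B F [],
 R B G [Q A N K P J Z C B E M Z D]],Q A N L K D Z E F H P G B],S (R C F [R D E [R B Z [],
 R C G []],R B P [R D G [],R D Z []],R B P [R B H []],R D M [R D G [],R C J []],
 R C G [Q E A H C B L E B C C D I,R C K []],R B F [R C G [Q E A H C B L E B C C D I],
 R B E []]]),S (R B L [R G E [R B E []],R G E [Q A Z C P L I E G H K G C],R B K [R B Z []],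
 Q E B K I F D B E H L H D,R B I [Q E B H C B L E B C C D I,R C G []],
 R B P [Q A N E G N K C D F N P Z],Q A Z K C P G B E G B C E]),R E D [R B G [R B K [],R C K []],
 R E H [R B G []],R D N [],Q E C K I F D B E H L H D,R C L [R B P [],R F G []],
 R B F [R C H [Q E C Z N E F B E H P G D],R F D []],R B H [R B G []]],
 R F B [R F L [Q A P L K E N E F H A A A],R B N [R C H []],R C I [R C F []],
 R C N [Q A C P B C I G C H C D I],R B H [Q A C C K D G D E G B C E],R B H [R D G [],R B E []]],
 Q A B D C J H C B H A A A,Q A A D C J H C B H A A A]),S (R D C [Q A D D B J Z D B G C D I,
 R B P [R H L [R B G []],R C I [R F P [],R B L []],R E M [R B G []],R E D [R G I []],R E F [],
 R E G [R B G []]],Q A P C D M E C D E B C E,R D J [R F G [],R D F [R B P []],R F I [R B P []],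
 R B K [R B E [R B G [R B F [R B H [U I E N D J G D F H M H P]]],
 R B G [U J H N Z G K C F E Z L G]],R B H [R B E [U I I E P N K C F G B C E]]],
 R H D [R B I [Q B A K M F Z E H G I M F]]],R D J [R D N [R C K []],R C H [R C K [],R C K []],
 R D N [R B N [Q B A Z N M G B E G A A A],R C H [R B F []]],R B E [R E D [],
 R B G [R B H [R B F [U I L L B C H C G H M F H]]]],
 R C N [R B F [R B G [U H P D Z K B B G E N I L]],Q B A F C B J B E H Z M B,R B H []],
 R E M [R C H [Q A E G E K B E B C I F M],Q A A C N J I G B C Z M B]],R D J [R B H [R B L []],
 R D M [R B H []],R E B [R H D []],R E P [R B K []],R D M [R G H []],R C L [R B F [R B H []]]],
 Q A P D B J Z D B G C D I,Q A E D B J Z D B G C D I]),S (R D C [R B I [R F D [R B L []],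
 R B E [],R E J [R H M [],R C H []],R B L [R B E [R B F [U J G D F I C H E G Z I N]]],
 R B F [R G M [],R B L []],R B E [R B F []]],Q A A C D N G C D H B C E,
 Q B A C D M E C D E B C E,R D E [R C Z [R C F []],R E J [R B I [Q A G M Z H B G E D B C E]],
 R E P [R B F []],R B G [R B L [],Q A F G J M C F H B G L H],R D G [R B F [],R B G [R B J []]],
 R H D [],R D Z [R C H []]],R E G [R B F [R B I []],R G K [R B M [R B G []],
 R B I [R B F [U J G P K Z J E D B G I B]]],R B J [R B H [],R B P []],
 R F D [Q B A D N K P E H B I H L],R E M [R D Z []],R B P [Q A B C Z G D B E C D E K]],
 R F M [R B L [R B H [R F B []]],R F G [],R B I [R B J [Q A F N C D G G C B J P C]],
 R C Z [Q B B B I L F E G B B C E],R F G [],R C Z [Q B B B I L F E G B B C E,R B E []],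
 R D Z [R B G [R B F [U J C F H K M H G D E L M]]]],
 R E P [R F M [R B F [R B E [U J A F J Z D D C E A A A]]],R D M [R C P [],R B J []],
 R B L [R B I [],R F L []],R B Z [R B F [R B G []],R B F []],R B F [R B I [R B J []],R E Z []],
 R B F [R B G []]],R D J [R C H [R B L []],R D G [R C I [],R B J []],R B F [R B I []],
 R B H [R B J [Q A A D K E L B H E J M B],R B G [Q E E M F E L B D E G I B]],
 Q A G B K C E F G B P N Z,R D I [R B J []],R C G [R C K []]]]),cert13,
 S (R D C [S (R H L [R F I [R B E []],R C I [R C P []],R B G [R E L [],R C L []],
 R C G [R B E []],Q E G M K N P E B G M Z D,R B F [R G F []]]),Q A D C D N G C D H B C E,
 Q B D C D M E C D E B C E,Q A H D B K P D B H C D I,Q A I D B K P D B H C D I,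
 Q B D D B K P D B H C D I,R E P [R B F [R C L [R B I [U I N Z G F H C D E A A A]],R D K []],
 R C P [Q A B P B E I H C D A A A,Q A A P B E I H C D A A A],R B H [R F P [],R B L []],
 R D K [R D N [],Q A D C Z E P B G E N H F],R B I [R C I [],R B H []],
 R G K [R B F [R B G [R B H [U I F G Z J F D C E A A A]]]],Q A D B E K H H B D M F P,
 R B I [R B N [],Q B E G K J C E D G B C E]],Q A C D B K P D B H C D I]),
 Q A C D C L G C B F A A A,S (R D C [Q A J D B L N D B F C D I,Q A E C D N G C D H B C E,
 Q B E C D M E C D E B C E,Q A D D B L N D B F C D I,R C I [R E Z [R C H []],
 R G J [R B I [R B F []]],Q A E K H B Z G H D D E K,R B M [R D E [],R B E []],
 R B P [R B E [Q A J N B E P G H C E K F],R B F []],R B F [R B K [],R C Z []],R B E [R B N [],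
 R B F []],Q E I Z D M E B E H A A A],R B G [Q E I N F H L B D E G J B,R G I [R H D []],
 R D J [R B J []],R C J [R B J [R B I [U I P C D Z E B C F H J F]]],R C P [R C H []],
 R B E [Q A E G Z C J H B E Z M N],R G D [R C J []]],Q A A C D Z H C D F B C E,
 Q A I D B L N D B F C D I]),S (R D C [R F D [R C K [],R C K [],R G F [R B G [],R C K []],
 R C L [R C K []],R B G [R C F []]],Q A F C D N G C D H B C E,Q B F C D M E C D E B C E,
 R H D [R F G [R B H []],R C H [R B P []],R D J [R B F []],R C N [],R C F [R C G []],
 R C G [R B H []]],R H F [R B M [R C Z [],R C H []],R G H [R B F [R B J []]],
 R C P [R B F [R B E [U I I M H B C B C G B C E]]],R D F [Q A E N M E P B G F D E K],
 Q A L G E P D F D C L B M,R B G [Q E J I N G J B D E Z M D,R B H []],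
 R F G [Q A F Z G B K G B D D E K,R D G []]],Q A A C D P F C D G B C E,
 Q A B C D Z H C D F B C E,R F M [R B M [R B J [],R B N []],R D M [R B I [],R C H []],
 R C F [R H Z [],Q B G L M F P C E D A A A],R B F [R B K [R B G []],R B I []],
 R D M [R B F [R B I [],Q A L B F G P B H D A A A],R D L []],R E G [R B N []]]]),cert14,cert15,
 cert16,S (R D C [R E L [R C G [R C F []],Q C H F Z E I B D E N B C,Q B H C Z J D G E F H J L,
 R B P [R C G [],R C J []],R E H [R C L [],R D L [],R B F []],R E P [R C I []],R B F [R B L [],
 R B K []]],R G K [Q B E K E P G G D C I K Z,R G I [R B E [Q F K E M P F B E G A A A],
 R B E [Q C H E I J K B E H A A A]],Q B F Z E C F H D B I K Z,Q B K Z E C F H D B I K Z,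
 R C F [Q C H E I L C E H G B C E,Q C H Z C N L E H C A A A],Q B E Z E C F H D B I K Z,
 R C Z [R H E [],R B G [Q A A G J H C E D C N B C]],R C F [Q C H Z C N L E H C A A A,R B E []],
 Q B B Z E C F H D B I K Z],R H D [R D F [R B Z [],R D L []],R G K [R C F []],R B I [R B M [],
 R C N []],R C P [R C J []],Q B A F H E L G E F K P G,R D L [R F N [],R C I []],
 Q C H N Z B I B E H A A A],R B H [R C N [R B P []],R B G [R B F [],R B E []],R G I [R E L []],
 R C J [Q A A P M G N E F H A A A,R C N [Q F K Z P G F E B H H M D]],R C P [R C G []],
 R B M [R E G [],R B P []]],Q A L B D I E D C E A A A,R G I [R B H [R B G [],R C Z []],
 R E F [R E H [],R D F []],R C M [R B E [],R B G []],R E H [R B E []],R D I [],R B H [R D P []],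
 Q A L L D C M E C D C D I],R F E [Q B E N J D I E D G D E K,R B G [],R B F [R B P [],R C H []],
 Q B A N J D I E D G D E K,R D J [R B E []],Q B K N J D I E D G D E K,
 R B E [Q B A I K J P E C F E L D,Q A A B N G J G C H B C E]],
 R E L [R F B [Q B C H P E B H F E D E K],R C H [R B G [],R B E [R C I []]],R E H [R D L [],
 R C H []],R E P [R B F [],Q B G G M E D F B H D E K],Q C H I K G F D E F B C E,R H B []]]),
 S (R D C [R H D [R B P [Q B N K C L G E C F E L M],R B P [R B F []],R G M [R C F []],
 R C L [R B H []],R H B [Q B G L M I B C F B I K H,R B L [R B E [U K P D F L B E F H H N M]]]],
 R G K [Q B I Z E C F H D B I K Z,Q B G Z E C F H D B I K Z,Q A A Z E C F H D B I K Z,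
 R F P [R F C []],Q B B Z E C F H D B I K Z,R B K [R B J [],Q A A L G P M H C B K M F]],
 R H D [R C M [R C G [],R H Z []],R E H [],Q C I D F C L E H F J L G,R B I [R B F [],R B G []],
 R E H [R H Z [],R B I []],R E C [R B L [],Q C I G F H M E F H Z K C]],R E M [R C M [R B I [],
 R E G []],R B K [R B E [R B F []],R G D []],R B I [R E B [],R B M []],R B F [R B G []],
 R D P [R B L []],R B K [R B G [],R H B []]],Q B A B D I E D C E A A A,
 R E G [R C N [Q B F Z C G F E H B E J G],R D P [],R C N [R B M [],R C L []],R C J [R B F [],
 Q B L C E D L F G B D E K],R B I [R B G [],R B E []],R B G [R B F [],R B H []]],
 R F E [Q B F N J D I E D G D E K,Q B I N J D I E D G D E K,Q B B N J D I E D G D E K,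
 R B F [R B P [],R B M [Q B N G I F B B C E N B D]],Q B L N J D I E D G D E K,
 Q A A N J D I E D G D E K],R F E [R F B [R B H []],R C H [R C P []],R F B [],
 Q B L E G M H F E C C D I,R H D [R B K []]]]),S (R D C [R B P [R B H [R B F []],
 R G H [R B H []],R D P [R B L []],R G B [R B F [R B G [R B J [U J K N K Z L C D H B C E]]],
 Q B B I N J Z H C E P J D],R G J [R B H [R B F [U K I I D B F G C B C D I]],
 Q B H L M D Z D E B I K G],R H L []],R B P [R D J [R B G []],R H D [R G K []],
 R D K [Q B C D I N H E G D C D I,Q B I D L N J E H C P G D],R B G [Q C J Z F N K D B E I K H],
 R B E [R B F [],R D I []],R B H [R C N []]],R F M [Q B M P M F N E F G A A A,R D K [R B F [],
 R B E []],R D G [R B G []],Q C J D F C L E H F J L G,R H P [R C H []],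
 Q C J G F H M E F H Z K C,R D E [R B E []]],R B L [R C I [R B K []],R C G [R B F []],
 R C G [R B H [],R B G []],R G B [R B F [Q C J B Z E H E C F F M B]],Q F M I K J P B E G B C E,
 R B M [R B I []],R C G [R C Z []]],R E G [R F B [R D I []],R E B [R B Z []],
 R D L [R B G [R B J []]],R B H [Q B I P G K N D C H Z L G,R B L []]],R E G [R G H [R B G []],
 R B G [R B F [],R B J []],R D K [R B F [],Q B B J E G K G D H K I N],R C N [R B E []],
 R B H [R B J [],R E B []],R B P [R B I []]],R E C [Q C J C M E L E H B A A A,
 Q F M Z C G L E F C A A A,R B K [R C G []],R E G [Q B I K C G J B H C A A A],
 R B K [R B H [Q B G C M N K H G C C D I]],R E B [R C L []],R E G [Q B C E C F M F C B A A A]],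
 R C Z [R C L [R B J []],Q C I K H J F G C B L J N,R B J [R C G [],Q C J I K G F D E F B C E],
 R G D [R C H []],R C K [R C G [],R B P []],R C H [R B G []]]]),cert17,
 S (R D C [R H Z [R B P [R C I []],R D Z [Q B J H P M B C G D Z B M,
 R B K [Q B N E N G Z B E D K H F]],R F P [Q B Z N K E C E G D K P L],Q B K D J C H C H E B C E,
 R B N [],Q C P D Z G E D E F A A A,Q C P N Z E I D E G A A A],Q B D B D K F D C H A A A,
 R E L [R E Z [R B N [Q C P D Z G E D E F A A A],R E B []],R D N [Q C Z B F D M B G F F I J,
 R B P []],R F G [R B L []],R B I [R B F []]],R G I [R B P [],
 R E H [R C N [R B G [R B I [U L A M F G L C F G E I H]]],R E G []],
 R B H [R B I [Q A A I P G L D G E A A A]],R F E [],Q B I M C K L B E C M K C],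
 R B I [R B J [Q C Z P N B J F E G Z B M],
 R D E [R B F [R B E [R B G [U J L N B K C F B C I G P]]]],S (R G J [R E Z []]),
 Q A A B D I E D C E A A A,Q C D C J P K C E F B C E,
 R G F [R B H [R B E [U J M N M F P G C B Z B M]]]],R H M [Q B N G Z L K G D B B C E,
 R B H [R F M [],R C L [],Q B I B L F I F D E H Z P],R C N [R F G [],R C L []],R H L [R B E []],
 R D M [R E D []],Q C P Z C L B D F C N H G,R F D []],Q A I B D J H D C F A A A,
 R G M [R D G [Q C D N H F E F B C L J N,R B F [Q C A D L M C G B F L J N]],R H G [R B N []],
 Q B I H E I N F D E B C E,Q D A C I P J C E H J N B,R G I [R B I [],R C L []],
 Q A B I K D N D E B C D I,R D M [R B H []]]]),S (R D C [R F G [R B G [R B M []],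
 R F Z [R B K [],R B K []],R C G [Q C G D N F P C F E N G F],Q B L D G K E H B F Z B N,
 R C G [Q C G D N F P C F E N G F,Q C A K P H G F D E D E K]],Q B J B D K F D C H A A A,
 R C G [R B H [R B E []],Q D B H C B M E B C C D I,Q A K G C K B E B C A A A,R B H [R H Z []],
 R D K [R C J []],R C I [Q B Z N K E I H E C A A A],Q A I Z N P F B G E N G F],
 R F G [Q C F N Z M L E G B F J D,R H F [R B G []],R F M [Q C F K P I M H D G D E K],
 R D G [R B E [],R B E []],R D E [Q D B K D N P E B C B C E],Q B Z F K M Z F C G K Z M,
 Q A C P D C H C G D B C E],R F Z [Q A C Z C D K E G D C D I,Q A A D E J I E H G C D I,
 R B P [R D L [],R B H [Q A A E P I N E D C C D I]],R B G [R B H [],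
 R B I [Q D B H C B M E B C C D I],R D N []],R D F [Q A H D E B N H F G M K C,
 Q A K D E B N H F G M K C],R D J [R B M []],R E P [R E L []]],R H P [Q A J N M Z G H F B F L B,
 R B E [R B G [],R B G []],R C M [Q C F J K I E C E H J M B],R B J [R C H [],R B L []],
 R G I [R D L [],R B L [R C L []]],R F L [R D E [],R B F []]],Q A I B D J H D C F A A A,
 R G N [R B K [Q C E E G M H F E C C D I],R B I [R B F []],Q C F I L Z C B H F D E K,R C Z [],
 R B M [R C G [],R E J []],Q A J L D J P G B D L J M]]),Q A I B D N L C B F C D I,
 S (R D C [R B L [Q B N D J C H C H E B C E,R D I [R B G []],Q A J F D M L H B F B C E,
 R B J [R B H []],R G C [R C I []],R B E [R B Z [],Q D C M N F D E C D B C E],R C G [R B E []],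
 Q B M G F H M F E G C D I],Q A K B D K F D C H A A A,R B L [R B G [R B F [],
 Q A K K L I F H C D G K N],R C H [R B Z [],Q C F M Z B K C H B D E K],R D N [R B E [R B N []]],
 Q A J F D M L H B F B C E,R B G [R B E [],R D I []],Q G F I K J P B E G B C E],
 Q A B B D L G D C G A A A,R C N [S (R B N [R C H []]),Q A A B D I E D C E A A A,
 Q G G M F G L B C E G N B,R B I [R D I [],R B M [Q C G M H E Z G F C P B M]],
 S (R F P [R B H [Q C I M K L I F C G D E K],Q C G M K I P D F C P B M]),
 Q A A B D I E D C E A A A],R D G [R F G [Q A D P J H E F G E I Z H,R B L []],R E B [],
 R B N [R B J []],Q B N I C F E F B G M K D,R B F [R E J [],Q A C Z E L J G B C D E K],
 R B Z [R B M [],R B F []],Q C H J Z N L D G C K I N],Q B I B D J H D C F A A A,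
 R B I [Q B N N D F E F E G I F G,R B J [],R F M [R B E [R B M []]],R B K [R C G [],
 Q A L E G M H F E C C D I],R B N [R B E [],Q B N K P G I D B F I M P],R F P [R C L []],
 Q C H N H F E F B C L J N]]),R D C [R F I [R B F [R B J [],R B Z []],R B F [R B J [],
 Q D E B E C K B H E F J Z,R G F []],R F M [R B K [],Q D F D G C I E G F K Z G],
 R B J [Q B Z K C F G B E G B C E,Q C K C I D F C E H L H D]],Q A M B D K F D C H A A A,
 R B N [Q C J M Z N E C G H N H F,R C M [R B K []],Q C E J K M E E C H N I L,
 Q D F F D E P E H G N J B,R C K [R C M []]],Q A D B D L G D C G A A A,
 R B N [R C G [Q D F F H B N E C D C D I,R B G [Q A L B J P E E G F C D I]],R D G [R B L []],
 Q A N M Z B K C H B D E K,R D I [Q C F Z M J K C G F P B N],R B E [R B F []],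
 Q C A C Z E D B G E N L J,Q D F J K L Z E C D B C E],R C M [R G I [R B I []],R G I [R B J []],
 R D G [R E C []],R C N [Q B P F J H B D B E P B N,Q D F B Z G F E C F H M D],R C J [R E D [],
 R B J []],Q C J J K I E C E H J M B],Q B N B D J H D C F A A A,R B N [R B E [R B H [],
 Q A A N C L M C H D P B N],R E C [R B G []],Q C J M Z N E C G H N H F,
 Q A N M Z B K C H B D E K,R C M [],R B E [R B F []],Q C A C Z E D B G E N L J]]])"
definition cert19 where "cert19 = S (R C B [Q A A D B I M D B E C D I,Q A A D C I E C B E A A A,
 S (R D C [R B J [Q A A I B H E B E G J F C,R B G [R B F [],Q A A G H J F C F G B C E],
 Q A A F G I E H B D I B P,Q A A E D L K E B C J H L,Q A A P B M E E D C M Z B,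
 Q A A I J H K B F G B C E,Q A A Z P C L F B D M Z B],Q A A C D N G C D H B C E,
 Q A A C D M E C D E B C E,R C N [Q A A K L I P H G C I B P,Q A A J I H F E F D F N J,
 Q A A G H J F C F G B C E,Q G J F P Z M B E G C D I,Q A A Z B N F E D B N P Z,
 Q A A H D I B E F C B C E,Q A A B P C L G C D N P Z,Q A A D L H N B G D I B P,
 Q A A G J I D E G D I B P],R B L [R C G [R B F []],Q A A L I Z B B G F L G F,
 R C I [Q A A I D Z K D H C D E M],Q A A G J I D E G D I B P,
 R E L [R B E [Q A A D P J E C F B N J L]],Q A A D I H B B G C L Z H,Q A A L I B M C F E D E M],
 Q A A C D P F C D G B C E,Q A A C D Z H C D F B C E,R C G [Q A A H C L E G D E C D I,
 R C I [R C K []],R B N [R E L []],Q A A G C M B E B C A A A,Q A A K L D G H E G A A A,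
 R B L [Q A A J L D M D E G C D I],Q A A E P Z C E C F P N Z]]),
 S (R D C [R E N [R C J [Q A B F K H L D C G M Z B,Q A B L G M E C G D A A A],
 R G N [Q A B C N G H H F E F K H],Q A B F I J D E G B J B F,Q A B F J N K E D B B C E,
 Q A B F M N C E C B M Z B,Q A B F N J P E H B A A A],Q A B C D N G C D H B C E,
 Q A B C D M E C D E B C E,Q A A B D E M B D E B C E,R B I [R G M [Q A B G H L P E G B B C E],
 R B P [R F L []],Q A B J G K L E H B D E M,Q A A P J F C F E H C D I,Q A B M Z G N F H D C D I,
 Q A B N B Z H E D F Z M D],Q A B C D P F C D G B C E,Q A B C D Z H C D F B C E,
 R D G [Q A B L G H I C F B P N Z,Q A B Z G E B G C D D E M,Q A B B N F Z H B E A A A,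
 Q A B G F B K E H G A A A,Q A B B N H E F D H J B F,Q A B F B C M E H F N L J,
 Q A B G M J Z F D H B C E,Q A B F M I L F C B Z I J]]),Q A C D C J H C B H A A A,
 Q A C D B J Z D B G C D I,S (R D C [Q A A B D E M B D E B C E,Q A C C D N G C D H B C E,
 Q A C C D M E C D E B C E,Q A B B D E M B D E B C E,R C Z [Q A C I J K M H G F K B G,
 Q A C L K G E E F H E Z P,Q A C J I L P E G F B C E,Q A C N M Z K E C F A A A,
 Q G L E M N P B E H Z M D,Q A C H G L E C F E B C E,Q A C B N C L H D F A A A,
 Q A C L I B M C F E D E M,Q A C I J H C F G E B C E],Q A C C D P F C D G B C E,
 Q A C C D Z H C D F B C E,R H Z [Q A C L N I B C H D C D I,Q A C M J N Z D B H P N Z,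
 Q A C N I Z K B H D H K D,Q A C H C L E G D E C D I,Q A C F G K E H B E K B G,
 Q A C E K L I F G E D E M,Q A B F H M D E F D P N Z]]),Q A D D C K F C B G A A A,
 Q A D D B K P D B H C D I,Q A D D C L G C B F A A A,Q A D D B L N D B F C D I,
 R D C [Q A B B D E M B D E B C E,Q A D C D N G C D H B C E,Q A D C D M E C D E B C E,
 Q A C B D E M B D E B C E,Q A A B D E M B D E B C E,Q A D C D P F C D G B C E,
 Q A D C D Z H C D F B C E,R F Z [R C L [Q A D G Z D P G C B C D I,Q A D J H P F C G B A A A],
 R G N [Q A D G Z D P G C B C D I],Q A D E K L D E G F L B P,Q A D E L Z I E D F B C E,
 Q A D E Z L M E H F A A A,Q A D E P Z C E C F P N Z]],R D C [Q A D B D K F D C H A A A,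
 Q A D B C K P C D G C D I,Q A D B D L G D C G A A A,Q A D B C L N C D H C D I,
 Q A D B C I M C D E C D I,Q A D B D I E D C E A A A,Q A D B D J H D C F A A A,
 Q A D B C J Z C D F C D I],Q A D B D Z J C B H C D I,Q A D B C Z H D B G B C E,
 R D C [Q A D B D K F D C H A A A,Q A D B C K P C D G C D I,Q A D B D L G D C G A A A,
 Q A D B C L N C D H C D I,Q A D B C I M C D E C D I,Q A D B D I E D C E A A A,
 Q A D B D J H D C F A A A,Q A D B C J Z C D F C D I],Q A D B D P K C B G C D I,
 Q A D B C P F D B H B C E,Q A D B C M E D B E B C E,Q A D B D M I C B E C D I,
 R D C [Q A D B D K F D C H A A A,Q A D B C K P C D G C D I,Q A D B D L G D C G A A A,
 Q A D B C L N C D H C D I,Q A D B C I M C D E C D I,Q A D B D I E D C E A A A,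
 Q A D B D J H D C F A A A,Q A D B C J Z C D F C D I],Q A D B D N L C B F C D I,
 Q A D B C N G D B F B C E,R D C [Q A D B D K F D C H A A A,Q A D B C K P C D G C D I,
 Q A D B D L G D C G A A A,Q A D B C L N C D H C D I,Q A D B C I M C D E C D I,
 Q A D B D I E D C E A A A,Q A D B D J H D C F A A A,Q A D B C J Z C D F C D I]])"
definition cert20 where "cert20 = S (R C B [Q A E D B I M D B E C D I,Q A A D C I E C B E A A A,
 S (R B L [Q G N Z H L D E F H A A A,Q A A H J D I E F H A A A,Q A A J H B E F E H A A A,
 Q A E G E N Z F B D L G C,Q A E F H M D G B D D E N,Q A E H F E J G B C D E N,
 Q A E E D J I E B G L H C,Q A E P N G Z F H G C D I,Q A E P G E B G C D D E N,
 Q A E C J D F C E D I B P,Q A E G J I D E G D I B P,Q A A Z J G K F H G A A A,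
 Q A E L C K Z D H B I B P,Q A A H J M K F G H D E N,Q A E H F P D G D B C D I,
 Q A E C L D G D E C B C E,R F P [Q A E Z H I L E H G I B P,Q A E J N C K H C B A A A,
 Q A E J K B Z C F G D E N,Q A A J C K E B F D B C E,Q A E N P B L C H G D E N,
 Q A A C D N G C D H B C E]]),S (R D C [R B G [Q A F P K M I B C E D E N,
 Q A F K P I M B D E D E N,Q A B F P E M B C E M Z B,Q G Z F K E I B D E M Z B,
 Q A F F K B C B D F J B F,Q A F F P B D B C F M Z B],Q A B C D N G C D H B C E,
 Q A B C D M E C D E B C E,Q A A B D E M B D E B C E,Q A B C D P F C D G B C E,
 R G B [Q A F Z G P E H B C E K L,Q A F H Z G D H C B B C E,Q A B G H Z C C E H A A A,
 Q A B N D K B C H B A A A,Q A B H J G N G D B Z M D,Q A B P Z H D B H E A A A],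
 Q A B C D Z H C D F B C E,Q A A D B J Z D B G C D I]),Q A C D C J H C B H A A A,
 Q A G D B J Z D B G C D I,Q A C D C K F C B G A A A,S (R D C [Q A A B D E M B D E B C E,
 Q A C C D N G C D H B C E,Q A C C D M E C D E B C E,Q A B B D E M B D E B C E,
 Q A C C D P F C D G B C E,Q A B D B K P D B H C D I,Q A C C D Z H C D F B C E,
 R B I [Q A C G L H Z H F B A A A,Q D M C J D G D E B B C E,Q A G L J I M B F D K B G,
 Q A C C L G D B E D B C E,Q A G J C H N B G D D E N,Q A C Z N L B H B D A A A]]),
 Q A H D B K P D B H C D I,Q A H D B L N D B F C D I,Q A D D C L G C B F A A A,
 Q A A D C L G C B F A A A,Q A D B C Z H D B G B C E,Q A H B D Z J C B H C D I,
 Q A H B C Z H D B G B C E,Q A D B C P F D B H B C E,Q A H B D P K C B G C D I,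
 Q A H B C P F D B H B C E,Q A H B C M E D B E B C E,Q A H B D M I C B E C D I,
 Q A D B C M E D B E B C E,Q A H B D N L C B F C D I,Q A H B C N G D B F B C E,
 Q A D B C N G D B F B C E])"
definition cert21 where "cert21 = S (R F E [Q A A K B C F E B G B C E,S (R G E [Q A A E I C F E B C A A A,
 R B M [Q A A E Z F N E F C B C E,R B Z [Q A A F J G N E B H D M H],Q A A M C N E B E H A A A,
 Q A A Z D M E E B H A A A],Q A A P L D G E F H A A A,R G B [Q A A M I D F E B H A A A,
 Q A A E H L J B E D C E I,Q A A B H C N B E H A A A,Q A A C K J Z E F H K H G,
 Q A A C J K G E F C A A A,Q A A Z P L D B E D N H G],Q A A N C L M E B C I B F,
 R D B [Q A A K M I L E B D J I C,Q A A C K Z B B E G I F B,Q A A M C N E B E H A A A,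
 Q A A G M D L B D E I F B],Q A A D B K G E F C C E I,Q A A G C N B E B C A A A,
 Q A A E I C N E B C A A A,Q A A L P Z D E F G A A A,Q A A G C P B E B C A A A,
 R E M [Q A A H Z E F E F G A A A,R C Z [Q A A E F Z I E F G M Z D],Q A A F P M Z B C E A A A,
 Q A A P F H E E B H D M H,Q A A B H C N B E H A A A]]),
 S (R G B [R D P [Q A B F M D H E F C B C E,Q A B B G C J B E G A A A,Q A B D E K M E B H I H F,
 R B K [R B G []]],Q A B K F B G E F D D P H,R G Z [Q A B J G H D E B G B C E,
 Q A B I H D C E F H H I G,Q A B H J E I E F H A A A,Q A B I H M N E F H I H J,
 Q A B C M E B B E G A A A,Q A B Z P H M B E D N I G],Q A B B H C K B E H A A A,
 Q A B B H C N B E H A A A,Q A B B H C Z B E H A A A,R B F [Q A B K M E H E B D F I C,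
 Q A B H Z E F E F G A A A,Q A B G B D P B E H F M D,Q A B G P D E E B G B C E,
 Q A B L C F I E F D A A A],Q A B Z G J C E F C A A A,Q A B Z P I D B E D N H G,
 R D C [Q A B I D K P B E H A A A,Q A B E M K H E B C Z H G,R E Z [],Q A B Z D M E E B H A A A,
 Q A B P J Z N E B G P N D],Q A B H N M D B E C D P H]),Q A C F B L C B E C A A A,
 Q A C F B Z C B E C A A A,Q A C F B P C B E C A A A,S (R F P [Q A C B L F C E B G B C E,
 Q A C Z G C F E B D G N C,Q A C I G H F E F C G N C,Q A C N H I E E F C A A A,
 Q A C L B J F E B H B C E,Q A C E F K M E F G I K H,Q A C D E B I E F C A A A,
 Q A C P F I D E F H B C E,Q A C Z G J C E F C A A A,R B N [Q A C G I C N E F C A A A,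
 Q A C M I F Z B E H B C E,Q A C C H B N E B H A A A,Q A C B D E J E F G N J B,
 Q A C M P J N E B G A A A],Q A C K N M E E F D G N C,Q A C L E G K E F G A A A,
 Q A C J D M E E B C A A A,Q A C E F Z I E F G M Z D,Q A C E L Z G E F H A A A]),
 S (R D E [Q A D D E B I E F C A A A,Q A D B Z F J E B C B C E,Q A D P G I D E B H B C E,
 Q A D L Z M N B E D K Z B,Q A D B C G I E F C C E I,Q A D D E B M E F C A A A,
 Q A D B C G Z E F C C E I,Q A D H K G P B D E G P C,R E J [Q A D G J D L E B H B C E,
 Q A D L D G P B E C N J B,Q A C P Z K I G H E G P C,Q A D L B E J E B D G P C],
 R G L [Q A D D K L N B D E H K B,Q A D C F B J E B G A A A,Q A D H C G I E B C C E I,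
 Q A D H C G M E B C C E I],Q A D F Z I M E B H Z K B,R F G [Q A D M G F C E F G A A A,
 Q A D B F G N B E G H J B,Q A D D F B J E F G A A A,Q A D D M G Z B E C B C E,
 Q A D L B E J E B D G P C],Q A D G J D Z E B H B C E,Q A D M E C J E B D G P C]),
 Q A E K L G D E B H H I D,S (R D I [R F I [Q A E J D H G E B D F N C,Q A E B G C J B E G A A A,
 Q A E J E M D B E H A A A,Q A E I P F Z E F H A A A],Q A E G P D E E B G B C E,
 R E J [Q A E H E Z P B E H B C E,Q A E I H M N E F H I H J,Q A E K D L E E B D A A A,
 Q A E D B J G E F C C E I,Q A E J D H I B E D H L D,Q A E H P L Z B E H A A A],
 R B I [Q A E P F G L B D E H L D,Q A E E Z F J E F C B C E,Q A E G I B F B D E A A A,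
 Q A E G I B L B D E A A A,Q A E D B K G E F C C E I],Q A E D Z E G E B G A A A,
 R F D [Q A E E I K D B E G B C E,Q A E G B J D B E D H L D,Q A E Z K I N B C E H L D,
 Q A E C Z E P B E H A A A],Q A E G I C J E F C A A A,Q A E N E F D B E G A A A,
 Q A E D M G H B E C B C E,Q A E G I C N E F C A A A,Q A E J D N I B E D H L D,
 Q A E H C G M E B C C E I,Q A E D E N L E B H P H C,Q A E G I J M B E H H L D,
 Q A E C H B P E B H A A A]),Q A F F D I P B E G H M D,S (R B L [Q A F Z H L E E F H A A A,
 Q A F Z G L C E F C A A A,R E L [Q A F B Z F C E B C B C E,Q A F B G C M B E G A A A,
 Q A F D Z E G E B G A A A,Q A F J I L M B C E A A A,Q A F B C G I E F C C E I,
 Q A F B C G Z E F C C E I,Q A F D M G Z B E C B C E],Q A F F B K J E B D C E I,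
 Q A F G C L B E B C A A A,Q A F N H L E E F C A A A,Q A F D K G E B E G B C E,
 R F J [Q A F B G C I B E G A A A,Q A F M C G F B C E E D K,Q A F B H C P B E H A A A,
 Q A F Z C F E B E G A A A,Q A F P D N G B E C B C E,Q A F F C K E E B D L H D,
 Q A F L P H N B E H A A A],Q A F D E J P E B H L H G,Q A F J D L E E B C A A A,
 Q A F G I P D E F C L K C,Q A F K D L E E B D A A A,Q A F Z D L E E B H A A A,
 Q A F D B J G E F C C E I,Q A F D E B L E F C A A A,R G L [Q A F H I K G B E C D J C,
 Q A F C F B J E B G A A A,Q A F E L I C E F C K I D,Q A F G I C N E F C A A A]]),
 S (R F P [Q A G F P D H E F G B C E,R C B [Q A G G I C J E F C A A A,Q A C H D J G B E H B C E,
 Q A G N E B D B E G A A A,Q A G Z G P C E F C A A A],Q A G L P G I E F G A A A,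
 Q A G B G C Z B E G A A A,Q A G P F I D E F H B C E,Q A G J E L D B E H A A A,
 R D M [Q A G C J M E B E C K L F,Q A G M G F C E F G A A A,Q A G P E H F E F G B C E,
 Q A G B G C K B E G A A A,Q A G H Z K I B E H K L F],R H B [Q A G G P D C E B G B C E,
 Q A G B P E J E B C M G D,Q A G G P D E E B G B C E,Q A G B G C I B E G A A A,
 Q A G B G C K B E G A A A,Q A G P G I D E B H B C E,Q A G E P Z I E F H A A A],
 Q A G J D M E E B C A A A,Q A G M C N E B E H A A A,Q A G E F Z I E F G M Z D,
 R G D [Q A G P L B N B E G N F C,Q A G P L B J B E G N F C,Q A G K D L E E B D A A A,
 Q A G D F B P E F G A A A,Q A G N P F Z B E D A A A],Q A G G C N B E B C A A A,
 Q A G L P Z I E F G A A A]),S (R D M [Q A H M G F C E F G A A A,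
 R F I [Q A H B Z F C E B C B C E,Q A H L I E G E B D B C E,Q A H I M J C B E G J L B,
 Q A H M E F L B E G B C E],Q A H P E H F E F G B C E,Q A H F P D H E F G B C E,
 Q A H P E G F E F G B C E,Q A H J G I L B D E B C E,Q A H P F I D E F H B C E,
 Q A H C F B J E B G A A A,Q A H G M C J E F H A A A,R D J [Q A H M I J C E B G D K C,
 Q A H J H F E E F G A A A,Q A H C M B G B C E E D K,Q A H J F H I E F C A A A,
 Q A H C F B M E B G A A A],Q A H M F K I E F D A A A,Q A H H C G I E B C C E I,
 Q A H J D L P B C E L H D,Q A H C H B L E B H A A A,R F D [Q A H L C D P B D E G I F,
 Q A H J F G I E F C A A A,Q A H G J D L E B H B C E,Q A H M N D H B E H B C E,
 Q A H H C G M E B C C E I,Q A H C Z E P B E H A A A],Q A H H F G P E B D C E I]),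
 S (R B K [Q A I K C B E B E C A A A,R D I [Q A I D Z P H E F G F N C,Q A I D Z M E E F G G Z B,
 Q A I G Z N K B E H H P B,Q A I D E N L E B H P H C,Q A A H N D I E F G K B D],
 Q A I K C H E B E C A A A,R G H [Q A I B Z F C E B C B C E,Q A I H Z E F E F G A A A,
 Q A I Z H I E E F H A A A,Q A I D B J G E F C C E I,Q A I L P B M B E H C E I,
 Q A I L G D E B D E P Z J],R C G [Q A I Z H I E E F H A A A,Q A I G C L B E B C A A A,
 Q A I Z F C D B E D M G D,Q A C F D N J B C F J F N,Q A I P E C D B E H N G B,
 Q A I G C N B E B C A A A,Q A I P K G I B E H A A A],Q A D N M E G G C D C E I,
 R G D [Q A I K D F E E B D A A A,Q A I E L M B B E H C E I,Q A I L E B I B E G C E I,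
 Q A I G E H J B E D C E I,Q A I F K B N B E H B C E,Q A I D F B P E F G A A A],
 Q A I G J D L E B H B C E,Q A I L Z M N B E D K Z B,Q A I B C G I E F C C E I,
 Q A I L Z N M B E D K P B,Q A I D F B K E F G A A A]),Q A J F M D I E F C B C E,
 Q A J B K F I E B H B C E,S (R B M [Q A J C F B M E B G A A A,Q A J J M N P B C E A A A,
 Q A J J M N Z E F D M G B,Q A J Z F C K B E D M G D,Q A J J G N I E F D B C E,
 R E J [Q A J K D F E E B D A A A,Q A J F P D H E F G B C E,Q A J B G C Z B E G A A A,
 Q A J K D I E E B D A A A,Q A J Z D M L E F H C E I,Q A C M B F C H G E E D K],
 Q A J D E B M E F C A A A,Q A J B C G Z E F C C E I,Q A J G H I N E F H B C E,
 Q A J M C N E B E H A A A,Q A J P Z N I E B G B C E,Q A E B J G M H C E C E I,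
 Q A J Z D M E E B H A A A,Q A J E F Z I E F G M Z D,R E Z [Q A J B G C J B E G A A A,
 Q A J G E H J B E D C E I,Q A J E Z F J E F C B C E,Q A J G I C N E F C A A A,
 Q A J Z F M P E B D A A A]]),Q A K E K D B B E C A A A,Q A K E K D F B E C A A A,
 Q A K E K D L B E C A A A,Q A K E K D P B E C A A A,Q A K H F G J E B D C E I,
 S (R D M [R B K [Q A K K C B E B E C A A A,Q A K M F Z B E F D K B D,Q A K K C H E B E C A A A,
 Q A A I P C M F B G A A A],Q A K H Z N M B E C F J G,Q A K K M B Z E B G F J H,
 Q A K K F G L E B C A A A,Q A K P E H F E F G B C E,Q A K F P D H E F G B C E,
 Q A I Z J G D E C H B C E,Q A K P E G F E F G B C E,R G H [Q A F B I L H C H E K G D,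
 Q A K F L J P B D E A A A,Q A K D M G Z B E C B C E,Q A K M N P K E F G B C E,
 Q A K Z L M P B C E A A A,Q A K G J D Z E B H B C E,Q A K N C F B E F H K G D],
 Q A K K L G F B E H A A A,Q A K F D Z B E B C K G J,Q A K N E B D B E G A A A,
 R B P [Q A K G C P B E B C A A A,Q A K Z G N E E F G P H D,Q A K K E P C E F D N B G,
 Q A K C J B M B D E N B G,Q A K M L Z E E B D P Z D]]),Q A L E Z C L E B H A A A,
 S (R H D [Q A L J L D E B D E N B J,Q A L E Z F H E F C B C E,Q A L D Z E G E B G A A A,
 Q A L E I C H E B C A A A,Q A L M I N H E F H A A A,Q A L E Z F J E F C B C E,
 Q A J J M B P B F D B C E,Q A L D E B I E F C A A A,Q A L K M I L E B D J I C,
 R H P [Q A L C I J F E B H N B J,Q A L B Z F J E B C B C E,Q A L B C G I E F C C E I,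
 Q A L G C L B E B C A A A,Q A L N M J Z B D E A A A,Q A L P D E G B E C B C E],
 R G E [Q A L F M D H E F C B C E,Q A L J G M L B E C A A A,Q A B L P Z D G B F J M G,
 Q A L C I J G E B H N B J],Q A L D E B M E F C A A A,Q A L Z D M E E B H A A A,
 R H P [Q A L G K L D E B G Z L G,Q A L Z H I E E F H A A A,Q A L B Z F J E B C B C E,
 Q A J J M E G G C D C E I,Q A L B C G I E F C C E I,Q A L G C L B E B C A A A,
 Q A L C I J G E B H N B J],R B D [Q A L J M D N E F D A A A,Q A L M N L F B E H Z P C,
 Q A L C Z J K B E H D L B,Q A L G I C D E F C A A A]]),R D C [Q A M E F K M E F G I K H,
 Q A M L C N I E F D A A A,R E H [Q A M J G H M E B D F N H,Q A M P E H F E F G B C E,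
 Q A M N H I E E F C A A A,Q A M D E B I E F C A A A,Q A M Z B J L B E D M N H],
 Q A C J G F H B E G E D K,Q A D J G F H B E G E D K,Q A M B I K M E F H B C E,
 Q A M E F Z I E F G M Z D,Q A M L C N M E F D A A A,Q A M P D Z G B E C B C E,
 Q A H J G F H B E G E D K,Q A M P J Z N E B G P N D,R E D [Q A M L P H K E F D I B D,
 Q A M P L I N E F G A A A,Q A M Z C B E B E G A A A,Q A M D K N I B E C Z L D]],
 Q A M K B M F E B G B C E,R C N [Q A G J K P L D F H B C E,Q A I J K P L D F H B C E,
 Q A A J K P L D F H B C E,Q A H J K P L D F H B C E,Q A F J K P L D F H B C E,
 Q A M G E H J B E D C E I,Q A L J K P L D F H B C E,Q A M P B G F E B C B C E,
 Q A E J K P L D F H B C E,Q A M B H C N B E H A A A,Q A C J K P L D F H B C E,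
 Q A M P B J F E B H I N D,R H B [Q A M B G C J B E G A A A,Q A H C B H I G E B C E I,
 Q A A H Z C N B E G K Z F,Q A M E F Z I E F G M Z D],Q A M P B I E E B H J N C,
 Q A J J K P L D F H B C E,Q A M G F J E E F D N M J,Q A M P J Z N E B G P N D],
 R B I [R C H [Q A M D E J P E B H L H G,Q A M I M F H B E H A A A,Q A M C B F K E B G I F B,
 R C G [R B D []],Q A M H C J G E B D I F B],Q A M N H I E E F C A A A,
 Q A M E Z F J E F C B C E,Q A M I B M H E F D I H D,Q A M D E K M E B H I H F,
 R G L [Q A M K B D P E B C A A A,Q A M P D J N B E D H Z F,R B M [],Q A M B M L F E F G K I D],
 Q A M L B J F E B H B C E,Q A M C K L M E B G E D K,Q A M K B I P E B C A A A,
 Q A M K D I E E B D A A A,Q A M D E B I E F C A A A,Q A M J D L M E F H E D K,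
 Q A M D L K H E F C I N D,Q A M D B K G E F C C E I,R B J [Q A M J E I D B E H A A A,
 Q A M J E L D B E H A A A]],R H G [Q A M L H G J B E G E D K,Q A M G I C D E F C A A A,
 Q A M K D F E E B D A A A,Q A M B H C Z B E H A A A,Q A M B H C P B E H A A A,
 Q A M G I C J E F C A A A,Q A D L F B C C E D B C E,R D Z [Q A M H Z E F E F G A A A,
 Q A M G I L M B E H H J B,Q A M Z G H C E F C A A A,Q A M Z G J C E F C A A A],
 Q A B L F B C C E D B C E,Q A I L F B C C E D B C E,Q A M J D M E E B C A A A,
 Q A K L F B C C E D B C E,Q A M L K M J E B G N J C,Q A F L F B C C E D B C E],
 Q A M E Z C P E B H A A A])"
definition cert22 where "cert22 = S (R H P [Q A N K M E H E B D F I C,Q A N M G F C E F G A A A,Q A N F B L C B E C A A A,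
 Q A N M D F E E B G A A A,R H I [Q A N G B E N B E G D J C,Q A N G B D K B E G D Z F,
 Q A N J G H D E B G B C E,Q A N E C L M B E G G P B,Q A N Z G H C E F C A A A,
 Q A N G J D I E B H B C E,R D P [Q A N H N D M E F C F N H,Q A N B G C J B E G A A A,
 Q A N F Z M E B E C H I G,Q A A P B I L F G B C E I,Q A N M C L K E B C Z B F],
 Q A N M E B D B E G A A A,Q A N E M D J B E H A A A,Q A N Z G P C E F C A A A,
 Q A A B P H F E H C F N H],R D P [Q A A Z J B K H G E G I B,Q A N Z P G D E F D A A A,
 R C L [Q A N M L E C E F H B C E,Q A A Z G B C B D G E D L,Q A A H E P N C F D B C E,
 Q A A M D J Z E C D P L Z],Q A N F M D E E F C B C E,Q A N Z P G F E F D A A A,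
 Q A A B M F G G E B B C E,Q A N C H B I E B H A A A,Q A N G C J B E B C A A A,
 Q A A Z P F H E D C B C E,Q A N F M D I E F C B C E,Q A N K C F E B E C A A A,
 Q A N L F H B B E G B C E,Q A A Z M I L D G E A A A,Q A N Z P G K E F D A A A],
 R D Z [Q A N P B C F E B D B C E,Q A N G P D C E B G B C E,Q A N Z G H C E F C A A A,
 R B D [Q A N Z G H F E F C G L C,Q A A H E C K C F E D M Z,Q A A F E C L D E C A A A,
 Q A N M G D C E F G A A A],Q A N J K E C B E H I G D,Q A N C F K M E B H I G F,
 Q A A M I L B H B F G L C,Q A A M P E G E D G A A A,Q A N Z G L C E F C A A A,
 R C K [Q A N F M D E E F C B C E,Q A N D J G I B E H B C E,Q A N N I Z B B E D G L C,
 Q A A G P L K B E H A A A],Q A N D K G H B E G B C E,Q A N Z G P C E F C A A A,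
 Q A N F Z B D B E G B C E],Q A N M D G E E B G A A A,Q A A L I P J G H D G Z H,
 Q A A E L B I G F H I B G,Q A A M G F H B E D E D L,Q A A M P K Z D F B B C E,
 Q A N C I E N B E C A A A,Q A A H I D N G F B K G D,Q A N K C H E B E C A A A,
 R D N [Q A A L G I B G B C K I N,Q A N Z E D C E B G A A A,Q A N C N K D E F C A A A,
 Q A N J G H D E B G B C E,Q A N C N K G E F C A A A,Q A N E K C H E B G A A A,
 Q A N G F H Z B E D C E I,Q A N J L H K B E D B C E,R E F [Q A N M G D C E F G A A A,
 Q A N Z M L G B E H G Z F,Q A N I J F H B E D B C E,Q A N K G Z J B D E Z P F],
 Q A N M B I K E B H C E I,Q A A B P K M B D E L G H,Q A N D K G E B E G B C E,
 Q A N M E B D B E G A A A,Q A N K D L N E B D B C E,Q A N C M E B B E G A A A],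
 Q A A K P L M D F C E D L,R H N [Q A N C I Z N B E G D M C,Q A N C I N Z B E G D P B,
 Q A N L K H C E B H G J C,Q A N N E L Z B E C G K B,Q A N L K G D E B H H J D,
 Q A N J K E C B E H I G D,Q A N K C F E B E C A A A,R D B [Q A N L H J E E B C I J D,
 Q A N C I E J B E C A A A,Q A N K M I L E B D J I C,Q A N K C L E B E C A A A,
 Q A A G L B J D H C B C E],R F N [Q A A I L F K B F C L B F,Q A N K P L H E F D A A A,
 Q A N B H C L B E H A A A,Q A A B N J Z E H C C E I,Q A N B L Z I B E H P L C],
 Q A N C B M G E F C C E I,Q A A C D M I G B F E D L,Q A N C B N G E F C C E I,
 Q A N J E F P B E D L B F],Q A N G C L B E B C A A A,S (R B N [Q A N N L B J B E D A A A,
 Q A A I L B E G C F B C E,Q A N E P F M E F C B C E,Q A N C F B N E B G A A A,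
 Q A A L M E N E H B A A A,Q A A H M E J E F D E D L,Q A A K I E F H F E L J N,
 Q A N H D G P E B C C E I,Q A N I D N E E B C A A A,Q A N N L I J B E D A A A,
 Q A A L M E Z F C D C E I,R B J [Q A N N I E C E B H J B C,Q A N Z G E J E F C N M D,
 Q A A E P C B D H G A A A,Q A N J M N C E F G J H K,Q A N F D P N E F D E D L],
 Q A N Z B M F E B C B C E,Q A N C B M K E F G B C E]),Q A Z D B J G E F D C E I,
 Q A B E Z F N E F H B C E,R G E [Q A B N M J K B F D M G F,Q A B J B F P C B E E D L,
 Q A Z G P D E E B G B C E,Q A Z F M D H E F C B C E,Q A Z E M N G E B G B C E,
 Q A Z D B F L E B G J F B,Q A Z I F Z K B C E M G F,Q A Z D G B J E B H N F B,
 Q A Z E I C N E B C A A A,R G J [Q A Z J N Z I E F G A A A,Q A Z K C L E B E C A A A,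
 Q A Z C D G P B D E Z H D,Q A Z E F P J E F H N P G,Q A B C H P L F H E C E I],
 Q A Z K F M Z E F C A A A,Q A Z E I N Z E B H B C E,R D Z [Q A Z Z G F C E F C A A A,
 Q A Z L K G D E B H H J D,Q A Z M F G L E F G P N J,Q A Z D F H I E B G M G F,
 Q A Z E L D F B E C A A A]],Q A Z D F B M E F G A A A,R D J [Q A Z E K C D E B G A A A,
 Q A B I E C B E C B A A A,Q A B P F D B E G F B C E,Q A B C F K M H G E B C E,
 Q A B K M Z D B G C M N Z,Q A Z P D G E E B H A A A,Q A Z E K F H E F G B C E,
 Q A Z P H F Z E F G C E I,Q A Z E K F G E F G B C E,Q A Z B H C Z B E H A A A,
 Q A Z K Z J M E F G I B D,Q A Z K C J N E F D B C E,Q A B M K I N B G F I B P,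
 Q A Z G C P B E B C A A A,Q A Z K C Z N E F D B C E],R E F [Q A B L F I K F B C D L F,
 Q A Z Z B C F E B C B C E,Q A Z M G D C E F G A A A,Q A B N F Z J H D C G I F,
 Q A Z E K N I B D E G K F,Q A Z J G H D E B G B C E,Q A B M E D J C E H E D L,
 Q A B B M D E E C H E D L,Q A Z Z B J F E B C B C E,Q A B J M B Z B E D A A A,
 Q A Z K E L C E B H A A A,Q A Z P Z L M E B G A A A,Q A Z F C P J E B G N B F,
 Q A Z Z B M F E B C B C E,Q A B M Z B L B C F A A A,R C J [Q A B E L D G D F E M Z N,
 Q A Z M H F E E F C A A A,Q A Z L K H C E B H G J C,Q A Z L K G D E B H H J D,
 Q A Z D J G L B E H B C E],Q A Z L B M C E B G Z P F],R E K [Q A B N M Z G D H G C E I,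
 Q A Z P B C F E B D B C E,Q A Z B G C N B E G A A A,Q A Z P D G E E B H A A A,
 Q A Z P K L J B D E N B D,R G Z [Q A Z L B C F E B G B C E,Q A Z I E N Z B E H F M C,
 Q A Z J G H D E B G B C E,Q A Z I H J K B C E A A A,Q A Z M C N L E F H A A A],
 Q A Z C H B I E B H A A A,Q A Z C I E J B E C A A A,Q A B I K B Z G H D C E I,
 Q A Z G J D I E B H B C E,Q A Z D K G H B E G B C E,Q A Z B J E C B E C N B D,
 Q A Z P B F G B E H N B D,Q A Z P B N F E B D B C E,Q A B K F B C C E D B C E,
 Q A B N C D G D B F B C E],R B F [Q A Z M E F K B E G B C E,Q A B M B E G B G C B C E,
 Q A Z E I C F E B C A A A,Q A Z Z D I P E B C N H F,Q A Z M H F E E F C A A A,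
 Q A B J M E C C D H B C E,Q A Z Z G F C E F C A A A,Q A Z E I Z L B E G F M C,
 Q A B P F D B E G F B C E,Q A Z E I P K B E G F N D,Q A Z G P D E E B G B C E,
 Q A B E K D L G B D N H F,R F L [Q A Z F M D H E F C B C E,Q A Z B G C K B E G A A A,
 Q A B Z B F H F E H C E I,Q A B D L E B F D E K P B,Q A A I G B M D F H C E I]],
 Q A Z D B P G E F D C E I,Q A Z D M E N E B H A A A,Q A Z P D E G B E C B C E,
 R F N [Q A B K J H B D C G A A A,Q A Z G I C D E F C A A A,Q A B C H K J C H D E D L,
 Q A Z J K P E B E H Z H G,Q A Z Z H G K B C E A A A,Q A Z F N P G E B G B C E,
 Q A Z C F K M E B H I G F,Q A Z Z B J F E B C B C E,Q A B Z M I L D G E A A A,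
 Q A B D P H N G D C K I H,Q A Z D E B K E F C A A A,Q A Z J M N Z E F D M G B,
 Q A A C P F B C E B B C E,R D Z [Q A B H Z B C E D G D N H,Q A Z E D J B E F D P F C,
 Q A Z L K G D E B H H J D],R C J [Q A B J K C Z G B D I J D,Q A Z D J G L B E H B C E,
 Q A Z B E M C B E C P L C,Q A Z E M D J B E H A A A,Q A B D B N J B D G P L C]],
 Q A Z D B M G E F D C E I,Q A Z D M E Z E B H A A A])"
definition cert23 where "cert23 = S (R B Z [Q A P Z C B E B E G A A A,Q A C E N B Z G F C Z B F,Q A P P H Z E E F G A A A,
 Q A A K G E D B G C E D M,Q A A E I F P E F C B C E,Q A C K I M P D G C A A A,
 Q A P Z C F E B E G A A A,S (R C M [Q A A Z H G L H C D Z F N,Q A P Z D F M B E D A A A,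
 Q A P F B M C B E C A A A,Q A A H Z B F G B D B C E,Q A P J E H F E F G B C E,
 Q A P D M E G E B C A A A,Q A P C D K M E F G I M B,Q A P D J G Z B E H B C E,
 Q A C N D F P H F D J M G,Q A C P I E K F C B C E I,Q A P D F B J E F G A A A,
 Q A A I E C B E C B A A A,Q A C N I M L D F C E D M,Q A P D M G Z B E C B C E]),
 Q A D L I E N F H B B C E,Q B A I H Z E E F H A A A,Q A D K G F H B E H E D M,
 Q B A P D E G B E C B C E,R B K [Q A B N G Z M G H D C E I,Q A B P H L N F H G A A A,
 Q A B P D G E H G E A A A,Q B A J H I E E F G K F H,Q A D M L E K E H B A A A,
 Q B A N I K Z E F D A A A,Q A D D B F P G C B Z G N,Q B A I D K E E B H A A A,
 Q A D E G I N D B E A A A,Q A B P M I K G D C A A A,Q B A J B L F E B C B C E,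
 Q B A Z H M I E F H C E I,Q B A D E B K E F C A A A,Q B A Z E N I B E H K Z L,
 Q B A D C I Z E F H K P B,Q A D P D H B G C D E D M],S (R H P [Q B A N J G Z E F H A A A,
 Q A D M N J L G H C G M F,Q A B L D E F G H C B C E,Q B A H Z B D B D E A A A,
 Q A B M N J Z F E C H N F,R F M [Q B A G P D C E B G B C E,Q B A B H C K B E H A A A,
 Q B A P G I D E B H B C E,Q B A N E K F E F H B C E],Q B A C I E N B E C A A A,
 Q A B C K E L B E D A A A,Q A B M B E Z G C F E D M,Q A B I K E F D E B C E I,
 Q B A D F B M E F G A A A,Q B A M D L J B C E Z H D,Q B A D M G L B E C B C E,
 Q B A Z N H M B E D A A A]),Q B B Z C H E B E G A A A,R C B [Q B B Z B L H E F G J B C,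
 Q A C F N E P B F D E D M,Q B B L E D G B E G K B D,Q A E D H C L H C D E D M,
 Q B B L E B D B E G A A A,Q B B F C J P E B H L B G,Q B B N J M Z E F G A A A,
 Q A C H B C M E D C Z H K,Q B B C M E B B E G A A A,Q A C H L E J E F D E D M,
 R G D [Q B B N G B I B E C A A A,Q B B D M E G E B C A A A,Q B B P C M K E F C B C E,
 Q B B G P D C E B G N B G],Q B B F C N L E B H P B C,Q B B N J Z L E F G P B D,
 Q B B Z G P C E F C A A A],Q B B H D G M E B D C E I,S (R H J [Q B B K M C B E B D D I C,
 Q A E D N H G B C E D N H,Q B B M G D C E F G A A A,Q B B J B G F E B C B C E,
 Q A C N D H F F C D C E I,Q A C P D G E H G E A A A,Q A E L J H N G B E E D M,
 Q B B N E K F E F H B C E,Q B B N J F K E B D Z K B,Q A E J K Z I E D C M H C,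
 Q A C P H N J D E C E D M,Q A A K J E L B C G E D M,Q B B D M G N B E C B C E]),
 Q B C D E B Z E F C A A A,Q A D K G F E B H E E D M,Q B C B I F P E B C B C E,
 R H D [Q A F F J D N F G H G K P,Q B C E G L H B E D C E I,Q A F I C G B E B D B C E,
 Q B C P J H K B C E Z L D,Q B C C I E B B E C A A A,Q B C G M C J E F H A A A,
 Q B C K M I L E B D J I C,Q B C D E B J E F C A A A,Q A F G F I B F H D Z L D,
 Q B C I D K E E B H A A A,Q A A L H D C G E D A A A,Q A D I E C B E C B A A A],
 Q B C C Z E L B E H A A A,R E G [Q B C F Z G K B C E A A A,Q A F K P G N H E F B C E,
 Q A D I K G D E C D B C E,Q B C F D I P B E H H M G,Q B C J E G F E F G B C E,
 Q B C P F I D E F H B C E,R C J [Q B C I C P L B E C B C E,Q B C H P L J B E H B C E,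
 Q A D D H B Z G F E Z L K,Q B C N C J F E B D L J H],Q B C F C J P E B H L B G,
 Q B C Z G L C E F C A A A,Q A D N E I Z F C G Z L K,Q A F E F K J G C F N B G,
 Q B C P L N Z E B G A A A,Q B C Z G P C E F C A A A,Q B C P E N D B E H A A A],
 R F J [Q A C E Z C B E D C D I K,Q B C I D B M E F G C E I,Q B C N B C F E B H B C E,
 Q A F E I G N F B C C E I,Q B C B H C P B E H A A A,Q B C C D K M E F G I M B,
 Q A F C M I H B G E C E I,Q A D F J D L G F E K G D,Q B C L Z C P B D E A A A,
 Q B C J B P F E B G L K C,Q B C N M K P E B G L P C,R E L [Q B C B H C K B E H A A A,
 Q A D L M I N G F C E D M,Q B C D M G L B E C B C E,Q B C Z D J L B E D M N F],
 Q A F K J M L H G F P F G,Q B C P E N D B E H A A A],R C K [Q B C E K C D E B G A A A,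
 Q A D F P G Z F E H C E I,Q B C P H F E E F G A A A,Q B C L P G Z B E H Z M B,
 Q B C E K C F E B G A A A,Q A F F L E J B H D F K Z,Q B C B G C K B E G A A A,
 Q B C E K C H E B G A A A,Q B C B H C K B E H A A A,R B D [Q B C J B C F E B C B C E,
 Q A D C M B L D C E Z M B,Q B C Z E D C E B G A A A,Q B C M G D C E F G A A A],
 Q B C B I F K E B C B C E,Q A B D H F I H F G Z M B,Q B C D F B P E F G A A A,
 Q B C B I F Z E B C B C E],Q B C P D Z G B E C B C E,Q B C B E G M E F C C E I,
 Q B C D M E Z E B C A A A,Q A D K I M P D G C A A A,Q A F K J M I D F E B C E,
 Q B C P D N G B E C B C E,Q B C C Z E P B E H A A A])"
definition cert24 where "cert24 = S (R H J [Q B D K M C B E B D D I C,S (R E F [Q A G C G B Z C G H C E I,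
 Q A G I Z J L G C F B C E,Q A E F M E Z B F D E D N,Q A E I L J Z D C F D L B,
 Q B D P G I D E B H B C E,Q B D M I J H E B D D L B,Q A G B E M P H D C D L B,
 Q A E N M F G G E B C E I,Q A E J N F K G C D L G F,Q B D K E L C E B H A A A,
 Q A G Z K J C D G H A A A,Q B D Z C H E B E G A A A,Q B D I B P F E B C B C E]),
 Q B E M G D C E F G A A A,Q A H N Z J P G H D G I H,Q B E K D G E E B G A A A,
 Q A B J H E G E B H C E I,Q A F K N Z P F B H G Z B,S (R G F [Q B E I H K L E F D I G H,
 Q B E G I C D E F C A A A,Q B E M B C F E B H B C E,Q B E I G H L B C E A A A,
 Q B E I H G K B E C A A A,Q A B N B F G E F C C E I,Q A F K N C L D G B H P K,
 Q A B B M J K B D E I G H,Q B E K C H E B E C A A A,Q A F H B P L F E D K L Z,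
 Q B E K C P M B C E I G H,Q A B M N E H C G B A A A,Q B E N E M D B E D A A A,
 Q B E F M N K B D E I G H,Q A F G M Z L B C F Z K P,Q B E E B M G E F C C E I,
 Q B E N B P F E B G B C E]),Q B F D E K M E B G I H G,Q B F K D I E E B G A A A,
 R D J [Q A C Z I H N H B F D K B,Q A G I M K P F D B C E I,Q B F I B C F E B C B C E,
 Q A G F P G Z F E H C E I,Q A I B P G F G C H B C E,Q B F J H F E E F H A A A,
 Q B F E C L M B E H G P F,Q B F Z C G H B C E G P K,Q B F Z C H G B C E G P L,
 Q B F J F H I E F C A A A,Q A G H P G K B H E H Z G,Q B F J H M E E F H A A A,
 Q A A C I M B B G C A A A,Q A G M C G B C G H C E I,Q B F Z C H E B E G A A A,
 Q A C M K E D C E H E D N,Q B F J H P E E F H A A A,Q B F G C P B E B C A A A],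
 Q B F K C B E B E C A A A,Q A G P D G E H G E A A A,Q B F P F L D E F H B C E,
 R C J [Q A G C I B Z D C H K I L,Q B F M G F C E F G A A A,Q B F N I M C E F H G J C,
 Q B F B G C J B E G A A A,Q A G Z D F J B F G E D N,Q A C E N F G E F D B C E,
 Q B F D J G L B E H B C E,Q B F F D Z C E F D K I L,Q A G M B E H B H C A A A,
 Q B F G I B K B E C M J D,Q A I D G B N E F H B C E,Q B F M J L K B E D N J B,
 Q B F P H N B B E G N J C,Q B F C D P J E F H N J G],Q B F D F B K E F G A A A,
 Q A C H Z D C H E B L B D,Q A C N Z J M H G D L F H,Q B F D E J P E B G L H F,
 Q A C K N Z M H B F L Z M,Q A I H Z D L G F B M G D,Q B F D E Z I E B G M H C,
 R D I [Q B F J B C F E B D B C E,Q B F P M E N E B D B C E,Q B F G P D E E B G B C E,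
 Q A I M L C B D G E F N K,Q B F G I C F E F C A A A,Q A C I N D H D F C C E I,
 Q B F M H Z P B E D A A A,Q A G G L F P C E D J B F,Q B F I F D B B E H B C E,
 Q A I M N E K C H B A A A,Q B F G I C N E F C A A A,Q A I N B Z L D H B Z G F,
 Q A I J F C G H C G B C E,Q B F G I C P E F C A A A],Q A C F I B C D E B N B F,
 Q B F M J H G B E D N F B,Q B F G C N B E B C A A A,Q B F E I C N E B C A A A,
 Q B F D M G N B E C B C E,R H L [Q B F J M C B E F D D J B,Q A G I M K P F D B C E I,
 Q B F J M H E E F D G M B,Q B F N M H C E B H G P C,Q B F C I E J B E C A A A,
 Q A C H Z C N G F C Z B G,Q A G E G H J G D B A A A,Q A C E I G D F B C C E I,
 Q B F B G Z K E B C A A A,Q B F E B I G E F C C E I,Q B F B N F L E B H B C E,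
 Q B F J M Z N E F D P F B,Q B F G C P B E B C A A A,Q A G G F H L F B C P H D],
 Q A C P D G H C E D C E I,R F M [Q A G F P G Z F E H C E I,Q B F G P D C E B G B C E,
 Q B F L F P N E F C Z G B,Q A G L B F M C B G E D N,Q A I P D G B E F H A A A,
 Q B F C J M I E B C Z G B,Q A B K E J M C F G A A A,Q B F P G I D E B H B C E,
 Q B F G H Z K E B D A A A,Q A C L M F G F C B E D N,Q A C C F B P E D B Z G B,
 Q B F B P M E B E H Z G B,Q B F Z D P E E B C A A A],Q B F J B P F E B D B C E])"
definition cert25 where "cert25 = S (R H K [R H J [Q A J B D H M D H B E I D,Q A J B C H K D E C E I D,Q B G J C F E B E C B C E,
 Q B G E D K B E F C C E I,Q B G K C B E B E C A A A,Q B G K D N G B E G A A A,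
 Q A J P N J Z H B C L P N,Q A J L C M N F G E D G P,Q A J C H M E E G F A A A,
 Q A H I C G F H B D B C E,Q B G D M G N B E C B C E,Q A H D G M L B C E C E I,
 Q B G C Z K H E B C E I D],Q A A B F C K B E D B C E,Q A H P K M I F G E C E I,
 Q B G Z E D C E B G A A A,Q A J C H E N C D F F B Z,Q B G F B Z C B E C A A A,
 Q A J C B G L C B F B C E,Q A H N K G C E G F C E I,Q A H B C H P D H C E I D,
 R F M [Q A A C H E Z C D H F B J,Q B G G P D E E B G B C E,Q B G L B I G E F C A A A,
 Q A J P D G B E F H A A A,Q A H B E G K D B H C E I,Q B G B H C K B E H A A A,
 Q B G N G J M B E C E I D,Q B G P G I D E B H B C E,Q A H P D G E H G E A A A,
 Q A A N H L D F G E E I D,Q A D L I J M C D G I D B,Q A A N K G C E G F C E I],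
 Q A D K P H D G D E A A A,Q A H K C F B E B G B C E,R B M [Q A H C G I F D E G M B F,
 Q A J P K M I F G E C E I,Q B G C M E D B E G A A A,Q A A L M G D E C B C E I,
 Q B G K Z N B B E G C E I,Q B G J M N Z E F D M G B,Q B G I M Z B B E D E I D,
 Q B G L B M I E F D A A A,Q A J K B G J F G H M H N,Q A H M E K D C H E I J L,
 Q B G M C L E B E H A A A,Q A A H N M P H E F C E I,Q A D G F C L H E F A A A,
 Q B G I M G B B E D E I D],Q B G N I J D B E G J B C,Q B G F N K Z B E G E I D,
 Q B G D F B J E F G A A A,Q B G E Z C J E B H A A A,R C G [Q B G G H M Z B E G E I D,
 Q A D D Z E F H F G L D C,Q A H N J H C H G F H G J,Q A A K N M Z F E H E I D,
 Q A H C E I D B C E A A A,Q B G J D H F B E D L D C,Q B G L J D G B E D A A A,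
 Q B G J M N Z E F D M G B,Q A D K P G E H E F B C E,Q B G Z D J G E F G L D C,
 Q B G K G B F B E C L D C,Q B G L F P G E B H L D C,Q A J E P F I C D F E I D,
 Q A D E P F I C D F E I D],Q A J N H L D F G E E I D,Q A D H N M I H E F C E I,
 Q B G E Z C L E B H A A A,Q A A K P H L F D H A A A,Q B G L M N E E F G A A A,
 Q A A L H N C F D B E I D,Q B G D M G Z B E C B C E,Q A J D G M L B C E C E I,
 Q B G P D B G B E C B C E,R H J [Q B G B D E L B D E A A A,Q B G G H M Z B E G E I D,
 Q B G H C D J B E C D L B,Q A J B D H M D H B E I D,Q B G G P H L B E C B C E,
 Q B G F J L G B E C H P B,Q A J C E I D B C E A A A,Q A D D P K N D C G E I D,
 Q A D F D K N C D H C E I,Q B G K C B E B E C A A A,Q A H P D G E H G E A A A,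
 Q B G D F B K E F G A A A,Q A H N Z J M H G D L F H,Q B G P Z I C E B D M H C],
 Q A J I D M J F B C E I D,Q A A K C F B E B G B C E,Q B G G L M D B E C E I D,
 Q B G E Z C P E B H A A A])"
definition cert26 where "cert26 = S (R B G [Q B H L I F C E B H E J C,Q A I B F G M D C E C E I,Q A B B F G J D C F C E I,
 Q A K N H G E E B D C E I,Q A I Z L G E E H G A A A,S (R C G [Q B H J G E I E B G A A A,
 Q A I L J G H H C D A A A,Q B H F N L P B E G E J C,Q A B J L G B C D F C E I,
 Q A K H M G J B F G G D Z,Q B H P F L D E F H B C E,Q B H L B G Z E F D E J C,
 Q B H J G E M E B G A A A,Q A K L B N D G F H M G H,Q A E K P G E H E F B C E,
 Q A K D P G C B E D C E I,Q B H G J Z E E B H A A A,Q A B J N G I F D C B C E,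
 Q A I N J G Z D C H A A A,Q A E F P G C F E H C E I,Q A K N J G D D C H A A A]),
 Q A J D B G Z C D H A A A,Q A L D B G N C D H A A A,Q A F D B G K C D H A A A,
 Q A L K H G C E D B E J C,Q A J F B G P C H D A A A,S (R B D [Q B I B D E P B D E A A A,
 Q B I J G E D E B G A A A,Q A L L J G M H C D A A A,Q B I G H N Z B E G E J C,
 Q A J P M E C E C D C E I,Q B I E K C D E B G A A A,Q B I G D I K B E G A A A,
 Q B I H B C P B E G D L B,Q B I C H J K B E G B C E,Q A L B G D Z B F H A A A,
 Q B I F M D C E F C B C E,Q A C F H D I C F B D P H,Q B I J P E D E B H A A A,
 Q A C J E G H G D B B C E]),Q B J Z D F C E F G E J C,Q B J B G C I B E G A A A,
 Q A K P M G C E G H A A A,Q A G F B G N C H D A A A,Q B J F P D H E F G B C E,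
 Q B J B G C K B E G A A A,Q A M F J D N F G H G K P,Q B J J M H E E F D G M B,
 Q A A B E C J B E C A A A,Q B J B G C M B E G A A A,Q A D K J M Z F E H G M P,
 Q A M F B G K C H D A A A,Q B J B G C N B E G A A A,Q A M D Z G M F H E E J C,
 Q A D B D G I D F C E J C,Q B J B G C Z B E G A A A,Q A D N I L P F H E G Z L,
 Q A M D I F K F H G G Z N,Q A K B D G L D E C E J C,Q A B B E C J B E C A A A,
 Q A M F P G L F E H C E I])"
definition cert27 where "cert27 = S (R B G [Q A N B F G P D C H C E I,Q A H B F G K D C G C E I,Q A E B F G J D C F C E I,
 R B D [Q A H E Z C B E D C D I K,Q B K N L E D E F D A A A,Q A N M N G Z H D C G D J,
 Q B K N D G H E B D E J G,Q B K E K C D E B G A A A,Q B K L N C F E F D D L C,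
 Q A H E B C J C E B B C E,Q A H I E C B E C B A A A,Q A E B G C N D H B E J G,
 Q B K L D G H E F H E J G,Q B K G P D C E B G B C E,Q B K E B H L B E C C E I,
 Q A N N B H E E C B G D J],R D M [Q A E J P C Z H B D A A A,Q A L P G I E F H G G D K,
 Q A D Z K F D E G H C E I,Q B K L J F G E B D B C E,Q A D P G E B E D C A A A,
 Q B K C F B J E B G A A A,Q A D Z H L B G F E K G B,Q B K H C E I E B C C E I,
 Q B K Z D P J E B C L H F,Q A L G P Z L H G E B C E,Q A E L P J D D E G A A A,
 Q A N G P Z N H G E B C E],Q A H F N G E E F C A A A,Q A L D B G Z C D H A A A,
 Q A E D B G J C D H A A A,Q B K H C K B B E D G I B,R H M [Q B K K F H E E B D B C E,
 Q B K B D F I B C E F K D,Q B K L H F G E B G B C E,Q A E D P I N H D B C E I,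
 Q B K L I G M E F G E J G,Q A L E P C H D C F J L Z,Q B K G L I K B E C A A A,
 Q A H E J G I B C E E J G,Q B K Z C F E B E G A A A,Q B K Z C H E B E G A A A,
 Q B K C Z E L B E H A A A,Q B K C Z E P B E H A A A],Q A L Z D I B F E D G I N,
 Q B K B G C I B E G A A A,Q B K H C I D B E D G K B,Q B K F P D H E F G B C E,
 Q B K B G C K B E G A A A,Q A N F J D N F G H G K P,Q A E K P G Z H E F B C E,
 Q A E B F H M B G D B C E,Q B K N F G C E B H E J G,Q B K B G C M B E G A A A,
 Q A H B F H M B G D B C E,Q B K B G C N B E G A A A,R G K [R B F [Q B K E K C F E B G A A A,
 R B H [Q B K B H C I B E H A A A,R B I [S (R B J [U Z E B C E I B C E A A A]),
 Q B L I H J K B C E A A A,Q A A B G D L B F H D G M,Q A A B F H M B G D E J G]],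
 Q B L F B M C B E C A A A,Q A I M H F B E D G B C E,Q B L N C E D E B G F P C,
 Q A M P J L M F C D E J G],Q B L M G D C E F G A A A,Q A M C H E L C D G F B L,
 Q B L F B L C B E C A A A,Q B L G D N K B E G E J G,Q B L G D N P B E G E J G,
 Q B L J F N L B E H B C E,Q B L G M C J E F H A A A,Q B L K M I L E B D J I C,
 Q A F K D G N C E F C E I,Q A E P C H B E B H B C E,Q B L P G Z K E B D M L B,
 Q A M K J M C D F E B C E],Q A Z B E G P B G C A A A,Q A M B F H M B G D B C E,
 Q B L B G C Z B E G A A A,Q A M L D N H F G B G Z L,Q B L H C N G B E D G P B,
 Q A M B E G P B G C A A A,Q A Z F P G L F E H C E I])"
definition cert28 where "cert28 = S (R B E [Q A A D F M N B D E B C E,Q A A D F M Z B D E B C E,Q A A D F M I B D E B C E,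
 Q A A D F M L B D E B C E,cert21,cert22,cert23,cert24,Q A A B D F P B D F B C E,
 Q A D B D F P B D F B C E,Q A H B D F P B D F B C E,Q A J B D F P B D F B C E,
 Q B G C E I J B C E A A A,Q B G C E I L B C E A A A,Q B G C E I N B C E A A A,
 Q B G C E I P B C E A A A,cert25,Q B H B E C I B E C A A A,Q A A J I E C E C B A A A,
 Q A A Z P F D E G F B C E,cert26,cert27,Q A A B D F P B D F B C E,
 S (R H F [Q A G K J M Z F E H G M P,Q A G B D F Z D F E G N Z,Q A P B D F I D H G G Z N,
 Q A P Z B L C G F H I B M,Q A P M P K E D F B B C E,Q B M C H B I E B H A A A,
 Q A A I J M Z B E D I M B,Q A N P F D B E G F B C E,Q A J P M G E G E F A A A,
 Q B M C N K E E F G A A A,Q B M K C N E B E C A A A,Q A G K B E D B F C A A A,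
 Q B M E L J B B E C A A A,Q A N I D G P E H C E J L,Q B M C H B L E B H A A A,
 Q A G I E C B E C B A A A,Q A P P K M I F G E C E I,Q B M L E F N E B D B C E,
 Q A A E K P M G F E B C E,Q B M L J M E E B D A A A,Q A J E K P M G F E B C E,
 R G E [Q A G I C G H G B D B C E,Q B M E I C H E B C A A A,Q B M P F B C B C E C E I,
 Q A J M Z I D D F E C E I,Q B M B L I F E B G B C E,Q A P M Z K N H B C J Z K,
 Q B M I M L N E F G A A A,Q A N M Z K L E B C L Z K,Q B M G J D N E B H B C E,
 Q A N M C E J C E F A A A,Q A P M C E J C E F A A A,Q B M J M Z N E F D P F B,
 Q B M E I C P E B C A A A],Q A N M D G N C E B C E I,Q B M C H B N E B H A A A,
 Q A P K F B H C F D B C E,Q A P J C G H G B D A A A,Q B M C H B Z E B H A A A,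
 Q B M P D Z G B E C B C E,Q B M G M C P E F H A A A,Q A G N J G F D C F A A A,
 Q B M K M Z N E B D P I C,Q A J P Z L J B E D P L B,Q A A J E L M C B E E J L]),
 Q A A B D F P B D F B C E,S (R D E [Q A D Z D E B E F C A A A,Q A Z C H E L C D G F B L,
 Q A K C H E I C D E F B M,Q B N N K F B E F D E K D,Q A H C B G Z C B F B C E,
 Q B N G D Z J B E H E K D,Q A G G Z M J E B G I M B,Q B N D E B I E F C A A A,
 Q A B L E D F F H B A A A,Q A A L K N F E G D E K D,Q B N P G I D E B H B C E,
 Q A B Z N K I F E D E K D,Q B N K E B D B D E A A A,Q B N E K D F B C E A A A,
 Q B N E K D L B C E A A A,R B G [Q A K B F G K D C G C E I,Q B N C D J N E F G L P C,
 Q B N C B J N E F H L P C,Q A K D B G K C D H A A A,Q A K E N G Z B C H G J H,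
 Q B N K J E G E B D A A A,Q B N J G H D E B G B C E,Q B N Z N E G E F D A A A,
 Q A H N J K P F H B G M J,Q B N B G C M B E G A A A,Q A Z K B H D B F G B C E,
 Q B N B G C N B E G A A A,Q A G F I B L D E G L P C,Q A Z F P Z M H D B G Z N],
 Q B A D M G B D F E L P F,Q B N D E B L E F C A A A,Q B N Z F G P E B D E K D,
 Q A B L B N Z E D C M I F,Q B N D E B M E F C A A A,Q A Z Z D E B E F C A A A,
 Q A A Z D E B E F C A A A,Q A G Z D E B E F C A A A,Q A A I E C B E C B A A A,
 Q A H J G F L B G E E K D,Q B N D M G L B E C B C E,Q A H J K P C D F H B C E,
 Q A G P B E D B F C A A A,Q A B I G E L G E B A A A,Q B N G J D Z E B H B C E,
 Q B N N K F L E F D E K D]),Q B Z B E C K B E C A A A,Q A B N F D M C D E B C E,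
 S (R E C [Q B Z K M C B E B D D I C,Q A B I M K P F D B C E I,Q A L P E Z G F B G C E I,
 Q B Z P Z D E E F H A A A,Q B Z K M E H E B D F I C,Q B B I E C B E C B A A A,
 Q A P K N P J F C G F N C,Q A L I H F B E D G A A A,Q A C I E C B E C B A A A,
 Q A P P F L D F D E E K L,Q A B N C E F G B C A A A,Q B Z L F E C E B H G P C,
 Q A H J B C E B C E A A A,Q B Z G C J B E B C A A A,Q B Z K M I L E B D J I C,
 Q A A M G P Z F C B B C E,Q B Z K C B E B E C A A A,Q B Z K C F E B E C A A A,
 Q B Z K C H E B E C A A A,Q B Z K C L E B E C A A A,Q B Z G C L B E B C A A A,
 Q A I P J K C B F C L P C,Q A H I E C B E C B A A A,Q A A I E C B E C B A A A,
 Q B Z N I G J B D E M H C,Q B Z B Z M E E F G A A A,Q A B L K M D E D C C E I,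
 Q B B D J G E D F C Z P C,Q B Z N L B P B E G P F C,Q B Z G C P B E B C A A A,
 Q A I K I F Z E C F B C E,Q A C L C E D F B C A A A]),S (R B I [Q B P F L K M E B C I B D,
 Q B C F M E P B G D E K N,Q A J M F B G C H D B C E,Q B P Z J E I E F G A A A,
 Q B P J D B G B E G B C E,Q A M M P F N D H B C E I,Q B P C I E D B E C A A A,
 Q B C F I G C E G B C E I,Q B C N F Z B H E C C E I,Q A D B F P H G B E I F H,
 Q A M N L D J G H C I F L,Q B A M F B G C H D B C E,Q B P C F B I E B G A A A,
 Q A D F Z N P H C B E K N,Q B C D J Z P H D F A A A,Q B P C H B I E B H A A A,
 Q A B P Z N H H G C E K N,Q B C M P F H D H B C E I,Q B P C I E J B E C A A A,
 Q B P J K I E E B H A A A,Q B P D J G L B E H B C E,Q A J F M E C B G D E K N,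
 Q B P D J G Z B E H B C E,Q A B N P K D E H F C E I,Q A A M C K B C H G C E I,
 Q B P D I K G E F H C E I,Q A M M F B G C H D B C E,Q A J J E Z M G B F C E I,
 Q B P H Z I E E F G A A A,Q B P C I E P B E C A A A,Q A B N P L M H B C I P L,
 Q A C N M K C E H G C E I]),S (R E N [Q C A F Z D E E F G A A A,Q A B B D E N B D E A A A,
 Q C A F M D C E F C B C E,Q B B D H F N C B E F H N,Q C A F E M K B E H A A A,
 Q A E L I N J G H E F Z N,Q C A F M D I E F C B C E,Q A J C N J I C H B J M N,
 Q C A E Z C J E B H A A A,Q A E D K E B C B H A A A,Q C A C F B K E B G A A A,
 Q C A K E N P B D E A A A,Q A N I N G P D B G B C E,Q A C P K M I F G E C E I,
 Q A J P F D B E G F B C E,Q A C P F D B E G F B C E,Q A C E K D P C H G B C E,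
 Q C A C M E D B E G A A A,Q A E M E B L B G F A A A,Q C A N F J L B C E B C E,
 Q A B L J N M E B C M J N,Q A J L B P J G D H C E I,Q B B D N F K E G H E K P,
 Q B D D I G M G E H Z G N,Q C A B I M G E F H C E I,Q C A Z I P F E B H B C E,
 Q C A C Z E P B E H A A A,Q A J K N D G G H F B C E,Q C A C H B P E B H A A A,
 Q A D M N C J G F C P Z N]),Q A D B D F P B D F B C E,Q C B B E C L B E C A A A,
 Q A E L E C K C B G A A A,Q A A B D F P B D F B C E,Q A B B D F P B D F B C E,
 Q A C B D F P B D F B C E,S (R F G [Q A E P K M I F G E C E I,Q C B M G D C E F G A A A,
 Q A L B C H J D G C E M D,Q A F P F D B E G F B C E,Q A A B N L F F H G I D Z,
 Q A F P K M I F G E C E I,Q A K Z F M E C B H E M D,Q A E N M K C E H G C E I,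
 Q C B G M C J E F H A A A,Q A F N D F C F E H B C E,Q A K H I M K F D B C E I,
 Q A A P F D B E G F B C E,Q A Z P K M I F G E C E I,Q C B F Z H P B C E E M D,
 Q B E P E I C E B C C E I,Q C B D F B K E F G A A A,Q C B Z J F P E B D E M D,
 Q C B E L M J B E H A A A,Q A C F D C I G E H B C E,Q B E H L Z I G E B E M D,
 Q B E P K M I F G E C E I,Q A C Z C F B E B G B C E,Q C B D F B M E F G A A A,
 Q C B Z H F I E B C E M D,Q C B D M G B B E C B C E,Q C B D M G L B E C B C E,
 Q C B D M G I B E C B C E,Q C B D M G N B E C B C E,Q C B G M C P E F H A A A,
 Q C B D F B P E F G A A A,Q A F I L M Z F E D E M D,Q A F L M K E H E F C E I]),
 Q C C B E C M B E C A A A,S (R G D [Q A A N Z L P G H E F I L,Q C C F P D E E F G B C E,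
 Q C C I L E F E F H A A A,Q A P K J M I G H E F P M,Q A C Z N I K F E H G I L,
 Q B F P D G B E F H A A A,Q C C F P D H E F G B C E,Q C C I L E G E F H A A A,
 Q A B E P K D E H F C E I,Q A F Z N I J E F G I G F,Q C C C I E J B E C A A A,
 Q A C L P K D E H F C E I,Q C C P F I D E F H B C E,Q C C I F E Z B E G B C E,
 Q C C F I Z K B E H B C E,Q C C F I Z P B E H B C E,Q C C E Z C J E B H A A A,
 Q C C P F L D E F H B C E,Q A A N G F B E H G B C E,Q B F C M I L D B F E M H,
 Q A D N Z L K E F G L G F,Q A A N J L B C B G L J K,Q C C L I Z E E F G A A A,
 Q A A I C M P C F B C E I,Q A M G K Z J C B E Z K J,Q A B N G F B E H G B C E,
 Q B F K J M L H G F P F G,Q A C J N P D C B F P N Z,Q A F J I L E E F H E M H]),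
 Q A H L F D K C D H B C E,S (R C H [Q A H I E D J C D F A A A,Q A A I M L F D C E E M L,
 Q B G D H F L C B H F H J,Q B E D H F N C B E F H N,Q B G D B G N C D H A A A,
 Q B A D B G K C D H A A A,Q A N D B G J C D H A A A,Q A H G E B J E D C B C E,
 Q A D P J H D F E D I H G,Q A C I G D M C B E C E I,Q C D C H B I E B H A A A,
 Q A H K E P J F D E E M L,Q A H P G F N G C H B C E,Q A H N D F C F E H B C E,
 Q C D K C H E B E C A A A,Q C D L F N P B C E B C E,Q C D M H E K E B D A A A,
 Q A A I P F G G E H B C E,Q C D C H B L E B H A A A,Q A M F H M E E C D A A A,
 Q A A I L N M E F H M H K,Q C D D L P J E B C N H D,Q A C P Z L C G C B E M L,
 Q A G D P E J E D G E M L,Q C D M H E N E B D A A A,Q C D C H B N E B H A A A,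
 Q C D D L M K E B C Z H D,Q A B J P B N G H D Z H G,Q C D C H B Z E B H A A A]),
 S (R C H [Q A I Z F C P C B H B C E,Q A B Z L M E D B H E M N,Q B H D H F L C B H F H J,
 Q B B D H F P C B G F H K,Q A Z D H F J C B F F H Z,Q B F D B G Z C D H A A A,
 Q C E I B E G E F H A A A,Q B H J N F K D F C A A A,Q C E D I K G E B H C E I,
 Q B H J I M P B F C I H M,Q A Z M Z F I E C F B C E,Q A I P G F N G C H B C E,
 Q A I N D F C F E H B C E,Q C E K C H E B E C A A A,Q C E L F N J B C E B C E,
 Q C E L F I J B C E B C E,Q A C N P F G G E H B C E,Q A A L P F G G E H B C E,
 Q C E D I J G E B H C E I,Q A D C N J B D F B E M N,Q B F Z J F B G D H A A A,
 Q A B I L N M E F H M H K,Q A B P J K E G D H C E I,Q B H N M F Z C E D B C E,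
 Q C E N E H M B E D A A A,Q C E D I P G E B H C E I,Q A G L I M C E D B C E I,
 Q C E Z C H E B E G A A A,Q A G I C M B C F B C E I,Q C E I J E Z E F G A A A]),
 Q A D B D F P B D F B C E,Q C F B E C N B E C A A A,Q A C B D F P B D F B C E,
 Q A A B D F P B D F B C E,Q A B B D F P B D F B C E,Q A J N E C M C B F A A A,
 S (R G K [Q C F G B K P B E G E Z D,Q C F G B K J B E G E Z D,Q C F F B L C B E C A A A,
 Q C F B G C K B E H E Z D,Q C F B G D K B E H E Z D,Q C F K H E G E F G A A A,
 Q A I B N H J F G H E Z D,Q B C B M G C E G H C E I,Q B G E B H L C H B B C E,
 Q C F M L F D E B D E Z D,Q B I B N H J F G H E Z D,Q B G F B H N C F D A A A,
 Q A F B M G C E G H C E I,Q A I Z L I H C D G J B L,Q A B P L J B C B E J L B,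
 Q A J B N H J F G H E Z D,Q A E B M G C E G H C E I,Q C F M L F P E B D E Z D,
 Q C F K H E L E F G A A A,Q A J I Z J C H F D E Z D,Q C F M L F I E B D E Z D,
 Q A J P J Z D H C E E Z D,Q C F H K M E E F H A A A,Q A P B N H J F G H E Z D,
 Q A B I N Z B C D G P B L,Q A H B N H J F G H E Z D,Q A I J N P H C B E P N H]),
 Q C G B E C Z B E C A A A,S (R G K [Q C G B D E L B D E A A A,Q A F C P F M F H E D G M,
 Q A I P I N B D G C E Z J,Q B H C H E L C D G F B L,Q A E L H N D F G H E Z J,
 Q A A B F C N B E D A A A,Q B D D B G K C D H A A A,Q C G N K G E E F H A A A,
 Q B H L H N D F G H E Z J,Q C G N M H F E B D B C E,Q B D B E G M D B F C E I,
 Q B H L M G C E G H C E I,Q B D L H N D F G H E Z J,Q C G N M G F E B D B C E,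
 Q A H C F E P G B E A A A,Q C G K N E L E F G A A A,Q A H N J L D C B E L J D,
 Q C G N M K F E B D B C E,Q C G K N E M E F G A A A,Q A B L H N D F G H E Z J,
 Q A D C P F G H F G M J D,Q A B K G H E D F E A A A,Q C G G N K F B E H C E I,
 Q C G G N K C B E H C E I,Q C G C H B P E B H A A A,Q C G N L P F B E H P L B,
 Q C G N L J D B E H P N H]),Q A A B D F P B D F B C E,R H D [Q B B L Z N J F H E G I N,
 Q C H N H G C E F D E P C,Q B K I F G B E H F A A A,Q A E B I L G H G E E P C,
 Q C H I D F C E F G E P C,Q C H E I C H E B C A A A,Q B K I C G B E B D B C E,
 Q C H N H G D E F D E P C,Q A E B I M G H D B C E I,Q B B M Z K J F B C H Z K,
 Q C H C I E B B E C A A A,Q A K Z M I H C E B I H M,Q A F P M F B D H C B C E,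
 Q C H D E B I E F C A A A,Q B K I M G B C H D E P C,Q A K Z L I H C D G J B L,
 Q C H F N G P B C E E P C,Q A D P L J B C B E J L B,Q B K I L G B C B F C E I,
 Q C H D E B J E F C A A A,Q A G L B F C B E D B C E,Q A J F B M L H E F C E I,
 Q C H D E B K E F C A A A,Q A J L B C F B C F A A A,Q C H N H G P E F D E P C,
 Q B E M I G F H D C A A A,Q A G M B C F B C F A A A,Q C H D E B M E F C A A A,
 Q A J C B L M H C D E P C,Q C H N H G J E F D E P C,Q A J M B F C B E D B C E,
 Q B E I K G F G C D B C E],Q A G P L N D D B G E P G,Q A G I N L C D C F E P H,
 Q A E I N L E D C H E P K,Q A E P L N F D B E E P N])"
text \<open>Up to affine maps there are two ways to add a codeword with first row \<open>C\<close>
  to zero and \<open>X B C E\<close>, represented by \<open>X C D I\<close> and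
  \<open>X C E I\<close>. They are treated by the first subtree and by \<open>cert28\<close>; every
  other candidate points to a copy of one of the two.\<close>

definition cert29 where "cert29 = S (R B C [S (R B D [cert5,cert11,Q A A C D E I D B E A A A,Q A A D B E I C D E A A A,cert18,
 Q A A B D E M B D E B C E,cert19,cert20,Q A I B D F P B D F B C E,Q A I B C F K B C F A A A,
 Q A E B C F K B C F A A A,Q A A B C F K B C F A A A,Q A A B C G L B C G A A A,
 Q A E B C G L B C G A A A,Q A I B D G N B D H B C E,Q A I B C G L B C G A A A,
 Q A E B C H J B C H A A A,Q A A B C H J B C H A A A,Q A I B D H Z B D G B C E,
 Q A I B C H J B C H A A A,Q A E C B L G B D H A A A,Q A A C B L G B D H A A A,
 Q A I C D L N B C G C D I,Q A I C B L G B D H A A A,Q A I C D K P B C F C D I,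
 Q A I C B K F B D F A A A,Q A E C B K F B D F A A A,Q A A C B K F B D F A A A,
 Q A A C B J H B D G A A A,Q A E C B J H B D G A A A,Q A I C D J Z B C H C D I,
 Q A I C B J H B D G A A A,Q A I C B I E B D E A A A,Q A I C D I M B C E C D I,
 Q A E C B I E B D E A A A,Q A A C B I E B D E A A A,Q A E D B Z H B C H B C E,
 Q A A D B Z H B C H B C E,Q A I D C Z J B D G C D I,Q A I D B Z H B C H B C E,
 Q A I D C P K B D F C D I,Q A I D B P F B C F B C E,Q A E D B P F B C F B C E,
 Q A A D B P F B C F B C E,Q A I D B M E B C E B C E,Q A I D C M I B D E C D I,
 Q A E D B M E B C E B C E,Q A A D B M E B C E B C E,Q A A D B N G B C G B C E,
 Q A E D B N G B C G B C E,Q A I D C N L B D H C D I,Q A I D B N G B C G B C E]),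
 Q A A B C E J B C E A A A,Q A A B C E K B C E A A A,Q A A B C E L B C E A A A,
 Q A A B C E M B C E A A A,Q A A B C E N B C E A A A,Q A A B C E Z B C E A A A,
 Q A A B C E P B C E A A A,cert28,Q A A B C E J B C E A A A,Q A A B C E K B C E A A A,
 Q A A B C E L B C E A A A,Q A A B C E M B C E A A A,Q A A B C E N B C E A A A,
 Q A A B C E Z B C E A A A,Q A A B C E P B C E A A A,Q A A B C F K B C F A A A,
 Q A A B C F L B C F A A A,Q A A B C F I B C F A A A,Q A A B C F J B C F A A A,
 Q A A B C F Z B C F A A A,Q A A B C F P B C F A A A,Q A A B C F M B C F A A A,
 Q A A B C F N B C F A A A,Q A A B C G Z B C G A A A,Q A A B C G P B C G A A A,
 Q A A B C G M B C G A A A,Q A A B C G N B C G A A A,Q A A B C G K B C G A A A,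
 Q A A B C G L B C G A A A,Q A A B C G I B C G A A A,Q A A B C G J B C G A A A,
 Q A A B C H N B C H A A A,Q A A B C H M B C H A A A,Q A A B C H P B C H A A A,
 Q A A B C H Z B C H A A A,Q A A B C H J B C H A A A,Q A A B C H I B C H A A A,
 Q A A B C H L B C H A A A,Q A A B C H K B C H A A A,Q A A I C B E C B E A A A,
 Q A A I C B F C B G A A A,Q A A E F H P D G B A A A,Q A A F E G Z D G C A A A,
 Q A A G B C I C E F A A A,Q A A H B C I C E H A A A,Q A A H G E M D G E A A A,
 Q A A G H F N D G H A A A,Q A A J C B E C B E A A A,Q A A J C B F C B G A A A,
 Q A A E F H Z D G B A A A,Q A A F E G P D G C A A A,Q A A G B C J C E F A A A,
 Q A A H B C J C E H A A A,Q A A H G E N D G E A A A,Q A A G H F M D G H A A A,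
 Q A A K C B E C B E A A A,Q A A K C B F C B G A A A,Q A A E F H N D G B A A A,
 Q A A F E G M D G C A A A,Q A A H B C K C E H A A A,Q A A G B C K C E F A A A,
 Q A A G H F P D G H A A A,Q A A H G E Z D G E A A A,Q A A L C B E C B E A A A,
 Q A A L C B F C B G A A A,Q A A E F H M D G B A A A,Q A A F E G N D G C A A A,
 Q A A H B C L C E H A A A,Q A A G B C L C E F A A A,Q A A G H F Z D G H A A A,
 Q A A H G E P D G E A A A,Q A A M C B E C B E A A A,Q A A M C B F C B G A A A,
 Q A A E F H L D G B A A A,Q A A F E G K D G C A A A,Q A A H G E I D G E A A A,
 Q A A G H F J D G H A A A,Q A A G B C M C E F A A A,Q A A H B C M C E H A A A,
 Q A A N C B E C B E A A A,Q A A N C B F C B G A A A,Q A A E F H K D G B A A A,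
 Q A A F E G L D G C A A A,Q A A H G E J D G E A A A,Q A A G H F I D G H A A A,
 Q A A G B C N C E F A A A,Q A A H B C N C E H A A A,Q A A Z C B E C B E A A A,
 Q A A Z C B F C B G A A A,Q A A E F H J D G B A A A,Q A A F E G I D G C A A A,
 Q A A G H F L D G H A A A,Q A A H G E K D G E A A A,Q A A H B C Z C E H A A A,
 Q A A G B C Z C E F A A A,Q A A P C B E C B E A A A,Q A A P C B F C B G A A A,
 Q A A E F H I D G B A A A,Q A A F E G J D G C A A A,Q A A G H F K D G H A A A,
 Q A A H G E L D G E A A A,Q A A H B C P C E H A A A,Q A A G B C P C E F A A A])"
text \<open>Every full matrix with first row \<open>B\<close> arises from \<open>X B C E\<close> by
  an invertible right factor. So only the first branch at the root is worked out, and the others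
  point back to it with the identity \<open>B\<close>, \<open>C\<close>, \<open>E\<close> as left
  factor and no translation.\<close>

definition cert where "cert = R B B [cert29,Q A A B C F I B C E A A A,Q A A B C G I B C E A A A,Q A A B C H I B C E A A A,
 Q A A B C I E B C E A A A,Q A A B C J E B C E A A A,Q A A B C K E B C E A A A,
 Q A A B C L E B C E A A A,Q A A B C M E B C E A A A,Q A A B C N E B C E A A A,
 Q A A B C Z E B C E A A A,Q A A B C P E B C E A A A,Q A A B D E I B C E A A A,
 Q A A B D F I B C E A A A,Q A A B D G I B C E A A A,Q A A B D H I B C E A A A,
 Q A A B D I E B C E A A A,Q A A B D J E B C E A A A,Q A A B D K E B C E A A A,
 Q A A B D L E B C E A A A,Q A A B D M E B C E A A A,Q A A B D N E B C E A A A,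
 Q A A B D Z E B C E A A A,Q A A B D P E B C E A A A,Q A A B E C I B C E A A A,
 Q A A B E D I B C E A A A,Q A A B E G I B C E A A A,Q A A B E H I B C E A A A,
 Q A A B E I C B C E A A A,Q A A B E J C B C E A A A,Q A A B E K C B C E A A A,
 Q A A B E L C B C E A A A,Q A A B E M C B C E A A A,Q A A B E N C B C E A A A,
 Q A A B E Z C B C E A A A,Q A A B E P C B C E A A A,Q A A B F C I B C E A A A,
 Q A A B F D I B C E A A A,Q A A B F G I B C E A A A,Q A A B F H I B C E A A A,
 Q A A B F I C B C E A A A,Q A A B F J C B C E A A A,Q A A B F K C B C E A A A,
 Q A A B F L C B C E A A A,Q A A B F M C B C E A A A,Q A A B F N C B C E A A A,
 Q A A B F Z C B C E A A A,Q A A B F P C B C E A A A,Q A A B G C I B C E A A A,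
 Q A A B G D I B C E A A A,Q A A B G E I B C E A A A,Q A A B G F I B C E A A A,
 Q A A B G I C B C E A A A,Q A A B G J C B C E A A A,Q A A B G K C B C E A A A,
 Q A A B G L C B C E A A A,Q A A B G M C B C E A A A,Q A A B G N C B C E A A A,
 Q A A B G Z C B C E A A A,Q A A B G P C B C E A A A,Q A A B H C I B C E A A A,
 Q A A B H D I B C E A A A,Q A A B H E I B C E A A A,Q A A B H F I B C E A A A,
 Q A A B H I C B C E A A A,Q A A B H J C B C E A A A,Q A A B H K C B C E A A A,
 Q A A B H L C B C E A A A,Q A A B H M C B C E A A A,Q A A B H N C B C E A A A,
 Q A A B H Z C B C E A A A,Q A A B H P C B C E A A A,Q A A B I C E B C E A A A,
 Q A A B I D E B C E A A A,Q A A B I E C B C E A A A,Q A A B I F C B C E A A A,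
 Q A A B I G C B C E A A A,Q A A B I H C B C E A A A,Q A A B I K E B C E A A A,
 Q A A B I L E B C E A A A,Q A A B I M C B C E A A A,Q A A B I N C B C E A A A,
 Q A A B I Z C B C E A A A,Q A A B I P C B C E A A A,Q A A B J C E B C E A A A,
 Q A A B J D E B C E A A A,Q A A B J E C B C E A A A,Q A A B J F C B C E A A A,
 Q A A B J G C B C E A A A,Q A A B J H C B C E A A A,Q A A B J K E B C E A A A,
 Q A A B J L E B C E A A A,Q A A B J M C B C E A A A,Q A A B J N C B C E A A A,
 Q A A B J Z C B C E A A A,Q A A B J P C B C E A A A,Q A A B K C E B C E A A A,
 Q A A B K D E B C E A A A,Q A A B K E C B C E A A A,Q A A B K F C B C E A A A,
 Q A A B K G C B C E A A A,Q A A B K H C B C E A A A,Q A A B K I E B C E A A A,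
 Q A A B K J E B C E A A A,Q A A B K M C B C E A A A,Q A A B K N C B C E A A A,
 Q A A B K Z C B C E A A A,Q A A B K P C B C E A A A,Q A A B L C E B C E A A A,
 Q A A B L D E B C E A A A,Q A A B L E C B C E A A A,Q A A B L F C B C E A A A,
 Q A A B L G C B C E A A A,Q A A B L H C B C E A A A,Q A A B L I E B C E A A A,
 Q A A B L J E B C E A A A,Q A A B L M C B C E A A A,Q A A B L N C B C E A A A,
 Q A A B L Z C B C E A A A,Q A A B L P C B C E A A A,Q A A B M C E B C E A A A,
 Q A A B M D E B C E A A A,Q A A B M E C B C E A A A,Q A A B M F C B C E A A A,
 Q A A B M G C B C E A A A,Q A A B M H C B C E A A A,Q A A B M I C B C E A A A,
 Q A A B M J C B C E A A A,Q A A B M K C B C E A A A,Q A A B M L C B C E A A A,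
 Q A A B M Z E B C E A A A,Q A A B M P E B C E A A A,Q A A B N C E B C E A A A,
 Q A A B N D E B C E A A A,Q A A B N E C B C E A A A,Q A A B N F C B C E A A A,
 Q A A B N G C B C E A A A,Q A A B N H C B C E A A A,Q A A B N I C B C E A A A,
 Q A A B N J C B C E A A A,Q A A B N K C B C E A A A,Q A A B N L C B C E A A A,
 Q A A B N Z E B C E A A A,Q A A B N P E B C E A A A,Q A A B Z C E B C E A A A,
 Q A A B Z D E B C E A A A,Q A A B Z E C B C E A A A,Q A A B Z F C B C E A A A,
 Q A A B Z G C B C E A A A,Q A A B Z H C B C E A A A,Q A A B Z I C B C E A A A,
 Q A A B Z J C B C E A A A,Q A A B Z K C B C E A A A,Q A A B Z L C B C E A A A,
 Q A A B Z M E B C E A A A,Q A A B Z N E B C E A A A,Q A A B P C E B C E A A A,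
 Q A A B P D E B C E A A A,Q A A B P E C B C E A A A,Q A A B P F C B C E A A A,
 Q A A B P G C B C E A A A,Q A A B P H C B C E A A A,Q A A B P I C B C E A A A,
 Q A A B P J C B C E A A A,Q A A B P K C B C E A A A,Q A A B P L C B C E A A A,
 Q A A B P M E B C E A A A,Q A A B P N E B C E A A A]"

lemmas cert_defs =
  cert1_def cert2_def cert3_def cert4_def cert5_def cert6_def cert7_def cert8_def cert9_def
  cert10_def cert11_def cert12_def cert13_def cert14_def cert15_def cert16_def cert17_def
  cert18_def cert19_def cert20_def cert21_def cert22_def cert23_def cert24_def cert25_def
  cert26_def cert27_def cert28_def cert29_def cert_def

section \<open>Outcome of the search and the number of types\<close>

definition accepted :: "'a option \<Rightarrow> bool" where
  "accepted r \<longleftrightarrow> r \<noteq> None"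

lemma accepted_Some: "accepted (Some e) = True"
  by (simp add: accepted_def)

text \<open>This is the exhaustive search, carried out by rewriting. It starts from the zero
  codeword, with all full matrices as candidates and the representatives as known
  configurations.\<close>

lemma cert_accepted: "accepted (check cert [X A A A] (prune (X A A A) [] mats) reps)"
  by (simp only: cert_defs reps_def mats_def nibs_def list.map concat.simps eval_simps accepted_Some)

lemma MRD_code_reps: "r \<in> set reps \<Longrightarrow> MRD_code 3 (mvec ` set r)"
  using good_reps unfolding list_all_iff by (intro good_MRD_code) (rule bspec, assumption+)+

definition rep_codes :: "(bit ^ 4 ^ 3) set list" where
  "rep_codes = map (\<lambda>r. mvec ` set r) reps"

lemma set_rep_codes: "\<C> \<in> set rep_codes \<longleftrightarrow> (\<exists>r\<in>set reps. \<C> = mvec ` set r)"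
  unfolding rep_codes_def by auto

lemma invariants_rep_codes: "map code_invariant rep_codes = map list_invariant reps"
proof -
  have "code_invariant (mvec ` set r) = list_invariant r" if "r \<in> set reps" for r
    using good_reps(1) that unfolding list_all_iff by (intro code_invariant_list good_distinct) (rule bspec)
  then show ?thesis unfolding rep_codes_def by simp
qed

lemma num_code_types: "num_iso_types {\<C> :: (bit ^ 4 ^ 3) set. MRD_code 3 \<C>} code_isomorphic = 37"
proof -
  have "num_iso_types {\<C> :: (bit ^ 4 ^ 3) set. MRD_code 3 \<C>} code_isomorphic = length rep_codes"
  proof (rule num_iso_types_reps[OF equivp_code_isomorphic])
    show "set rep_codes \<subseteq> {\<C>. MRD_code 3 \<C>}"
      using MRD_code_reps by (auto simp: set_rep_codes)
    show "\<exists>\<D>\<in>set rep_codes. code_isomorphic \<D> \<C>" if "\<C> \<in> {\<C>. MRD_code 3 \<C>}" for \<C>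
    proof -
      have "check cert [X A A A] (prune (X A A A) [] mats) reps \<noteq> None"
        using cert_accepted unfolding accepted_def .
      then have "\<exists>r\<in>set reps. code_isomorphic (mvec ` set r) \<C>"
        by (rule check_classifies[OF _ MRD_code_reps]) (use that in simp_all)
      then show ?thesis using set_rep_codes by blast
    qed
    \<comment> \<open>Pairwise different invariants give at once that the list has no repetitions
      and that isomorphic members are equal.\<close>
    have "distinct (map code_invariant rep_codes)"
      unfolding invariants_rep_codes by (rule distinct_invariants)
    then have "distinct rep_codes" and inj: "inj_on code_invariant (set rep_codes)"
      by (simp_all only: distinct_map)
    then show "distinct rep_codes" by blast
    show "\<C> = \<D>" if "\<C> \<in> set rep_codes" "\<D> \<in> set rep_codes" "code_isomorphic \<C> \<D>" for \<C> \<D>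
      using code_invariant_isomorphic[OF that(3)] that(1,2) by (rule inj_onD[OF inj])
  qed
  also have "length rep_codes = length (map list_invariant reps)" by (simp add: rep_codes_def)
  also have "\<dots> = 37" unfolding invariants_reps by simp
  finally show ?thesis .
qed

hide_const (open) A B C D E F G H I J K L M N Z P Q R S T U X

theorem theorem5p3:
  shows "num_iso_types
           {P :: (bit ^ 7) set set.
              vector_space_partition P \<and> vsp_type P = replicate_mset 16 3 + replicate_mset 1 4}
           vsp_isomorphic = 37 \<and>
         num_iso_types {C :: (bit ^ 4 ^ 3) set. MRD_code 3 C} code_isomorphic = 37"
proof
  show "num_iso_types {C :: (bit ^ 4 ^ 3) set. MRD_code 3 C} code_isomorphic = 37"
    by (rule num_code_types)
  then show "num_iso_types
           {P :: (bit ^ 7) set set.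
              vector_space_partition P \<and> vsp_type P = replicate_mset 16 3 + replicate_mset 1 4}
           vsp_isomorphic = 37"
    by (rule num_partitions_eq_num_codes) simp
qed

end
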